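(* Let $$D=\widetilde X_{12}^4+\widetilde X_{13}^4+\widetilde X_{23}^4-2\widetilde X_{12}^2\widetilde X_{13}^2-2\widetilde X_{12}^2\widetilde X_{23}^2-2\widetilde X_{13}^2\widetilde X_{23}^2+4\widetilde X_{23}^2,\qquad s=\widetilde X_{12}^2+\widetilde X_{13}^2-\widetilde X_{23}^2-2.$$ Then, in $\mathbb C(\kappa)[[\widetilde X_{12},\widetilde X_{13},\widetilde X_{23}]]$, $$\Omega_-(\widetilde X_{12},\widetilde X_{13},\widetilde X_{23}|\kappa)=\frac{1}{\kappa(\kappa^2-1)}\cdot\frac{-2\,\operatorname{arctanh}\!\left(\sqrt D/s\right)}{\sqrt D},$$ where the right-hand side (an even function of $\sqrt D$) is understood as the power series $\frac{-2}{\kappa(\kappa^2-1)}\cdot\frac1s\sum_{k\ge0}\frac{D^k}{(2k+1)s^{2k}}$ expanded at the origin (note $s=-2$ at the origin).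
   Context: A triple $(j_1,j_2,j_3)$ of nonnegative integers is admissible if $|j_1-j_2|\le j_3\le j_1+j_2$ and $j_1+j_2+j_3$ is even; $\mathbf J$ denotes the set of admissible triples. Let $\mathcal H=\mathbb C[x_{12}+x_{12}^{-1},x_{13}+x_{13}^{-1},x_{23}+x_{23}^{-1}]\subset\mathbb C[x_{12}^{\pm1},x_{13}^{\pm1},x_{23}^{\pm1}]$. For $a,b\in\{\pm1\}$ set $K_{a,b}(j_1,j_2,j_3)=ab\,\frac{(aj_1+bj_2+j_3+a+b+2)(aj_1+bj_2-j_3+a+b)}{4(j_1+1)(j_2+1)}$. The genus two Schur polynomials $(\phi_{j_1,j_2,j_3})_{(j_1,j_2,j_3)\in\mathbf J}$ are the unique family in $\mathcal H$ with $\phi_{0,0,0}=1$ such that for all admissible $(j_1,j_2,j_3)$: $(x_{12}+x_{12}^{-1})\phi_{j_1,j_2,j_3}=\sum_{a,b\in\{\pm1\}}K_{a,b}(j_1,j_2,j_3)\phi_{j_1+a,j_2+b,j_3}$, $(x_{13}+x_{13}^{-1})\phi_{j_1,j_2,j_3}=\sum_{a,b\in\{\pm1\}}K_{a,b}(j_1,j_3,j_2)\phi_{j_1+a,j_2,j_3+b}$, $(x_{23}+x_{23}^{-1})\phi_{j_1,j_2,j_3}=\sum_{a,b\in\{\pm1\}}K_{a,b}(j_2,j_3,j_1)\phi_{j_1,j_2+a,j_3+b}$, where $\phi$ of a non-admissible triple is interpreted as $0$. Genus two Cauchy sums: $\mathcal C_-=\sum_{(j_1,j_2,j_3)\in\mathbf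 J}\phi_{j_1,j_2,j_3}(\kappa^{j_1+1}-\kappa^{-j_1-1})\lambda^{j_2+j_3}$ and $\mathcal C_+=\kappa\partial_\kappa\mathcal C_-=\sum_{(j_1,j_2,j_3)\in\mathbf J}(j_1+1)\phi_{j_1,j_2,j_3}(\kappa^{j_1+1}+\kappa^{-j_1-1})\lambda^{j_2+j_3}$, formal power series in $\lambda$. After substituting $x_{ij}=1+(1-\lambda/\kappa)\widetilde X_{ij}$ and expanding $\mathcal C_\pm=\sum_m C^\pm_m(\kappa,\lambda)\widetilde X^m$ (multi-index $m=(m_{12},m_{13},m_{23})$), each $C^\pm_m$ is a rational function of $(\kappa,\lambda)$, and as a function of $\lambda$ over $\mathbb C(\kappa)$, $C^-_m$ has pole order at most $2$ and $C^+_m$ pole order at most $3$ at $\lambda=\kappa$. The leading terms are the formal power series in $\mathbb C(\kappa)[[\widetilde X_{12},\widetilde X_{13},\widetilde X_{23}]]$ $$\Omega_-=\sum_m\Big(\big[(1-\lambda/\kappa)^2C^-_m(\kappa,\lambda)\big]_{\lambda=\kappa}\Big)\widetilde X^m,\qquad \Omega_+=\sum_m\Big(\big[(1-\lambda/\kappa)^3C^+_m(\kappa,\lambda)\big]_{\lambda=\kappa}\Big)\widetilde X^m,$$ i.e. the coefficients of $(1-\lambda/\kappa)^{-2}$, resp. $(1-\lambda/\kappa)^{-3}$, in the Laurent expansions at $\lambda=\kappa$. *)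

theory Defs
  imports "HOL-Computational_Algebra.Computational_Algebra"
begin

type_synonym ratf = "complex poly fract"

definition kap :: ratf where "kap = Fract [:0, 1:] 1"

definition cst :: "complex \<Rightarrow> ratf" where "cst c = Fract [:c:] 1"

(* Admissible triples (indices as integers, so that j-1 makes sense). *)
definition adm :: "int \<times> int \<times> int \<Rightarrow> bool" where
  "adm j = (case j of (j1, j2, j3) \<Rightarrow>
     0 \<le> j1 \<and> 0 \<le> j2 \<and> 0 \<le> j3 \<and> \<bar>j1 - j2\<bar> \<le> j3 \<and> j3 \<le> j1 + j2 \<and> even (j1 + j2 + j3))"

definition Kab :: "int \<Rightarrow> int \<Rightarrow> int \<Rightarrow> int \<Rightarrow> int \<Rightarrow> complex" where
  "Kab a b j1 j2 j3 =
     of_int (a * b) * of_int ((a*j1 + b*j2 + j3 + a + b + 2) * (a*j1 + b*j2 - j3 + a + b))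
     / of_int (4 * (j1 + 1) * (j2 + 1))"

(* H = C[y12, y13, y23] with y_ij = x_ij + x_ij^-1 (algebraically independent),
   represented as nested polynomials: innermost variable y12, middle y13, outer y23. *)
type_synonym poly3 = "complex poly poly poly"

definition Y12 :: poly3 where "Y12 = [:[:[:0, 1:]:]:]"
definition Y13 :: poly3 where "Y13 = [:[:0, 1:]:]"
definition Y23 :: poly3 where "Y23 = [:0, 1:]"
definition C3 :: "complex \<Rightarrow> poly3" where "C3 c = [:[:[:c:]:]:]"

definition sgns :: "int set" where "sgns = {-1, 1}"

definition schur_family :: "(int \<times> int \<times> int \<Rightarrow> poly3) \<Rightarrow> bool" where
  "schur_family \<Phi> \<longleftrightarrow>
     \<Phi> (0, 0, 0) = 1 \<and>
     (\<forall>j. \<not> adm j \<longrightarrow> \<Phi> j = 0) \<and>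
     (\<forall>j1 j2 j3. adm (j1, j2, j3) \<longrightarrow>
        Y12 * \<Phi> (j1, j2, j3) = (\<Sum>a\<in>sgns. \<Sum>b\<in>sgns. C3 (Kab a b j1 j2 j3) * \<Phi> (j1 + a, j2 + b, j3)) \<and>
        Y13 * \<Phi> (j1, j2, j3) = (\<Sum>a\<in>sgns. \<Sum>b\<in>sgns. C3 (Kab a b j1 j3 j2) * \<Phi> (j1 + a, j2, j3 + b)) \<and>
        Y23 * \<Phi> (j1, j2, j3) = (\<Sum>a\<in>sgns. \<Sum>b\<in>sgns. C3 (Kab a b j2 j3 j1) * \<Phi> (j1, j2 + a, j3 + b)))"

definition phi :: "int \<times> int \<times> int \<Rightarrow> poly3" where
  "phi = (THE \<Phi>. schur_family \<Phi>)"

definition eval3 :: "(complex \<Rightarrow> 'r::comm_ring_1) \<Rightarrow> poly3 \<Rightarrow> 'r \<Rightarrow> 'r \<Rightarrow> 'r \<Rightarrow> 'r" where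
  "eval3 emb p a b c =
     poly (map_poly (\<lambda>q. poly (map_poly (\<lambda>r. poly (map_poly emb r) a) q) b) p) c"

definition ring_inv :: "'a::comm_ring_1 \<Rightarrow> 'a" where
  "ring_inv x = (THE w. x * w = 1)"

(* The ring C(kappa)[[lambda]][[X23]][[X13]][[X12]]:
   coefficient of X12^m1 X13^m2 X23^m3 lambda^n of F is  F $ m1 $ m2 $ m3 $ n. *)
type_synonym ring4 = "ratf fps fps fps fps"

definition emb4 :: "ratf \<Rightarrow> ring4" where
  "emb4 k = fps_const (fps_const (fps_const (fps_const k)))"

definition XX12 :: ring4 where "XX12 = fps_X"
definition XX13 :: ring4 where "XX13 = fps_const fps_X"
definition XX23 :: ring4 where "XX23 = fps_const (fps_const fps_X)"
definition lam :: ring4 where "lam = fps_const (fps_const (fps_const fps_X))"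

definition tt :: ring4 where "tt = 1 - lam * emb4 (inverse kap)"
definition yy :: "ring4 \<Rightarrow> ring4" where
  "yy X = (1 + tt * X) + ring_inv (1 + tt * X)"

definition Cterm :: "int \<times> int \<times> int \<Rightarrow> ring4" where
  "Cterm j = (case j of (j1, j2, j3) \<Rightarrow>
     eval3 (\<lambda>c. emb4 (cst c)) (phi j) (yy XX12) (yy XX13) (yy XX23)
     * emb4 (kap ^ (nat j1 + 1) - inverse kap ^ (nat j1 + 1)) * lam ^ nat (j2 + j3))"

(* C^-_m as a formal power series in lambda over C(kappa). The summand for j is divisible
   by lambda^(j2+j3), so only the finitely many j with j2+j3 <= n contribute to lambda^n. *)
definition Cminus :: "nat \<Rightarrow> nat \<Rightarrow> nat \<Rightarrow> ratf fps" where
  "Cminus m1 m2 m3 = Abs_fps (\<lambda>n.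
     \<Sum>j\<in>{j. adm j \<and> fst (snd j) + snd (snd j) \<le> int n}. Cterm j $ m1 $ m2 $ m3 $ n)"

(* Coefficient of (1 - lambda/kappa)^(-2) in the Laurent expansion at lambda = kappa of a
   rational function f in lambda (given by its power series at 0) with pole order <= 2 there:
   f = P / (Q * (1 - lambda/kappa)^2) with Q(kappa) <> 0, value P(kappa)/Q(kappa). *)
definition lead2 :: "ratf fps \<Rightarrow> ratf" where
  "lead2 f = (THE c. \<exists>P Q :: ratf poly. poly Q kap \<noteq> 0 \<and>
      fps_of_poly (Q * [:1, - inverse kap:] ^ 2) * f = fps_of_poly P \<and>
      c = poly P kap / poly Q kap)"

definition Omega_minus :: "nat \<Rightarrow> nat \<Rightarrow> nat \<Rightarrow> ratf" where
  "Omega_minus m1 m2 m3 = lead2 (Cminus m1 m2 m3)"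

type_synonym ring3 = "ratf fps fps fps"

definition emb3 :: "ratf \<Rightarrow> ring3" where
  "emb3 k = fps_const (fps_const (fps_const k))"

definition Z12 :: ring3 where "Z12 = fps_X"
definition Z13 :: ring3 where "Z13 = fps_const fps_X"
definition Z23 :: ring3 where "Z23 = fps_const (fps_const fps_X)"

definition DD :: ring3 where
  "DD = Z12^4 + Z13^4 + Z23^4 - 2 * Z12^2 * Z13^2 - 2 * Z12^2 * Z23^2 - 2 * Z13^2 * Z23^2
        + 4 * Z23^2"

definition ss :: ring3 where "ss = Z12^2 + Z13^2 - Z23^2 - 2"

definition rhs_term :: "nat \<Rightarrow> ring3" where
  "rhs_term k = emb3 (-2 / (kap * (kap^2 - 1))) * emb3 (inverse (of_nat (2 * k + 1)))
                * DD ^ k * ring_inv ss ^ (2 * k + 1)"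

(* D has order >= 2, so D^k contributes to X^m only if 2k <= |m|; the sum is exact. *)
definition Omega_rhs :: "nat \<Rightarrow> nat \<Rightarrow> nat \<Rightarrow> ratf" where
  "Omega_rhs m1 m2 m3 = (\<Sum>k\<le>m1 + m2 + m3. rhs_term k $ m1 $ m2 $ m3)"

end

theory Submission
  imports Defs
begin

text \<open>
  In terms of \<open>j\<^sub>1 = a + b\<close>, \<open>j\<^sub>2 = a + c\<close>, \<open>j\<^sub>3 = b + c\<close> the polynomial \<open>\<phi>\<close> is the normalised spin network of
  the theta graph. Put \<open>A = y\<^sub>1\<^sub>2 - 2\<close>, \<open>B = y\<^sub>1\<^sub>3 - 2\<close>, \<open>C = y\<^sub>2\<^sub>3 - 2\<close>, where \<open>y = x + 1/x\<close>, \<open>E = 1 + U + V + W\<close> and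
  \<open>\<rho> = (1 - A(UE - VW) - B(VE - UW) - C(WE - UV))\<^sup>2
     + 4 UVWE (A\<^sup>2 + B\<^sup>2 + C\<^sup>2 - 2AB - 2AC - 2BC - ABC)\<close>.
  If \<open>g\<^sub>p\<^sub>q\<^sub>r\<close> are the coefficients of \<open>g = 1 / \<surd>\<rho>\<close>, then \<open>\<phi>\<close> is the sum of
  \<open>g\<^sub>p\<^sub>q\<^sub>r a\<^sup>[\<^sup>p\<^sup>] b\<^sup>[\<^sup>q\<^sup>] c\<^sup>[\<^sup>r\<^sup>] / (p + q + r + 1)!\<close> with falling factorials: the three recurrences
  are second order differential equations for \<open>g\<close>, which reduce to one polynomial identity in \<open>\<rho>\<close>.

  Since \<open>A\<close>, \<open>B\<close>, \<open>C\<close> have order 2 in \<open>X\<close>, the coefficient \<open>g\<^sub>p\<^sub>q\<^sub>r\<close> has order at least \<open>p + q + r\<close>, and the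
  substitution \<open>x = 1 + \<tau> X\<close>, \<open>\<tau> = 1 - \<lambda>/\<kappa>\<close>, multiplies its coefficient of \<open>X\<^sup>m\<close> by \<open>\<tau>\<close> to the power \<open>|m|\<close>.
  Summing the falling factorials over \<open>a\<close>, \<open>b\<close>, \<open>c\<close> gives a pole of order \<open>p + q + 2\<close>, so only \<open>r = 0\<close> and
  \<open>p + q = |m|\<close> contribute to the leading term. At \<open>W = 0\<close> the series \<open>g\<close> is geometric, and the weights
  \<open>p! q! / (p + q + 1)!\<close> turn it into the integral over \<open>\<theta>\<close> from 0 to 1 of the inverse of
  \<open>1 - \<theta> X\<^sub>1\<^sub>2\<^sup>2 - (1 - \<theta>) X\<^sub>1\<^sub>3\<^sup>2 + \<theta> (1 - \<theta>) X\<^sub>2\<^sub>3\<^sup>2\<close>, a quadratic polynomial in \<open>\<theta>\<close> with discriminant \<open>D\<close>.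
\<close>

section \<open>The differential equation of the theta series\<close>

definition derivation :: "('r::comm_ring_1 \<Rightarrow> 'r) \<Rightarrow> bool" where
  "derivation d \<longleftrightarrow> (\<forall>x y. d (x + y) = d x + d y) \<and> (\<forall>x y. d (x * y) = d x * y + x * d y)"

lemma derivationI:
  assumes "\<And>x y. d (x + y) = d x + d y" and "\<And>x y. d (x * y) = d x * y + x * d y"
  shows "derivation d"
  using assms by (simp add: derivation_def)

lemma
  assumes "derivation (d :: 'r::comm_ring_1 \<Rightarrow> 'r)"
  shows derivation_add: "d (x + y) = d x + d y"
    and derivation_mult: "d (x * y) = d x * y + x * d y"
    and derivation_0: "d 0 = 0"
    and derivation_1: "d 1 = 0"
    and derivation_uminus: "d (- x) = - d x"
    and derivation_diff: "d (x - y) = d x - d y"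
    and derivation_of_nat: "d (of_nat n) = 0"
    and derivation_numeral: "d (numeral k) = 0"
proof -
  show add: "d (x + y) = d x + d y" for x y
    using assms by (simp add: derivation_def)
  show mult: "d (x * y) = d x * y + x * d y" for x y
    using assms by (simp add: derivation_def)
  show zero: "d 0 = 0" using add[of 0 0] by simp
  show one: "d 1 = 0" using mult[of 1 1] by simp
  show um: "d (- x) = - d x" for x
    using add[of x "- x"] zero by (simp add: eq_neg_iff_add_eq_0 add.commute)
  show "d (x - y) = d x - d y"
    using add[of x "- y"] um[of y] by simp
  show nat: "d (of_nat n) = 0" for n
    by (induction n) (simp_all add: zero add one)
  show "d (numeral k) = 0"
    using nat[of "numeral k"] by simp
qed

lemmas derivation_simps = derivation_add derivation_mult derivation_0 derivation_1
  derivation_uminus derivation_diff derivation_of_nat derivation_numeral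

text \<open>Differentiating \<open>g * g * \<rho> = 1\<close> and cancelling one factor
  \<open>g\<close> gives the chain rule for the inverse square root, with the denominator
  cleared.\<close>

lemma derivation_inverse_sqrt:
  fixes d :: "'r::idom \<Rightarrow> 'r"
  assumes d: "derivation d" and g: "g * g * \<rho> = 1"
  shows "2 * \<rho> * d g = - (g * d \<rho>)"
proof -
  have "g \<noteq> 0" using g by auto
  have "d (g * g * \<rho>) = 0" unfolding g by (rule derivation_1[OF d])
  hence "g * (2 * \<rho> * d g + g * d \<rho>) = 0"
    by (simp add: derivation_mult[OF d] algebra_simps)
  thus ?thesis using \<open>g \<noteq> 0\<close> by (simp add: eq_neg_iff_add_eq_0)
qed

text \<open>The abbreviated terms are derivatives that occur in \<open>theta_pde\<close>: \<open>r1\<close>, \<open>r11\<close> are the first and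
  second derivative of \<open>\<rho>\<close> in direction \<open>U\<close>, and \<open>r2\<close>, \<open>r22\<close> those in direction \<open>\<partial>\<^sub>V - \<partial>\<^sub>W\<close>. The point of
  the identity is that the terms quadratic in first derivatives add up to a multiple of \<open>\<rho>\<close>.\<close>

lemma theta_polynomial_identity:
  fixes U V W A B C :: "'a::idom"
  assumes E: "E = 1+U+V+W"
    and m: "m = 1 - (A*(U*E-V*W)+B*(V*E-U*W)+C*(W*E-U*V))"
    and Dl: "Dl = A*A+B*B+C*C-2*A*B-2*A*C-2*B*C-A*B*C"
    and rho: "\<rho> = m*m + 4*Dl*(U*V*W*E)"
    and mu: "mu = A*(E+U)+(B-C)*(V-W)"
    and md: "md = A*(V-W)+(B-C)*(E+U)"
    and kc: "kc = 1+2*(U+V) - C*(W*E+U*V)"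
    and kb: "kb = 1+2*(U+W) - B*(V*E+U*W)"
    and r1: "r1 = 4*Dl*(V*W*(E+U)) - 2*m*mu"
    and r2: "r2 = 4*Dl*(U*E*(W-V)) - 2*m*md"
    and r11: "r11 = 2*mu*mu - 4*m*A + 8*Dl*V*W"
    and r22: "r22 = 2*md*md - 4*m*A - 8*Dl*U*E"
    and am: "am = C*(W*E+U*V) - (1+2*(U+V))*(1-m)"
    and akb: "akb = 2*(U*(1+(U+V))+(U+V)*W) - B*(1+2*(U+V))*(V*E+U*W)"
  shows "U*E*(3*r1*r1 - 2*\<rho>*r11) - 2*\<rho>*(E+U)*r1 + V*W*(3*r2*r2-2*\<rho>*r22) - 2*\<rho>*(W-V)*r2
   = 4*A*(3*m*kc*m*kb + \<rho>*(am*kb+m*akb - 2*(1+2*(U+V))*m*kb))"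
  unfolding r1 r2 r11 r22 am akb rho mu md kc kb
  unfolding Dl m E
  by algebra

text \<open>Differentiate the first-order rule once more and eliminate \<open>d g\<close> with it;
  the factor \<open>4 * \<rho> * \<rho>\<close> clears all denominators.\<close>

lemma derivation_inverse_sqrt_second:
  fixes d :: "'r::idom \<Rightarrow> 'r"
  assumes d: "derivation d" and g: "g * g * \<rho> = 1"
  shows "4 * \<rho> * \<rho> * d (d g) = g * (3 * d \<rho> * d \<rho> - 2 * \<rho> * d (d \<rho>))"
proof -
  note 1 = derivation_inverse_sqrt[OF d g]
  have "d (2 * \<rho> * d g) = d (- (g * d \<rho>))" by (simp only: 1)
  hence 2: "2 * d \<rho> * d g + 2 * \<rho> * d (d g) = - (d g * d \<rho> + g * d (d \<rho>))"
    by (simp add: derivation_simps[OF d] algebra_simps)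
  have "4 * \<rho> * \<rho> * d (d g) = 2 * \<rho> * (2 * d \<rho> * d g + 2 * \<rho> * d (d g)) - 2 * d \<rho> * (2 * \<rho> * d g)"
    by (simp add: algebra_simps)
  also have "\<dots> = - d \<rho> * (2 * \<rho> * d g) - 2 * \<rho> * g * d (d \<rho>) - 2 * d \<rho> * (2 * \<rho> * d g)"
    unfolding 2 by (simp add: algebra_simps)
  also have "\<dots> = g * (3 * d \<rho> * d \<rho> - 2 * \<rho> * d (d \<rho>))"
    unfolding 1 by (simp add: algebra_simps)
  finally show ?thesis .
qed

text \<open>After multiplication by \<open>4 * \<rho> * \<rho>\<close> both sides are
  \<open>g\<close> times a polynomial, and the polynomials agree by
  \<open>theta_polynomial_identity\<close>. The operators \<open>al\<close> and \<open>be\<close>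
  later turn into the factors a + b + 1 and a + c + 1 of the recurrence.\<close>

lemma theta_pde:
  fixes dU dV dW :: "'r::{idom,semiring_char_0} \<Rightarrow> 'r"
  assumes dU: "derivation dU" and dV: "derivation dV" and dW: "derivation dW"
    and U: "dU U = 1" "dV U = 0" "dW U = 0"
    and V: "dU V = 0" "dV V = 1" "dW V = 0"
    and W: "dU W = 0" "dV W = 0" "dW W = 1"
    and A: "dU A = 0" "dV A = 0" "dW A = 0"
    and B: "dU B = 0" "dV B = 0" "dW B = 0"
    and C: "dU C = 0" "dV C = 0" "dW C = 0"
    and E: "E = 1+U+V+W"
    and g: "g * g * ((1 - (A*(U*E-V*W)+B*(V*E-U*W)+C*(W*E-U*V)))^2
        + 4*(A*A+B*B+C*C-2*A*B-2*A*C-2*B*C-A*B*C)*(U*V*W*E)) = 1"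
    and th: "th = (\<lambda>f. U * dU f + V * dV f + W * dW f)"
    and al: "al = (\<lambda>f. (U+V) * th f + U * dU f + V * dV f + (1+2*(U+V)) * f)"
    and be: "be = (\<lambda>f. (U+W) * th f + U * dU f + W * dW f + (1+2*(U+W)) * f)"
    and dl: "dl = (\<lambda>f. dV f - dW f)"
  shows "dU (U * E * dU g) + dl (V * W * dl g) = A * al (be g)"
proof -
  define m where "m = 1 - (A*(U*E-V*W)+B*(V*E-U*W)+C*(W*E-U*V))"
  define Dl where "Dl = A*A+B*B+C*C-2*A*B-2*A*C-2*B*C-A*B*C"
  define \<rho> where "\<rho> = m*m + 4*Dl*(U*V*W*E)"
  have g\<rho>: "g * g * \<rho> = 1" using g by (simp add: \<rho>_def m_def Dl_def power2_eq_square)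
  define s t where "s = U + V" and "t = U + W"
  \<comment> \<open>The derivation parts of \<open>al\<close> and \<open>be\<close>; what remains of
    them is multiplication by 1 + 2s and 1 + 2t.\<close>
  define a0 b0 where "a0 = (\<lambda>f. s * th f + U * dU f + V * dV f)"
    and "b0 = (\<lambda>f. t * th f + U * dU f + W * dW f)"
  note dsimps = derivation_simps[OF dU] derivation_simps[OF dV] derivation_simps[OF dW]
  note vals = U V W A B C
  have dl': "derivation dl"
    by (rule derivationI) (simp_all add: dl dsimps algebra_simps)
  have a0: "derivation a0" and b0: "derivation b0"
    by (rule derivationI; simp add: a0_def b0_def th dsimps algebra_simps)+
  note d2 = derivation_simps[OF dl'] derivation_simps[OF a0] derivation_simps[OF b0]
  have dlv: "dl U = 0" "dl V = 1" "dl W = -1" "dl A = 0" "dl B = 0" "dl C = 0" "dl E = 0"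
    by (simp_all add: dl vals E dsimps)
  have a0v: "a0 U = U*(1+s)" "a0 V = V*(1+s)" "a0 W = s*W" "a0 A = 0" "a0 B = 0" "a0 C = 0"
    by (simp_all add: a0_def th vals algebra_simps)
  have b0v: "b0 U = U*(1+t)" "b0 W = W*(1+t)" "b0 V = t*V" "b0 A = 0" "b0 B = 0" "b0 C = 0"
    by (simp_all add: b0_def th vals algebra_simps)
  have a0E: "a0 E = s * E" and b0E: "b0 E = t * E"
    by (simp_all add: E d2 a0v b0v s_def t_def algebra_simps)
  have dUE: "dU E = 1" by (simp add: E dsimps vals)
  have dDl: "dU Dl = 0" "dl Dl = 0" "a0 Dl = 0" "b0 Dl = 0"
    by (simp_all add: Dl_def dsimps d2 vals dlv a0v b0v)
  define mu md where "mu = A*(E+U)+(B-C)*(V-W)" and "md = A*(V-W)+(B-C)*(E+U)"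
  define kb kc where "kb = 1+2*t - B*(V*E+U*W)" and "kc = 1+2*s - C*(W*E+U*V)"
  have mU: "dU m = - mu" and mD: "dl m = - md"
    by (simp_all add: m_def mu_def md_def dsimps d2 vals dlv dUE algebra_simps E)
  have muU: "dU mu = 2 * A" and mdD: "dl md = 2 * A"
    by (simp_all add: mu_def md_def dsimps d2 vals dlv dUE algebra_simps)
  have am: "a0 m = C*(W*E+U*V) - (1+2*s)*(1-m)"
    by (simp add: m_def d2 a0v a0E algebra_simps)
  have bm: "b0 m = B*(V*E+U*W) - (1+2*t)*(1-m)"
    by (simp add: m_def d2 b0v b0E algebra_simps)
  have akb: "a0 kb = 2*(U*(1+s)+s*W) - B*(1+2*s)*(V*E+U*W)"
    by (simp add: kb_def t_def d2 a0v a0E algebra_simps)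
  define r1 r2 where "r1 = 4*Dl*(V*W*(E+U)) - 2*m*mu" and "r2 = 4*Dl*(U*E*(W-V)) - 2*m*md"
  have r1: "dU \<rho> = r1" and r2: "dl \<rho> = r2"
    by (simp_all add: \<rho>_def r1_def r2_def dsimps d2 vals dlv dUE dDl mU mD algebra_simps)
  have r11: "dU r1 = 2*mu*mu - 4*m*A + 8*Dl*V*W" and r22: "dl r2 = 2*md*md - 4*m*A - 8*Dl*U*E"
    by (simp_all add: r1_def r2_def dsimps d2 vals dlv dUE dDl mU mD muU mdD algebra_simps)
  \<comment> \<open>\<open>a0\<close> and \<open>b0\<close> send each of \<open>U\<close>,
    \<open>V\<close>, \<open>W\<close>, \<open>E\<close> to a polynomial multiple of itself. So the
    second summand of \<rho> reproduces itself, and \<rho> goes to a multiple of itself plus a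
    multiple of \<open>m\<close>.\<close>
  have aT: "a0 (U*V*W*E) = (2+4*s)*(U*V*W*E)" and bT: "b0 (U*V*W*E) = (2+4*t)*(U*V*W*E)"
    by (simp_all add: d2 a0v b0v a0E b0E algebra_simps)
  have ar: "a0 \<rho> = 2*(1+2*s)*\<rho> - 2*m*kc"
  proof -
    have "a0 \<rho> = 2 * m * a0 m + 4 * Dl * a0 (U*V*W*E)"
      unfolding \<rho>_def derivation_add[OF a0] derivation_mult[OF a0, of "4 * Dl"]
        derivation_mult[OF a0, of 4] derivation_mult[OF a0, of m m]
      by (simp add: derivation_numeral[OF a0] dDl)
    thus ?thesis unfolding aT am by (simp add: \<rho>_def kc_def algebra_simps)
  qed
  have br: "b0 \<rho> = 2*(1+2*t)*\<rho> - 2*m*kb"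
  proof -
    have "b0 \<rho> = 2 * m * b0 m + 4 * Dl * b0 (U*V*W*E)"
      unfolding \<rho>_def derivation_add[OF b0] derivation_mult[OF b0, of "4 * Dl"]
        derivation_mult[OF b0, of 4] derivation_mult[OF b0, of m m]
      by (simp add: derivation_numeral[OF b0] dDl)
    thus ?thesis unfolding bT bm by (simp add: \<rho>_def kb_def algebra_simps)
  qed
  have two: "2 * x = 2 * y \<longleftrightarrow> x = y" for x y :: 'r by simp
  have ag: "\<rho> * a0 g = g * (m * kc - (1+2*s) * \<rho>)"
    using derivation_inverse_sqrt[OF a0 g\<rho>] unfolding ar
    by (subst two[symmetric]) (simp add: algebra_simps)
  have bg: "\<rho> * (b0 g + (1+2*t) * g) = g * (m * kb)"
    using derivation_inverse_sqrt[OF b0 g\<rho>] unfolding br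
    by (subst two[symmetric]) (simp add: algebra_simps)
  have beg: "be g = b0 g + (1+2*t) * g" by (simp add: be b0_def t_def)
  have ale: "al f = a0 f + (1+2*s) * f" for f by (simp add: al a0_def s_def)
  \<comment> \<open>\<open>X\<close> is the polynomial in \<open>\<rho> * be g = g * X\<close>;
    applying \<open>a0\<close> to this cleared equation avoids any division by \<rho>.\<close>
  define X where "X = m * kb"
  have bX: "\<rho> * be g = g * X" using bg by (simp add: beg X_def)
  have "a0 \<rho> * be g + \<rho> * a0 (be g) = a0 g * X + g * a0 X"
    using arg_cong[OF bX, of a0] by (simp add: derivation_mult[OF a0])
  hence "\<rho> * (a0 \<rho> * be g + \<rho> * a0 (be g)) = \<rho> * (a0 g * X + g * a0 X)" by simp
  hence "\<rho> * \<rho> * a0 (be g) = (\<rho> * a0 g) * X + g * \<rho> * a0 X - a0 \<rho> * (\<rho> * be g)"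
    by (simp add: algebra_simps)
  hence "\<rho> * \<rho> * a0 (be g) = g * ((m * kc - (1+2*s) * \<rho>) * X + \<rho> * a0 X - (2*(1+2*s)*\<rho> - 2*m*kc) * X)"
    unfolding ag bX ar by (simp add: algebra_simps)
  moreover have "\<rho> * \<rho> * al (be g) = \<rho> * \<rho> * a0 (be g) + (1+2*s) * \<rho> * (\<rho> * be g)"
    by (simp add: ale algebra_simps)
  ultimately have R: "\<rho> * \<rho> * al (be g) = g * (3 * m * kc * X + \<rho> * (a0 X - 2 * (1+2*s) * X))"
    unfolding bX by (simp add: algebra_simps)
  have X: "a0 X = (C*(W*E+U*V) - (1+2*s)*(1-m)) * kb + m * (2*(U*(1+s)+s*W) - B*(1+2*s)*(V*E+U*W))"
    by (simp add: X_def derivation_mult[OF a0] am akb)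
  have L: "dU (U * E * dU g) + dl (V * W * dl g)
      = U * E * dU (dU g) + (E + U) * dU g + V * W * dl (dl g) + (W - V) * dl g"
    by (simp add: derivation_mult[OF dU] derivation_mult[OF dl'] vals dlv dUE algebra_simps)
  have "4 * \<rho> * \<rho> * (dU (U * E * dU g) + dl (V * W * dl g))
     = U * E * (4 * \<rho> * \<rho> * dU (dU g)) + 2 * \<rho> * (E + U) * (2 * \<rho> * dU g)
      + V * W * (4 * \<rho> * \<rho> * dl (dl g)) + 2 * \<rho> * (W - V) * (2 * \<rho> * dl g)"
    unfolding L by (simp add: algebra_simps)
  also have "\<dots> = g * (U*E*(3*r1*r1 - 2*\<rho>*dU r1) - 2*\<rho>*(E+U)*r1 + V*W*(3*r2*r2-2*\<rho>*dl r2) - 2*\<rho>*(W-V)*r2)"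
    unfolding derivation_inverse_sqrt_second[OF dU g\<rho>] derivation_inverse_sqrt_second[OF dl' g\<rho>]
      derivation_inverse_sqrt[OF dU g\<rho>] derivation_inverse_sqrt[OF dl' g\<rho>] r1 r2
    by (simp add: algebra_simps)
  also have "U*E*(3*r1*r1 - 2*\<rho>*dU r1) - 2*\<rho>*(E+U)*r1 + V*W*(3*r2*r2-2*\<rho>*dl r2) - 2*\<rho>*(W-V)*r2
     = 4*A*(3*m*kc*m*kb + \<rho>*((C*(W*E+U*V) - (1+2*s)*(1-m))*kb
         + m*(2*(U*(1+s)+s*W) - B*(1+2*s)*(V*E+U*W)) - 2*(1+2*s)*m*kb))"
    unfolding s_def
    by (rule theta_polynomial_identity[OF E m_def Dl_def \<rho>_def mu_def md_def
          kc_def[unfolded s_def] kb_def[unfolded t_def] r1_def r2_def r11 r22 refl refl])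
  also have "g * \<dots> = 4 * A * (\<rho> * \<rho> * al (be g))"
    unfolding R X by (simp add: X_def algebra_simps)
  finally have fin: "4 * \<rho> * \<rho> * (dU (U * E * dU g) + dl (V * W * dl g)) = 4 * \<rho> * \<rho> * (A * al (be g))"
    by (simp add: algebra_simps)
  have "\<rho> \<noteq> 0" using g\<rho> by auto
  with fin show ?thesis by simp
qed

text \<open>Abstract passage to coefficients: \<open>Lam k\<close> is meant to divide terms of total
  degree n by (n + k)!, and \<open>T\<close> to send U^p V^q W^r to the product of the falling
  factorials of a, b, c. Being abstract, one proof serves three orders of the variables. In
  \<open>T_X\<close> the truncated index at 0 is harmless, since its factor is 0.\<close>

locale theta_calculus =
  fixes dU dV dW :: "'r::{idom,semiring_char_0} \<Rightarrow> 'r" and U V W A :: 'r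
    and Lam :: "nat \<Rightarrow> 'r \<Rightarrow> 'r"
    and T :: "'r \<Rightarrow> nat \<Rightarrow> nat \<Rightarrow> nat \<Rightarrow> 'a::comm_ring_1" and y :: 'a
  assumes dU: "derivation dU" and dV: "derivation dV" and dW: "derivation dW"
    and comm: "dV (dU f) = dU (dV f)" "dW (dU f) = dU (dW f)" "dW (dV f) = dV (dW f)"
    and U: "dU U = 1" "dV U = 0" "dW U = 0"
    and V: "dU V = 0" "dV V = 1" "dW V = 0"
    and W: "dU W = 0" "dV W = 0" "dW W = 1"
    and A: "dU A = 0" "dV A = 0" "dW A = 0"
    and Lam_add: "Lam k (f + f') = Lam k f + Lam k f'"
    and Lam_A: "Lam k (A * f) = A * Lam k f"
    and Lam_X: "U * Lam (Suc k) f = Lam k (U * f)" "V * Lam (Suc k) f = Lam k (V * f)"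
      "W * Lam (Suc k) f = Lam k (W * f)"
    and Lam_d: "dU (Lam k f) = Lam (Suc k) (dU f)" "dV (Lam k f) = Lam (Suc k) (dV f)"
      "dW (Lam k f) = Lam (Suc k) (dW f)"
    and Lam_theta: "U * dU (Lam (Suc k) f) + V * dV (Lam (Suc k) f) + W * dW (Lam (Suc k) f)
        + of_nat (Suc k) * Lam (Suc k) f = Lam k f"
    and T_add: "T (f + f') a b c = T f a b c + T f' a b c"
    and T_A: "T (A * f) a b c = y * T f a b c"
    and T_X: "T (U * f) a b c = of_nat a * T f (a - 1) b c"
      "T (V * f) a b c = of_nat b * T f a (b - 1) c"
      "T (W * f) a b c = of_nat c * T f a b (c - 1)"
    and T_d: "T (f + dU f) a b c = T f (Suc a) b c"
      "T (f + dV f) a b c = T f a (Suc b) c"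
      "T (f + dW f) a b c = T f a b (Suc c)"
begin

lemmas d_simps = derivation_simps[OF dU] derivation_simps[OF dV] derivation_simps[OF dW] U V W A

definition nU where "nU f = U * f + U * dU f"
definition nV where "nV f = V * f + V * dV f"
definition nW where "nW f = W * f + W * dW f"
definition sU where "sU f = f + dU f"
definition sV where "sV f = f + dV f"
definition sW where "sW f = f + dW f"

lemma T_n:
  "T (nU f) a b c = of_nat a * T f a b c"
  "T (nV f) a b c = of_nat b * T f a b c"
  "T (nW f) a b c = of_nat c * T f a b c"
  unfolding nU_def nV_def nW_def distrib_left[symmetric] T_X T_d
  subgoal by (cases a) simp_all
  subgoal by (cases b) simp_all
  subgoal by (cases c) simp_all
  done

lemma T_s: "T (sU f) a b c = T f (Suc a) b c" "T (sV f) a b c = T f a (Suc b) c"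
  "T (sW f) a b c = T f a b (Suc c)"
  by (simp_all only: sU_def sV_def sW_def T_d)

lemma T_diff: "T (f - f') a b c = T f a b c - T f' a b c"
  using T_add[of "f - f'" f' a b c] by simp

lemma Lam_raise:
  "Lam (Suc 0) (X * f) + (U * dU (Lam (Suc 0) (X * f)) + V * dV (Lam (Suc 0) (X * f))
    + W * dW (Lam (Suc 0) (X * f))) = Lam 0 (X * f)"
  using Lam_theta[of 0 "X * f"] by (simp add: algebra_simps)

text \<open>With th the Euler operator, X Lam_1 f = Lam_0 (X f) = Lam_1 ((1 + th) (X f)), and th (X
  f) = X f + X th f; this is where the 2 comes from.\<close>

lemma Lam_factor:
  assumes X: "\<And>k f. X * Lam (Suc k) f = Lam k (X * f)" and eul: "U * dU X + V * dV X + W * dW X = X"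
  shows "Lam (Suc 0) (X * (U * dU f + V * dV f + W * dW f) + 2 * (X * f)) = X * Lam (Suc 0) f"
proof -
  have "X * (U * dU f + V * dV f + W * dW f) + 2 * (X * f)
      = X * f + (U * dU (X * f) + V * dV (X * f) + W * dW (X * f))"
  proof -
    have "U * dU (X * f) + V * dV (X * f) + W * dW (X * f)
      = (U * dU X + V * dV X + W * dW X) * f + X * (U * dU f + V * dV f + W * dW f)"
      by (simp add: d_simps algebra_simps)
    thus ?thesis unfolding eul by (simp add: algebra_simps)
  qed
  also have "Lam (Suc 0) \<dots> = Lam 0 (X * f)"
    using Lam_raise[of X f] by (simp add: Lam_add Lam_X Lam_d)
  finally show ?thesis by (simp add: X)
qed

text \<open>Used with two of the variables as \<open>X\<close> and \<open>Y\<close> to transport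
  \<open>al\<close> and \<open>be\<close>: the factorial weights absorb the Euler terms, and each
  variable is left with its operator \<open>nU\<close>, \<open>nV\<close> or
  \<open>nW\<close>.\<close>

lemma Lam_field:
  assumes X: "\<And>k f. X * Lam (Suc k) f = Lam k (X * f)" and eulX: "U * dU X + V * dV X + W * dW X = X"
    and Y: "\<And>k f. Y * Lam (Suc k) f = Lam k (Y * f)" and eulY: "U * dU Y + V * dV Y + W * dW Y = Y"
    and dX: "\<And>k f. dX (Lam k f) = Lam (Suc k) (dX f)" and dY: "\<And>k f. dY (Lam k f) = Lam (Suc k) (dY f)"
  shows "Lam (Suc 0) ((X + Y) * (U * dU f + V * dV f + W * dW f) + X * dX f + Y * dY f + (1 + 2 * (X + Y)) * f)
     = (X * Lam (Suc 0) f + X * dX (Lam (Suc 0) f)) + (Y * Lam (Suc 0) f + Y * dY (Lam (Suc 0) f)) + Lam (Suc 0) f"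
proof -
  let ?P = "X * (U * dU f + V * dV f + W * dW f) + 2 * (X * f)"
  let ?Q = "Y * (U * dU f + V * dV f + W * dW f) + 2 * (Y * f)"
  have "(X + Y) * (U * dU f + V * dV f + W * dW f) + X * dX f + Y * dY f + (1 + 2 * (X + Y)) * f
    = ?P + (?Q + (X * dX f + (Y * dY f + f)))"
    by (simp add: algebra_simps)
  hence "Lam (Suc 0) ((X + Y) * (U * dU f + V * dV f + W * dW f) + X * dX f + Y * dY f + (1 + 2 * (X + Y)) * f)
    = Lam (Suc 0) ?P + (Lam (Suc 0) ?Q + (Lam (Suc 0) (X * dX f) + (Lam (Suc 0) (Y * dY f) + Lam (Suc 0) f)))"
    by (simp only: Lam_add)
  also have "\<dots> = X * Lam (Suc 0) f + (Y * Lam (Suc 0) f + (X * dX (Lam (Suc 0) f) + (Y * dY (Lam (Suc 0) f) + Lam (Suc 0) f)))"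
    by (simp only: Lam_factor[OF X eulX] Lam_factor[OF Y eulY] dX dY X[symmetric] Y[symmetric])
  finally show ?thesis by (simp only: ac_simps)
qed

text \<open>Under \<open>T\<close> the operators \<open>nU\<close> and \<open>sU\<close> become multiplication by \<open>a\<close> and the shift of \<open>a\<close>, so
  the left-hand side is the recurrence of the genus two Schur polynomials, minus twice its diagonal part.\<close>

lemma operator_identity:
  "(sU (nU (nU h + nV h + nW h + h)) + U * (nU h + nV h + nW h + 2 * h)
    + sV (nV (W * h)) + sW (nW (V * h)))
   - 2 * (nU (nU h + nW h + h) + nV (nU h + nW h + h) + (nU h + nW h + h))
   = (U * dU (dU (U * dU h)) + V * dV (dU (U * dU h)) + W * dW (dU (U * dU h)) + 2 * dU (U * dU h))
     + (U * (U + V + W) * dU (dU h) + (U + V + W + U) * dU h)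
     + (V * W * (dV (dV h - dW h) - dW (dV h - dW h)) + (W - V) * (dV h - dW h))"
  unfolding nU_def nV_def nW_def sU_def sV_def sW_def
  by (simp add: d_simps comm algebra_simps)

text \<open>\<open>Lam 1\<close> and then \<open>T\<close> are applied to the differential equation.
  The diagonal part subtracted in \<open>operator_identity\<close> moves to the right and gives the
  2 in \<open>2 + y\<close>.\<close>

lemma theta_recurrence:
  assumes pde: "dU (U * (1+U+V+W) * dU g)
      + (dV (V * W * (dV g - dW g)) - dW (V * W * (dV g - dW g))) = A * al (be g)"
    and th: "th = (\<lambda>f. U * dU f + V * dV f + W * dW f)"
    and al: "al = (\<lambda>f. (U+V) * th f + U * dU f + V * dV f + (1+2*(U+V)) * f)"
    and be: "be = (\<lambda>f. (U+W) * th f + U * dU f + W * dW f + (1+2*(U+W)) * f)"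
    and F: "F = T (Lam (Suc 0) g)"
  shows "of_nat (a+b+c+2) * of_nat (a+1) * F (a+1) b c + of_nat a * of_nat (a+b+c+1) * F (a-1) b c
    + of_nat (b+1) * of_nat c * F a (b+1) (c-1) + of_nat (c+1) * of_nat b * F a (b-1) (c+1)
    = of_nat (a+b+1) * of_nat (a+c+1) * ((2 + y) * F a b c)"
proof -
  define h where "h = Lam (Suc 0) g"
  have eul: "U * dU U + V * dV U + W * dW U = U" "U * dU V + V * dV V + W * dW V = V"
    "U * dU W + V * dV W + W * dW W = W"
    by (simp_all add: d_simps)
  have "Lam (Suc 0) (A * al (be g)) = A * (nU (nU h + nW h + h) + nV (nU h + nW h + h) + (nU h + nW h + h))"
    unfolding al be th Lam_A
    by (simp only: Lam_field[OF Lam_X(1) eul(1) Lam_X(2) eul(2) Lam_d(1,2)]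
        Lam_field[OF Lam_X(1) eul(1) Lam_X(3) eul(3) Lam_d(1,3)] h_def nU_def nV_def nW_def)
  moreover have "Lam (Suc 0) (dU (U * (1+U+V+W) * dU g)
      + (dV (V * W * (dV g - dW g)) - dW (V * W * (dV g - dW g))))
    = (U * dU (dU (U * dU h)) + V * dV (dU (U * dU h)) + W * dW (dU (U * dU h)) + 2 * dU (U * dU h))
     + (U * (U + V + W) * dU (dU h) + (U + V + W + U) * dU h)
     + (V * W * (dV (dV h - dW h) - dW (dV h - dW h)) + (W - V) * (dV h - dW h))"
  proof -
    have Lam_diff: "Lam k (f - f') = Lam k f - Lam k f'" for k f f'
      using Lam_add[of k "f - f'" f'] by simp
    \<comment> \<open>Splits off \<open>dU (U * dU g)\<close>, the only part that lowers the total
      degree; the other terms preserve it, so \<open>Lam\<close> passes through them with unchanged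
      index.\<close>
    have e1: "dU (U * (1+U+V+W) * dU g) + (dV (V * W * (dV g - dW g)) - dW (V * W * (dV g - dW g)))
      = dU (U * dU g) + ((U * (U * dU (dU g)) + U * (V * dU (dU g)) + U * (W * dU (dU g))
         + U * dU g + V * dU g + W * dU g + U * dU g)
       + (V * (W * dV (dV g)) - V * (W * dV (dW g)) - V * (W * dV (dW g)) + V * (W * dW (dW g))
         + (W * dV g - V * dV g - (W * dW g - V * dW g))))"
      by (simp add: d_simps comm algebra_simps)
    \<comment> \<open>The derivative moves \<open>Lam\<close> to index 2; the Euler relation returns
      it to index 1 and produces the extra terms.\<close>
    have e2: "Lam (Suc 0) (dU (U * dU g))
      = U * dU (dU (U * dU h)) + V * dV (dU (U * dU h)) + W * dW (dU (U * dU h)) + 2 * dU (U * dU h)"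
    proof -
      have "dU (U * dU h) = Lam (Suc (Suc 0)) (dU (U * dU g))"
        by (simp add: h_def Lam_d Lam_X)
      thus ?thesis using Lam_theta[of "Suc 0" "dU (U * dU g)"] by simp
    qed
    have e3: "U * (U + V + W) * dU (dU h) + (U + V + W + U) * dU h
        + V * W * (dV (dV h - dW h) - dW (dV h - dW h)) + (W - V) * (dV h - dW h)
      = (U * (U * dU (dU h)) + U * (V * dU (dU h)) + U * (W * dU (dU h))
         + U * dU h + V * dU h + W * dU h + U * dU h)
       + (V * (W * dV (dV h)) - V * (W * dV (dW h)) - V * (W * dV (dW h)) + V * (W * dW (dW h))
         + (W * dV h - V * dV h - (W * dW h - V * dW h)))"
      by (simp add: d_simps comm algebra_simps)
    have e4: "Lam (Suc 0) ((U * (U * dU (dU g)) + U * (V * dU (dU g)) + U * (W * dU (dU g))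
         + U * dU g + V * dU g + W * dU g + U * dU g)
       + (V * (W * dV (dV g)) - V * (W * dV (dW g)) - V * (W * dV (dW g)) + V * (W * dW (dW g))
         + (W * dV g - V * dV g - (W * dW g - V * dW g))))
      = U * (U + V + W) * dU (dU h) + (U + V + W + U) * dU h
        + V * W * (dV (dV h - dW h) - dW (dV h - dW h)) + (W - V) * (dV h - dW h)"
      unfolding e3 unfolding h_def by (simp only: Lam_add Lam_diff Lam_d Lam_X)
    show ?thesis
      by (subst e1, subst Lam_add, subst e2, subst e4) (simp only: add.assoc)
  qed
  ultimately have "A * (nU (nU h + nW h + h) + nV (nU h + nW h + h) + (nU h + nW h + h))
    = (sU (nU (nU h + nV h + nW h + h)) + U * (nU h + nV h + nW h + 2 * h)
    + sV (nV (W * h)) + sW (nW (V * h)))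
   - 2 * (nU (nU h + nW h + h) + nV (nU h + nW h + h) + (nU h + nW h + h))"
    unfolding operator_identity pde by simp
  from arg_cong[OF this, of "\<lambda>f. T f a b c"]
  show ?thesis
    unfolding T_A T_diff mult_2 T_add T_s T_n T_X F h_def[symmetric]
    by (cases a; cases b; cases c) (simp_all add: algebra_simps)
qed

end

section \<open>From the differential equation to the recurrence\<close>

definition fps_map :: "('a \<Rightarrow> 'b) \<Rightarrow> 'a::zero fps \<Rightarrow> 'b::zero fps" where
  "fps_map f F = Abs_fps (\<lambda>n. f (F $ n))"

lemma fps_map_nth [simp]: "fps_map f F $ n = f (F $ n)"
  by (simp add: fps_map_def)

lemma derivation_sum:
  assumes "derivation d"
  shows "d (sum f I) = (\<Sum>i\<in>I. d (f i))"
  by (induction I rule: infinite_finite_induct) (simp_all add: derivation_simps[OF assms])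

lemma derivation_fps_deriv: "derivation (fps_deriv :: 'a::comm_ring_1 fps \<Rightarrow> _)"
  by (rule derivationI) (simp_all add: algebra_simps)

lemma derivation_fps_map:
  assumes d: "derivation d"
  shows "derivation (fps_map d)"
  by (rule derivationI)
    (simp_all add: fps_eq_iff derivation_simps[OF d] derivation_sum[OF d] fps_mult_nth sum.distrib)

lemma fps_map_const: "d 0 = 0 \<Longrightarrow> fps_map d (fps_const c) = fps_const (d c)"
  by (simp add: fps_eq_iff)

lemma fps_map_X: "derivation d \<Longrightarrow> fps_map d fps_X = 0"
  by (simp add: fps_eq_iff fps_X_def derivation_simps)

text \<open>The linear functional that sends X^p to the falling factorial of a of length p, written
  as a binomial coefficient times p!. It vanishes for p > a, so the finite sum loses
  nothing.\<close>

definition bin_trans :: "'a::comm_ring_1 fps \<Rightarrow> nat \<Rightarrow> 'a" where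
  "bin_trans h a = (\<Sum>p\<le>a. h $ p * of_nat ((a choose p) * fact p))"

lemma bin_trans_add: "bin_trans (f + g) a = bin_trans f a + bin_trans g a"
  by (simp add: bin_trans_def algebra_simps sum.distrib)

lemma bin_trans_const_mult: "bin_trans (fps_const k * f) a = k * bin_trans f a"
  by (simp add: bin_trans_def algebra_simps sum_distrib_left)

text \<open>Falling factorials satisfy a^[p+1] = a (a-1)^[p]. At a = 0 both sides vanish, whatever
  the truncated \<open>a - 1\<close> is.\<close>

lemma bin_trans_X_mult: "bin_trans (fps_X * f) a = of_nat a * bin_trans f (a - 1)"
proof (cases a)
  case (Suc n)
  have *: "(Suc n choose Suc p) * fact (Suc p) = Suc n * ((n choose p) * fact p)" for p
    by (metis Suc_times_binomial_eq fact_Suc mult.assoc of_nat_id)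
  have "bin_trans (fps_X * f) a = (\<Sum>p\<le>n. f $ p * of_nat ((Suc n choose Suc p) * fact (Suc p)))"
    unfolding bin_trans_def Suc by (subst sum.atMost_Suc_shift) simp
  also have "\<dots> = of_nat (Suc n) * bin_trans f n"
    unfolding * by (simp only: bin_trans_def sum_distrib_left of_nat_mult ac_simps)
  finally show ?thesis by (simp add: Suc)
qed (simp add: bin_trans_def)

lemma ffact_Suc_Suc: "(Suc a choose Suc p) * fact (Suc p)
    = (a choose Suc p) * fact (Suc p) + Suc p * ((a choose p) * fact p)"
  by (simp add: algebra_simps)

text \<open>Passing from a to a + 1 adds p a^[p-1] to a^[p], just as adding its derivative does to
  X^p.\<close>

lemma bin_trans_deriv: "bin_trans (f + fps_deriv f) a = bin_trans f (Suc a)"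
proof -
  have "bin_trans f (Suc a) = f $ 0 + (\<Sum>p\<le>a. f $ Suc p * of_nat ((a choose Suc p) * fact (Suc p)))
      + (\<Sum>p\<le>a. f $ Suc p * of_nat (Suc p * ((a choose p) * fact p)))"
    unfolding bin_trans_def
    by (subst sum.atMost_Suc_shift, unfold ffact_Suc_Suc) (simp add: algebra_simps sum.distrib)
  also have "f $ 0 + (\<Sum>p\<le>a. f $ Suc p * of_nat ((a choose Suc p) * fact (Suc p)))
      = (\<Sum>p\<le>Suc a. f $ p * of_nat ((a choose p) * fact p))"
    by (subst sum.atMost_Suc_shift) simp
  also have "\<dots> = bin_trans f a" by (simp add: bin_trans_def binomial_eq_0)
  also have "(\<Sum>p\<le>a. f $ Suc p * of_nat (Suc p * ((a choose p) * fact p))) = bin_trans (fps_deriv f) a"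
    by (simp add: bin_trans_def algebra_simps)
  finally show ?thesis by (simp add: bin_trans_add)
qed

lemma bin_trans_map:
  assumes "derivation d"
  shows "bin_trans (fps_map d f) a = d (bin_trans f a)"
  by (simp add: bin_trans_def derivation_sum[OF assms] derivation_simps[OF assms])

section \<open>The concrete series ring in U, V, W\<close>

definition inv_fact :: "nat \<Rightarrow> poly3" where "inv_fact n = C3 (inverse (fact n))"

lemma of_nat_C3: "of_nat n = C3 (of_nat n)"
  by (simp add: C3_def of_nat_poly)

lemma C3_mult: "C3 a * C3 b = C3 (a * b)"
  by (simp add: C3_def)

lemma inv_fact_Suc: "of_nat (Suc n) * inv_fact (Suc n) = inv_fact n"
  unfolding inv_fact_def of_nat_C3 C3_mult by (simp add: field_simps del: of_nat_Suc)

text \<open>The coefficient of \<open>U\<^sup>p V\<^sup>q W\<^sup>r\<close> is \<open>f $ r $ p $ q\<close>: with \<open>W\<close> outermost, \<open>f $ 0\<close> is the restriction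
  to \<open>W = 0\<close>, the only part that contributes to the leading pole.\<close>

definition dU :: "poly3 fps fps fps \<Rightarrow> poly3 fps fps fps" where "dU = fps_map fps_deriv"
definition dV :: "poly3 fps fps fps \<Rightarrow> poly3 fps fps fps" where "dV = fps_map (fps_map fps_deriv)"
definition dW :: "poly3 fps fps fps \<Rightarrow> poly3 fps fps fps" where "dW = fps_deriv"
definition UU :: "poly3 fps fps fps" where "UU = fps_const fps_X"
definition VV :: "poly3 fps fps fps" where "VV = fps_const (fps_const fps_X)"
definition WW :: "poly3 fps fps fps" where "WW = fps_X"
definition cc :: "poly3 \<Rightarrow> poly3 fps fps fps" where "cc a = fps_const (fps_const (fps_const a))"

definition Lam :: "nat \<Rightarrow> poly3 fps fps fps \<Rightarrow> poly3 fps fps fps" where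
  "Lam k f = Abs_fps (\<lambda>r. Abs_fps (\<lambda>p. Abs_fps (\<lambda>q. inv_fact (r + p + q + k) * f $ r $ p $ q)))"

lemma Lam_nth: "Lam k f $ r $ p $ q = inv_fact (r + p + q + k) * f $ r $ p $ q"
  by (simp add: Lam_def)

text \<open>The nesting follows the series: the outermost variable W is evaluated first, with c,
  then U with a and V with b.\<close>

definition theta_trans :: "poly3 fps fps fps \<Rightarrow> nat \<Rightarrow> nat \<Rightarrow> nat \<Rightarrow> poly3" where
  "theta_trans h a b c = bin_trans (bin_trans (bin_trans h c) a) b"

lemma derivations: "derivation dU" "derivation dV" "derivation dW"
  unfolding dU_def dV_def dW_def by (intro derivation_fps_map derivation_fps_deriv)+

lemma d_vars:
  "dU UU = 1" "dV UU = 0" "dW UU = 0"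
  "dU VV = 0" "dV VV = 1" "dW VV = 0"
  "dU WW = 0" "dV WW = 0" "dW WW = 1"
  by (simp_all add: dU_def dV_def dW_def UU_def VV_def WW_def fps_map_const fps_map_X
      derivation_fps_map derivation_fps_deriv derivation_0)

lemma d_const: "dU (cc a) = 0" "dV (cc a) = 0" "dW (cc a) = 0"
  by (simp_all add: dU_def dV_def dW_def cc_def fps_map_const derivation_fps_map
      derivation_fps_deriv derivation_0)

lemma series_ops_nth:
  "(UU * f) $ r $ p $ q = (if p = 0 then 0 else f $ r $ (p - 1) $ q)"
  "(VV * f) $ r $ p $ q = (if q = 0 then 0 else f $ r $ p $ (q - 1))"
  "(WW * f) $ r $ p $ q = (if r = 0 then 0 else f $ (r - 1) $ p $ q)"
  "(cc a * f) $ r $ p $ q = a * f $ r $ p $ q"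
  "dU f $ r $ p $ q = of_nat (Suc p) * f $ r $ Suc p $ q"
  "dV f $ r $ p $ q = of_nat (Suc q) * f $ r $ p $ Suc q"
  "dW f $ r $ p $ q = of_nat (Suc r) * f $ Suc r $ p $ q"
  by (simp_all add: UU_def VV_def WW_def cc_def dU_def dV_def dW_def fps_of_nat[symmetric]
      del: of_nat_Suc)

lemma d_comm: "dV (dU f) = dU (dV f)" "dW (dU f) = dU (dW f)" "dW (dV f) = dV (dW f)"
  by (simp_all add: fps_eq_iff series_ops_nth mult.left_commute del: of_nat_Suc)

lemma Lam_rules:
  "Lam k (f + f') = Lam k f + Lam k f'"
  "Lam k (cc a * f) = cc a * Lam k f"
  "UU * Lam (Suc k) f = Lam k (UU * f)" "VV * Lam (Suc k) f = Lam k (VV * f)"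
  "WW * Lam (Suc k) f = Lam k (WW * f)"
  "dU (Lam k f) = Lam (Suc k) (dU f)" "dV (Lam k f) = Lam (Suc k) (dV f)"
  "dW (Lam k f) = Lam (Suc k) (dW f)"
  by (simp_all add: fps_eq_iff Lam_nth series_ops_nth distrib_left mult.left_commute del: of_nat_Suc)

text \<open>On a term of degree n this is (n + k + 1) / (n + k + 1)! = 1 / (n + k)!.\<close>

lemma Lam_theta:
  "UU * dU (Lam (Suc k) f) + VV * dV (Lam (Suc k) f) + WW * dW (Lam (Suc k) f)
     + of_nat (Suc k) * Lam (Suc k) f = Lam k f"
proof -
  have of_nat: "(of_nat n * f) $ r $ p $ q = of_nat n * f $ r $ p $ q" for n r p q and f :: "poly3 fps fps fps"
    by (simp add: fps_of_nat[symmetric])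
  have *: "(UU * dU f) $ r $ p $ q = of_nat p * f $ r $ p $ q"
    "(VV * dV f) $ r $ p $ q = of_nat q * f $ r $ p $ q"
    "(WW * dW f) $ r $ p $ q = of_nat r * f $ r $ p $ q" for f r p q
    by (simp_all add: series_ops_nth del: of_nat_Suc)
  have "of_nat p * (inv_fact (Suc (r + p + q + k)) * x) + of_nat q * (inv_fact (Suc (r + p + q + k)) * x)
    + of_nat r * (inv_fact (Suc (r + p + q + k)) * x) + of_nat (Suc k) * (inv_fact (Suc (r + p + q + k)) * x)
    = inv_fact (r + p + q + k) * x" for p q r x
    unfolding inv_fact_Suc[of "r + p + q + k", symmetric] by (simp add: algebra_simps)
  thus ?thesis
    by (simp add: fps_eq_iff * of_nat Lam_nth del: of_nat_Suc)
qed

lemma theta_trans_rules: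
  "theta_trans (f + f') a b c = theta_trans f a b c + theta_trans f' a b c"
  "theta_trans (cc y * f) a b c = y * theta_trans f a b c"
  "theta_trans (UU * f) a b c = of_nat a * theta_trans f (a - 1) b c"
  "theta_trans (VV * f) a b c = of_nat b * theta_trans f a (b - 1) c"
  "theta_trans (WW * f) a b c = of_nat c * theta_trans f a b (c - 1)"
  "theta_trans (f + dU f) a b c = theta_trans f (Suc a) b c"
  "theta_trans (f + dV f) a b c = theta_trans f a (Suc b) c"
  "theta_trans (f + dW f) a b c = theta_trans f a b (Suc c)"
proof -
  note [simp] = bin_trans_add bin_trans_const_mult bin_trans_X_mult
    bin_trans_map[OF derivation_fps_deriv] bin_trans_map[OF derivation_fps_map[OF derivation_fps_deriv]]
  have nat: "bin_trans (of_nat n * f) a = of_nat n * bin_trans f a" for n a and f :: "'z::comm_ring_1 fps"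
    by (simp only: fps_of_nat[symmetric] bin_trans_const_mult)
  note [simp] = nat
  show "theta_trans (f + f') a b c = theta_trans f a b c + theta_trans f' a b c"
    "theta_trans (cc y * f) a b c = y * theta_trans f a b c"
    "theta_trans (UU * f) a b c = of_nat a * theta_trans f (a - 1) b c"
    "theta_trans (VV * f) a b c = of_nat b * theta_trans f a (b - 1) c"
    "theta_trans (WW * f) a b c = of_nat c * theta_trans f a b (c - 1)"
    by (simp_all add: theta_trans_def UU_def VV_def WW_def cc_def)
  show "theta_trans (f + dU f) a b c = theta_trans f (Suc a) b c"
    "theta_trans (f + dV f) a b c = theta_trans f a (Suc b) c"
    "theta_trans (f + dW f) a b c = theta_trans f a b (Suc c)"
    by (simp_all add: theta_trans_def dU_def dV_def dW_def flip: bin_trans_deriv)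
qed

definition theta_rho :: "'r \<Rightarrow> 'r \<Rightarrow> 'r \<Rightarrow> 'r \<Rightarrow> 'r \<Rightarrow> 'r \<Rightarrow> 'r::comm_ring_1" where
  "theta_rho A B C U V W = (let E = 1+U+V+W in
     (1 - (A*(U*E-V*W)+B*(V*E-U*W)+C*(W*E-U*V)))^2
        + 4*(A*A+B*B+C*C-2*A*B-2*A*C-2*B*C-A*B*C)*(U*V*W*E))"

lemma theta_rho_sym:
  "theta_rho B A C V U W = theta_rho A B C U V W"
  "theta_rho C A B W U V = theta_rho A B C U V W"
  by (simp_all add: theta_rho_def Let_def algebra_simps)

text \<open>\<rho> is invariant under simultaneous permutations of (A, U), (B, V), (C, W). So the
  calculus is interpreted three times, with the distinguished variable in first place, for one and
  the same \<open>g\<close>.\<close>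

lemma theta_phi_recurrence:
  assumes g: "g * g * theta_rho (cc A) (cc B) (cc C) UU VV WW = 1"
    and F: "F = theta_trans (Lam (Suc 0) g)"
  shows "of_nat (a+b+c+2) * of_nat (a+1) * F (a+1) b c + of_nat a * of_nat (a+b+c+1) * F (a-1) b c
    + of_nat (b+1) * of_nat c * F a (b+1) (c-1) + of_nat (c+1) * of_nat b * F a (b-1) (c+1)
    = of_nat (a+b+1) * of_nat (a+c+1) * ((2 + A) * F a b c)" (is ?t1)
  and "of_nat (a+b+c+2) * of_nat (b+1) * F a (b+1) c + of_nat b * of_nat (a+b+c+1) * F a (b-1) c
    + of_nat (a+1) * of_nat c * F (a+1) b (c-1) + of_nat (c+1) * of_nat a * F (a-1) b (c+1)
    = of_nat (a+b+1) * of_nat (b+c+1) * ((2 + B) * F a b c)" (is ?t2)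
  and "of_nat (a+b+c+2) * of_nat (c+1) * F a b (c+1) + of_nat c * of_nat (a+b+c+1) * F a b (c-1)
    + of_nat (a+1) * of_nat b * F (a+1) (b-1) c + of_nat (b+1) * of_nat a * F (a-1) (b+1) c
    = of_nat (a+c+1) * of_nat (b+c+1) * ((2 + C) * F a b c)" (is ?t3)
proof -
  note L = Lam_rules Lam_theta
  have Lt2: "VV * dV (Lam (Suc k) f) + UU * dU (Lam (Suc k) f) + WW * dW (Lam (Suc k) f)
     + of_nat (Suc k) * Lam (Suc k) f = Lam k f" 
    and Lt3: "WW * dW (Lam (Suc k) f) + UU * dU (Lam (Suc k) f) + VV * dV (Lam (Suc k) f)
     + of_nat (Suc k) * Lam (Suc k) f = Lam k f" for k f
    using Lam_theta[of k f] by (simp_all only: ac_simps)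
  interpret X1: theta_calculus dU dV dW UU VV WW "cc A" Lam theta_trans A
    by unfold_locales (fact derivations d_vars d_comm d_const Lam_rules Lam_theta theta_trans_rules)+
  interpret X2: theta_calculus dV dU dW VV UU WW "cc B" Lam "\<lambda>f b a c. theta_trans f a b c" B
    by unfold_locales (fact derivations d_vars d_comm d_comm[symmetric] d_const Lam_rules Lt2 theta_trans_rules)+
  interpret X3: theta_calculus dW dU dV WW UU VV "cc C" Lam "\<lambda>f c a b. theta_trans f a b c" C
    by unfold_locales (fact derivations d_vars d_comm d_comm[symmetric] d_const Lam_rules Lt3 theta_trans_rules)+
  note rho = theta_rho_def[unfolded Let_def]
  show ?t1
    by (rule X1.theta_recurrence[OF theta_pde[OF derivations d_vars d_const d_const d_const refl
       g[unfolded rho] refl refl refl refl] refl refl refl F])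
  have F2: "(\<lambda>b a c. F a b c) = (\<lambda>b a c. theta_trans (Lam (Suc 0) g) a b c)"
    and F3: "(\<lambda>c a b. F a b c) = (\<lambda>c a b. theta_trans (Lam (Suc 0) g) a b c)" by (simp_all add: F)
  have g2: "g * g * theta_rho (cc B) (cc A) (cc C) VV UU WW = 1"
    and g3: "g * g * theta_rho (cc C) (cc A) (cc B) WW UU VV = 1"
    using g by (simp_all only: theta_rho_sym[of "cc B" "cc A"] theta_rho_sym(2)[of "cc C" "cc A"])
  show ?t2
    using X2.theta_recurrence[OF theta_pde[OF derivations(2,1,3) d_vars(5,4,6,2,1,3,8,7,9)
        d_const(2,1,3) d_const(2,1,3) d_const(2,1,3) refl
       g2[unfolded rho] refl refl refl refl] refl refl refl F2, of b a c]
    by (simp only: ac_simps)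
  show ?t3
    using X3.theta_recurrence[OF theta_pde[OF derivations(3,1,2) d_vars(9,7,8,3,1,2,6,4,5)
        d_const(3,1,2) d_const(3,1,2) d_const(3,1,2) refl
       g3[unfolded rho] refl refl refl refl] refl refl refl F3, of c a b]
    by (simp only: ac_simps)
qed

section \<open>Existence of the theta series\<close>

text \<open>\<open>J k\<close> stands for the elements of order at least k. Negative k occur because
  U, V, W get order -1, to balance the order 2 of A, B, C.\<close>

locale filtration =
  fixes J :: "int \<Rightarrow> 'a::comm_ring_1 set"
  assumes zero: "0 \<in> J k" and one: "1 \<in> J 0" and minus_one: "- 1 \<in> J 0"
    and add: "x \<in> J k \<Longrightarrow> y \<in> J k \<Longrightarrow> x + y \<in> J k"
    and mult: "x \<in> J i \<Longrightarrow> y \<in> J j \<Longrightarrow> x * y \<in> J (i + j)"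
    and antimono: "k \<le> l \<Longrightarrow> x \<in> J l \<Longrightarrow> x \<in> J k"
begin

lemma mult': "x \<in> J i \<Longrightarrow> y \<in> J j \<Longrightarrow> k = i + j \<Longrightarrow> x * y \<in> J k"
  by (simp add: mult)

lemma uminus: "x \<in> J k \<Longrightarrow> - x \<in> J k"
  using mult[OF minus_one, of x k] by simp

lemma diff: "x \<in> J k \<Longrightarrow> y \<in> J k \<Longrightarrow> x - y \<in> J k"
  using add[OF _ uminus, of x k y] by simp

lemma sum: "(\<And>i. i \<in> I \<Longrightarrow> f i \<in> J k) \<Longrightarrow> sum f I \<in> J k"
  by (induction I rule: infinite_finite_induct) (simp_all add: zero add)

lemma of_nat: "of_nat n \<in> J 0"
  by (induction n) (simp_all add: zero one add)

lemma numeral: "numeral n \<in> J 0"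
  using of_nat[of "numeral n"] by simp

end

text \<open>For \<open>e = 1\<close> the coefficients must lie deeper in the filtration as their index grows, for \<open>e = -1\<close>
  the variable itself contributes one to the order.\<close>

definition fps_filt :: "int \<Rightarrow> (int \<Rightarrow> 'a::zero set) \<Rightarrow> int \<Rightarrow> 'a fps set" where
  "fps_filt e J k = {f. \<forall>n. f $ n \<in> J (k + e * int n)}"

lemma fps_filt_nth: "f \<in> fps_filt e J k \<Longrightarrow> l = k + e * int n \<Longrightarrow> f $ n \<in> J l"
  by (simp add: fps_filt_def)

lemma filtration_fps_filt:
  assumes "filtration J"
  shows "filtration (fps_filt e J)"
proof -
  interpret filtration J by fact
  show ?thesis
  proof (unfold_locales, goal_cases)
    case (5 x i y j)
    have "(x * y) $ n \<in> J (i + j + e * int n)" for n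
      unfolding fps_mult_nth
      by (intro sum mult'[OF fps_filt_nth[OF 5(1) refl] fps_filt_nth[OF 5(2) refl]])
        (simp add: of_nat_diff algebra_simps)
    thus ?case by (simp add: fps_filt_def)
  next
    case (6 k l x)
    thus ?case by (auto simp: fps_filt_def intro!: antimono[OF add_right_mono[OF 6(1)]])
  qed (auto simp: fps_filt_def zero one minus_one intro: add)
qed

lemma fps_const_in_fps_filt: "filtration J \<Longrightarrow> c \<in> J k \<Longrightarrow> fps_const c \<in> fps_filt e J k"
  by (auto simp: fps_filt_def filtration.zero)

lemma fps_X_in_fps_filt: "filtration J \<Longrightarrow> fps_X \<in> fps_filt e J (- e)"
  by (auto simp: fps_filt_def fps_X_def filtration.zero filtration.one)

lemma fps_mult_nth_low:
  fixes f s :: "'a::comm_ring_1 fps"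
  assumes "\<And>k. k < n \<Longrightarrow> s $ k = 0"
  shows "(f * s) $ n = f $ 0 * s $ n"
proof -
  have "(f * s) $ n = (\<Sum>i = 0..n. if i = 0 then f $ 0 * s $ n else 0)"
    unfolding fps_mult_nth by (intro sum.cong) (auto simp: assms)
  thus ?thesis by simp
qed

text \<open>At order n > 0 the equation \<open>g * g * \<rho> = 1\<close> is linear in the new
  coefficient: twice g_0 \<rho>_0 g_n cancels the contribution of the earlier coefficients.
  Multiplying by \<open>g0\<close> and by \<open>hf\<close>, which is 1/2, solves for g_n.\<close>

function inv_sqrt_coeff :: "'a::comm_ring_1 \<Rightarrow> 'a \<Rightarrow> 'a fps \<Rightarrow> nat \<Rightarrow> 'a" where
  "inv_sqrt_coeff hf g0 \<rho> n = (if n = 0 then g0 else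
     - (hf * g0 * (Abs_fps (\<lambda>k. if k < n then inv_sqrt_coeff hf g0 \<rho> k else 0)
       * Abs_fps (\<lambda>k. if k < n then inv_sqrt_coeff hf g0 \<rho> k else 0) * \<rho>) $ n))"
  by auto
termination by (relation "measure (\<lambda>(_, _, _, n). n)") auto

declare inv_sqrt_coeff.simps [simp del]

text \<open>The recursion uses ring operations only, so every coefficient stays in the filtration:
  existence and order bound come together.\<close>

lemma ex_inverse_sqrt:
  fixes J :: "int \<Rightarrow> 'a::comm_ring_1 set"
  assumes J: "filtration J" and hf: "hf \<in> J 0" "2 * hf = 1"
    and \<rho>: "\<rho> \<in> fps_filt 1 J 0" and g0: "g0 \<in> J 0" "g0 * g0 * \<rho> $ 0 = 1"
  shows "\<exists>g \<in> fps_filt 1 J 0. g * g * \<rho> = 1 \<and> g $ 0 = g0"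
proof -
  interpret filtration J by fact
  interpret F: filtration "fps_filt 1 J" by (rule filtration_fps_filt) fact
  define g where "g = Abs_fps (inv_sqrt_coeff hf g0 \<rho>)"
  define t where "t n = Abs_fps (\<lambda>k. if k < n then g $ k else 0)" for n
  have g_0: "g $ 0 = g0" by (simp add: g_def inv_sqrt_coeff.simps)
  have g_Suc: "g $ n = - (hf * g0 * (t n * t n * \<rho>) $ n)" if "n > 0" for n
  proof -
    have "t n = Abs_fps (\<lambda>k. if k < n then inv_sqrt_coeff hf g0 \<rho> k else 0)"
      unfolding t_def g_def fps_nth_Abs_fps ..
    thus ?thesis using that by (simp add: g_def inv_sqrt_coeff.simps[of hf g0 \<rho> n])
  qed
  have "g $ n \<in> J (int n)" for n
  proof (induction n rule: less_induct)
    case (less n)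
    show ?case
    proof (cases "n = 0")
      case False
      have "t n \<in> fps_filt 1 J 0"
        using less by (auto simp: fps_filt_def t_def zero)
      hence "t n * t n * \<rho> \<in> fps_filt 1 J 0"
        using \<rho> F.mult[of _ 0 _ 0] by simp
      hence "(t n * t n * \<rho>) $ n \<in> J (int n)" by (rule fps_filt_nth) simp
      thus ?thesis unfolding g_Suc[OF False[unfolded neq0_conv]]
        by (intro uminus mult'[of _ 0 _ "int n"] mult'[of _ 0 _ 0] hf g0) simp_all
    qed (simp add: g_0 g0)
  qed
  hence "g \<in> fps_filt 1 J 0" by (simp add: fps_filt_def)
  moreover have "g * g * \<rho> = 1"
  proof (rule fps_ext)
    fix n
    show "(g * g * \<rho>) $ n = 1 $ n"
    proof (cases "n = 0")
      case False
      \<comment> \<open>The tail \<open>s\<close> starts at order n, so at this order the mixed term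
        is linear in g_n and the square of the tail drops out.\<close>
      define s where "s = g - t n"
      have s: "s $ k = (if k < n then 0 else g $ k)" for k
        by (simp add: s_def t_def)
      have "g * g * \<rho> = t n * t n * \<rho> + 2 * (t n * \<rho> * s) + s * \<rho> * s"
        by (simp add: s_def algebra_simps)
      also have "\<dots> $ n = (t n * t n * \<rho>) $ n + 2 * (t n * \<rho> * s) $ n + (s * \<rho> * s) $ n"
        by (simp only: fps_add_nth mult_2)
      also have "(t n * \<rho> * s) $ n = g0 * \<rho> $ 0 * g $ n"
        using False by (subst fps_mult_nth_low) (simp_all add: s t_def g_0)
      also have "(s * \<rho> * s) $ n = 0"
        using False by (subst fps_mult_nth_low) (simp_all add: s)
      also have "(t n * t n * \<rho>) $ n + 2 * (g0 * \<rho> $ 0 * g $ n) + 0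
          = (t n * t n * \<rho>) $ n - (2 * hf) * (g0 * g0 * \<rho> $ 0) * (t n * t n * \<rho>) $ n"
        using False by (subst g_Suc) (simp_all only: neq0_conv, simp add: algebra_simps)
      also have "\<dots> = 0" by (simp add: hf g0)
      finally show ?thesis using False by simp
    qed (simp add: g_0 g0)
  qed
  ultimately show ?thesis using g_0 by blast
qed


section \<open>Ring homomorphisms and evaluation of nested polynomials\<close>

definition is_hom :: "('a::comm_ring_1 \<Rightarrow> 'b::comm_ring_1) \<Rightarrow> bool" where
  "is_hom h \<longleftrightarrow> h 1 = 1 \<and> (\<forall>x y. h (x + y) = h x + h y) \<and> (\<forall>x y. h (x * y) = h x * h y)"

lemma is_homI:
  assumes "h 1 = 1" "\<And>x y. h (x + y) = h x + h y" "\<And>x y. h (x * y) = h x * h y"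
  shows "is_hom h"
  using assms by (simp add: is_hom_def)

lemma
  assumes "is_hom h"
  shows hom_1: "h 1 = 1" and hom_add: "h (x + y) = h x + h y" and hom_mult: "h (x * y) = h x * h y"
    and hom_0: "h 0 = 0" and hom_uminus: "h (- x) = - h x" and hom_diff: "h (x - y) = h x - h y"
    and hom_power: "h (x ^ n) = h x ^ n" and hom_sum: "h (sum f I) = (\<Sum>i\<in>I. h (f i))"
    and hom_of_nat: "h (of_nat n) = of_nat n" and hom_numeral: "h (numeral k) = numeral k"
proof -
  show one: "h 1 = 1" and add: "h (x + y) = h x + h y" and mult: "h (x * y) = h x * h y" for x y
    using assms by (simp_all add: is_hom_def)
  show zero: "h 0 = 0" using add[of 0 0] by simp
  show um: "h (- x) = - h x" for x
    using add[of x "- x"] zero by (simp add: eq_neg_iff_add_eq_0 add.commute)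
  show "h (x - y) = h x - h y" using add[of x "- y"] um[of y] by simp
  show "h (x ^ n) = h x ^ n" by (induction n) (simp_all add: one mult)
  show "h (sum f I) = (\<Sum>i\<in>I. h (f i))"
    by (induction I rule: infinite_finite_induct) (simp_all add: zero add)
  show nat: "h (of_nat n) = of_nat n" for n by (induction n) (simp_all add: zero one add)
  show "h (numeral k) = numeral k" using nat[of "numeral k"] by simp
qed

lemmas hom_simps = hom_1 hom_add hom_mult hom_0 hom_uminus hom_diff hom_power hom_sum
  hom_of_nat hom_numeral

lemma is_hom_fps_const: "is_hom h \<Longrightarrow> is_hom (\<lambda>x. fps_const (h x))"
  by (rule is_homI) (simp_all add: hom_simps)

lemma is_hom_id: "is_hom (\<lambda>x. x)"
  by (rule is_homI) simp_all

lemma poly_map_poly_pCons: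
  "is_hom h \<Longrightarrow> poly (map_poly h (pCons c p)) x = h c + x * poly (map_poly h p) x"
  by (simp add: map_poly_pCons hom_0)

lemma is_hom_poly_map_poly:
  assumes h: "is_hom h"
  shows "is_hom (\<lambda>p. poly (map_poly h p) x)"
proof (rule is_homI)
  note [simp] = poly_map_poly_pCons[OF h] hom_simps[OF h]
  show "poly (map_poly h 1) x = 1" by simp
  show add: "poly (map_poly h (p + q)) x = poly (map_poly h p) x + poly (map_poly h q) x" for p q
  proof -
    have "map_poly h (p + q) = map_poly h p + map_poly h q"
      by (simp add: poly_eq_iff coeff_map_poly)
    thus ?thesis by simp
  qed
  have smult: "poly (map_poly h (smult c q)) x = h c * poly (map_poly h q) x" for c q
    by (induction q) (simp_all add: algebra_simps)
  show "poly (map_poly h (p * q)) x = poly (map_poly h p) x * poly (map_poly h q) x" for p q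
  proof (induction p)
    case (pCons c p)
    have "pCons c p * q = smult c q + pCons 0 (p * q)" by simp
    thus ?case using pCons by (simp only: add smult) (simp add: algebra_simps)
  qed simp
qed

lemma is_hom_eval3: "is_hom emb \<Longrightarrow> is_hom (\<lambda>p. eval3 emb p a b c)"
  unfolding eval3_def by (intro is_hom_poly_map_poly)

lemma eval3_simps:
  assumes h: "is_hom emb"
  shows "eval3 emb (C3 k) a b c = emb k"
    "eval3 emb Y12 a b c = a" "eval3 emb Y13 a b c = b" "eval3 emb Y23 a b c = c"
proof -
  note h1 = is_hom_poly_map_poly[OF h, of a]
  note h2 = is_hom_poly_map_poly[OF h1, of b]
  note [simp] = poly_map_poly_pCons[OF h] poly_map_poly_pCons[OF h1] poly_map_poly_pCons[OF h2]
    hom_0[OF h] hom_1[OF h]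
  have [simp]: "map_poly f 0 = 0" for f :: "'x::zero \<Rightarrow> 'y::zero" by simp
  show "eval3 emb (C3 k) a b c = emb k" "eval3 emb Y12 a b c = a"
    "eval3 emb Y13 a b c = b" "eval3 emb Y23 a b c = c"
    by (simp_all add: eval3_def C3_def Y12_def Y13_def Y23_def)
qed

text \<open>The constants and the three variables generate \<open>poly3\<close>; there is one
  induction for each layer of nesting.\<close>

lemma poly3_hom_eqI:
  fixes h h' :: "poly3 \<Rightarrow> 'b::comm_ring_1"
  assumes h: "is_hom h" and h': "is_hom h'" and C: "\<And>c. h (C3 c) = h' (C3 c)"
    and Y: "h Y12 = h' Y12" "h Y13 = h' Y13" "h Y23 = h' Y23"
  shows "h p = h' p"
proof -
  note hs = hom_simps[OF h] hom_simps[OF h']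
  have 1: "h [:[:r:]:] = h' [:[:r:]:]" for r
  proof (induction r)
    case (pCons c r)
    have "[:[:pCons c r:]:] = C3 c + Y12 * [:[:r:]:]" by (simp add: C3_def Y12_def)
    thus ?case using pCons by (simp only: hs C Y)
  qed (simp add: hs)
  have 2: "h [:q:] = h' [:q:]" for q
  proof (induction q)
    case (pCons r q)
    have "[:pCons r q:] = [:[:r:]:] + Y13 * [:q:]" by (simp add: Y13_def)
    thus ?case using pCons by (simp only: hs 1 Y)
  qed (simp add: hs)
  show ?thesis
  proof (induction p)
    case (pCons q p)
    have "pCons q p = [:q:] + Y23 * p" by (simp add: Y23_def)
    thus ?case using pCons by (simp only: hs 2 Y)
  qed (simp add: hs)
qed

text \<open>The expansion of 1 / (1 + X), over any commutative ring.\<close>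

definition fps_alt :: "'a::comm_ring_1 fps" where "fps_alt = Abs_fps (\<lambda>n. (- 1) ^ n)"

lemma fps_alt_inverse: "(1 + fps_X) * fps_alt = 1"
proof (rule fps_ext)
  fix n show "((1 + fps_X) * fps_alt :: 'a fps) $ n = 1 $ n"
    by (cases n) (simp_all add: fps_alt_def distrib_right)
qed

section \<open>Expansion at x = 1 and the order in X\<close>

type_synonym cfps3 = "complex fps fps fps"

definition x12 :: cfps3 where "x12 = fps_X"
definition x13 :: cfps3 where "x13 = fps_const fps_X"
definition x23 :: cfps3 where "x23 = fps_const (fps_const fps_X)"
definition i12 :: cfps3 where "i12 = fps_alt"
definition i13 :: cfps3 where "i13 = fps_const fps_alt"
definition i23 :: cfps3 where "i23 = fps_const (fps_const fps_alt)"

lemma x_inverse: "(1 + x12) * i12 = 1" "(1 + x13) * i13 = 1" "(1 + x23) * i23 = 1"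
proof -
  have const: "(1 + fps_const x) * fps_const i = 1" if "(1 + x) * i = 1" for x i :: "'z::comm_ring_1"
  proof -
    have "1 + fps_const x = fps_const (1 + x)" by (simp flip: fps_const_1_eq_1)
    thus ?thesis by (simp only: fps_const_mult that fps_const_1_eq_1)
  qed
  show "(1 + x12) * i12 = 1" "(1 + x13) * i13 = 1" "(1 + x23) * i23 = 1"
    unfolding x12_def x13_def x23_def i12_def i13_def i23_def
    by (intro const fps_alt_inverse)+
qed

text \<open>The substitution x = 1 + X without the factor \<tau>, which \<open>rescale\<close>
  inserts later; \<open>i12\<close>, \<open>i13\<close>, \<open>i23\<close> are the inverses of the
  three x.\<close>

definition ev3 :: "poly3 \<Rightarrow> cfps3" where
  "ev3 p = eval3 (\<lambda>c. fps_const (fps_const (fps_const c))) p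
     ((1 + x12) + i12) ((1 + x13) + i13) ((1 + x23) + i23)"

lemma is_hom_ev3: "is_hom ev3"
  unfolding ev3_def by (intro is_hom_eval3 is_hom_fps_const is_hom_id)

lemma ev3_simps:
  "ev3 (C3 c) = fps_const (fps_const (fps_const c))"
  "ev3 Y12 = (1 + x12) + i12" "ev3 Y13 = (1 + x13) + i13" "ev3 Y23 = (1 + x23) + i23"
  unfolding ev3_def by (simp_all add: eval3_simps is_hom_fps_const is_hom_id)

text \<open>This is x + 1/x - 2 = (x - 1)^2 / x; hence the shifted variables A, B, C have order
  2.\<close>

lemma ev3_Y:
  "ev3 (Y12 - 2) = x12 * x12 * i12" "ev3 (Y13 - 2) = x13 * x13 * i13" "ev3 (Y23 - 2) = x23 * x23 * i23"
proof -
  have *: "x * x * i = (1 + x) + i - 2" if "(1 + x) * i = 1" for x i :: cfps3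
  proof -
    have "x * i = 1 - i" using that by (simp add: algebra_simps)
    hence "x * x * i = x * (1 - i)" by (simp add: mult.assoc)
    also have "\<dots> = x - (1 - i)" using \<open>x * i = 1 - i\<close> by (simp add: algebra_simps)
    finally show ?thesis by simp
  qed
  show "ev3 (Y12 - 2) = x12 * x12 * i12" "ev3 (Y13 - 2) = x13 * x13 * i13" "ev3 (Y23 - 2) = x23 * x23 * i23"
    by (simp_all add: *[OF x_inverse(1)] *[OF x_inverse(2)] *[OF x_inverse(3)]
       hom_simps[OF is_hom_ev3] ev3_simps)
qed

text \<open>In the base layer only 0 has positive order; the three layers with -1 then count the
  total degree in X, as \<open>in_ordC_iff\<close> spells out.\<close>

definition ordC :: "int \<Rightarrow> 'a::comm_ring_1 fps fps fps set" where
  "ordC = fps_filt (- 1) (fps_filt (- 1) (fps_filt (- 1) (\<lambda>k. {c. 0 < k \<longrightarrow> c = 0})))"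

lemma in_ordC_iff: "f \<in> ordC k \<longleftrightarrow> (\<forall>i j l. int (i + j + l) < k \<longrightarrow> f $ i $ j $ l = 0)"
  by (auto simp: ordC_def fps_filt_def)

lemma filtration_ordC: "filtration ordC"
  unfolding ordC_def
  by (intro filtration_fps_filt, unfold_locales) auto

lemma x_i_in_ordC: "x12 \<in> ordC 1" "x13 \<in> ordC 1" "x23 \<in> ordC 1" "i12 \<in> ordC 0" "i13 \<in> ordC 0" "i23 \<in> ordC 0"
  by (auto simp: in_ordC_iff x12_def x13_def x23_def i12_def i13_def i23_def fps_X_def fps_alt_def)

definition ordP :: "int \<Rightarrow> poly3 set" where "ordP k = {p. ev3 p \<in> ordC k}"

lemma filtration_ordP: "filtration ordP"
proof -
  interpret filtration ordC by (rule filtration_ordC)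
  show ?thesis
    by unfold_locales
      (auto simp: ordP_def hom_simps[OF is_hom_ev3] zero one minus_one intro: add mult antimono)
qed

lemma Y_in_ordP: "Y12 - 2 \<in> ordP 2" "Y13 - 2 \<in> ordP 2" "Y23 - 2 \<in> ordP 2"
proof -
  interpret filtration ordC by (rule filtration_ordC)
  show "Y12 - 2 \<in> ordP 2" "Y13 - 2 \<in> ordP 2" "Y23 - 2 \<in> ordP 2"
    unfolding ordP_def mem_Collect_eq ev3_Y
    by (rule mult'[of _ 2 _ 0], rule mult'[of _ 1 _ 1], simp_all add: x_i_in_ordC)+
qed

lemma C3_in_ordP: "C3 c \<in> ordP 0"
  by (simp add: ordP_def in_ordC_iff)

text \<open>In \<open>ordP3 0\<close> the coefficient of a monomial of degree n in U, V, W has order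
  at least n in X.\<close>

abbreviation "ordP1 \<equiv> fps_filt 1 ordP"
abbreviation "ordP2 \<equiv> fps_filt 1 ordP1"
abbreviation "ordP3 \<equiv> fps_filt 1 ordP2"

lemma filtration_ordP': "filtration ordP1" "filtration ordP2" "filtration ordP3"
  by (intro filtration_fps_filt filtration_ordP)+

lemma half: "C3 (1/2) \<in> ordP 0" "2 * C3 (1/2) = 1"
  "fps_const (C3 (1/2)) \<in> ordP1 0" "2 * fps_const (C3 (1/2)) = 1"
  "fps_const (fps_const (C3 (1/2))) \<in> ordP2 0" "2 * fps_const (fps_const (C3 (1/2))) = 1"
proof -
  show *: "2 * C3 (1/2) = 1"
  proof -
    have "C3 2 * C3 (1/2) = C3 1" by (simp only: C3_mult) simp
    moreover have "C3 2 = 2" "C3 1 = 1" using of_nat_C3[of 2] of_nat_C3[of 1] by simp_all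
    ultimately show ?thesis by simp
  qed
  have const: "2 * fps_const c = 1" if "2 * c = 1" for c :: "'z::comm_ring_1"
    using that by (simp add: fps_eq_iff numeral_fps_const)
  show "C3 (1/2) \<in> ordP 0" "fps_const (C3 (1/2)) \<in> ordP1 0" "fps_const (fps_const (C3 (1/2))) \<in> ordP2 0"
    by (intro fps_const_in_fps_filt filtration_ordP filtration_ordP' C3_in_ordP)+
  show "2 * fps_const (C3 (1/2)) = 1" "2 * fps_const (fps_const (C3 (1/2))) = 1"
    by (intro const *)+
qed

text \<open>At W = 0 the second summand of \<rho> vanishes and \<rho> is the square of 1 -
  \<open>theta_M0\<close>.\<close>

definition theta_M0 :: "'r \<Rightarrow> 'r \<Rightarrow> 'r \<Rightarrow> 'r \<Rightarrow> 'r \<Rightarrow> 'r::comm_ring_1" where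
  "theta_M0 A B C U V = A*(U*(1+U+V)) + B*(V*(1+U+V)) - C*(U*V)"

text \<open>Count orders: products such as U E have order -2 and match A, B, C; the factor of order
  4 matches U V W E of order -4. The summand 1 of E does no harm, since \<open>J 0\<close> lies in
  \<open>J (-1)\<close>.\<close>

lemma theta_rho_in_filtration:
  assumes "filtration J" and ABC: "A \<in> J 2" "B \<in> J 2" "C \<in> J 2"
    and UVW: "U \<in> J (-1)" "V \<in> J (-1)" "W \<in> J (-1)"
  shows "theta_rho A B C U V W \<in> J 0"
proof -
  interpret filtration J by fact
  define E where "E = 1 + U + V + W"
  have E: "E \<in> J (-1)" unfolding E_def by (intro add UVW antimono[OF _ one]) simp
  note UVWE = UVW E
  have 2: "x * y \<in> J (-2)" if "x \<in> J (-1)" "y \<in> J (-1)" for x y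
    using mult[OF that] by simp
  have M: "A*(U*E-V*W)+B*(V*E-U*W)+C*(W*E-U*V) \<in> J 0"
    by (intro add mult'[of _ 2 _ "-2"] ABC diff 2 UVWE) simp_all
  have T: "U*V*W*E \<in> J (-4)"
    by (rule mult'[of _ "-3" _ "-1"], rule mult'[of _ "-2" _ "-1"]) (auto intro: 2 UVWE)
  have AB: "x * y \<in> J 4" if "x \<in> J 2" "y \<in> J 2" for x y
    using mult[OF that] by simp
  have AB2: "2 * x * y \<in> J 4" if "x \<in> J 2" "y \<in> J 2" for x y
    using mult[OF numeral AB[OF that], of num.One] mult[OF numeral AB[OF that], of "num.Bit0 num.One"]
    by (simp add: mult.assoc)
  have ABC3: "A * B * C \<in> J 4"
    by (rule antimono[of 4 6], simp, rule mult'[OF AB, of _ _ _ 2]) (use ABC in auto)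
  have Dl: "A*A+B*B+C*C-2*A*B-2*A*C-2*B*C-A*B*C \<in> J 4"
    by (intro add diff AB AB2 ABC ABC3)
  have "(1 - (A*(U*E-V*W)+B*(V*E-U*W)+C*(W*E-U*V)))^2
        + 4*(A*A+B*B+C*C-2*A*B-2*A*C-2*B*C-A*B*C)*(U*V*W*E) \<in> J 0"
    unfolding power2_eq_square
    by (rule add, rule mult'[of _ 0 _ 0], (intro diff one M)+, simp,
        rule mult'[of _ 4 _ "-4"], rule mult'[of _ 0 _ 4], rule numeral, rule Dl, simp, rule T, simp)
  thus ?thesis by (simp add: theta_rho_def Let_def E_def)
qed

lemma theta_M0_in_filtration:
  assumes "filtration J" and ABC: "A \<in> J 2" "B \<in> J 2" "C \<in> J 2"
    and UV: "U \<in> J (-1)" "V \<in> J (-1)"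
  shows "1 - theta_M0 A B C U V \<in> J 0"
proof -
  interpret filtration J by fact
  have E: "1 + U + V \<in> J (-1)" by (intro add UV antimono[OF _ one]) simp
  have 2: "x * y \<in> J (-2)" if "x \<in> J (-1)" "y \<in> J (-1)" for x y
    using mult[OF that] by simp
  show ?thesis unfolding theta_M0_def
    by (intro diff one add mult'[of _ 2 _ "-2"] ABC 2 UV E) simp_all
qed

abbreviation "c2 \<equiv> \<lambda>a. fps_const (fps_const a)"

text \<open>One variable is added at a time. Applied to 1 - M, first at U = 0 and then in U, the
  square root lemma gives \<open>k2\<close> whose square is 1 / (1 - M), with the order bound. This
  square is the starting value at W = 0 for \<open>g\<close>.\<close>

lemma ex_theta_series:
  "\<exists>g \<in> ordP3 0. g * g * theta_rho (cc (Y12 - 2)) (cc (Y13 - 2)) (cc (Y23 - 2)) UU VV WW = 1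
     \<and> g $ 0 * (1 - theta_M0 (c2 (Y12 - 2)) (c2 (Y13 - 2)) (c2 (Y23 - 2)) fps_X (fps_const fps_X)) = 1"
proof -
  note fil = filtration_ordP filtration_ordP'
  define M where "M = theta_M0 (c2 (Y12 - 2)) (c2 (Y13 - 2)) (c2 (Y23 - 2)) fps_X (fps_const fps_X)"
  define \<rho> where "\<rho> = theta_rho (cc (Y12 - 2)) (cc (Y13 - 2)) (cc (Y23 - 2)) UU VV WW"
  have M: "1 - M \<in> ordP2 0" unfolding M_def
    by (intro theta_M0_in_filtration fil fps_const_in_fps_filt Y_in_ordP fps_X_in_fps_filt)
  have \<rho>: "\<rho> \<in> ordP3 0" unfolding \<rho>_def cc_def UU_def VV_def WW_def
    by (intro theta_rho_in_filtration fil fps_const_in_fps_filt Y_in_ordP fps_X_in_fps_filt)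
  have \<rho>0: "\<rho> $ 0 = (1 - M) * (1 - M)"
    by (simp add: \<rho>_def M_def theta_rho_def theta_M0_def Let_def cc_def UU_def VV_def WW_def
        power2_eq_square algebra_simps)
  have M00: "(1 - M) $ 0 $ 0 = 1" by (simp add: M_def theta_M0_def)
  have M0: "(1 - M) $ 0 \<in> ordP1 0" using M by (rule fps_filt_nth) simp
  obtain k1 where k1: "k1 \<in> ordP1 0" "k1 * k1 * (1 - M) $ 0 = 1"
    using ex_inverse_sqrt[OF filtration_ordP half(1,2) M0 filtration.one[OF filtration_ordP]] M00 by auto
  obtain k2 where k2: "k2 \<in> ordP2 0" "k2 * k2 * (1 - M) = 1"
    using ex_inverse_sqrt[OF fil(2) half(3,4) M k1] by auto
  have k22: "k2 * k2 \<in> ordP2 0" using filtration.mult[OF fil(3) k2(1) k2(1)] by simp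
  have "(k2 * k2) * (k2 * k2) * \<rho> $ 0 = (k2 * k2 * (1 - M)) * (k2 * k2 * (1 - M))"
    unfolding \<rho>0 by (simp only: ac_simps)
  hence "(k2 * k2) * (k2 * k2) * \<rho> $ 0 = 1" by (simp add: k2)
  from ex_inverse_sqrt[OF fil(3) half(5,6) \<rho> k22 this]
  obtain g where "g \<in> ordP3 0" "g * g * \<rho> = 1" "g $ 0 = k2 * k2" by auto
  thus ?thesis using k2(2) unfolding \<rho>_def M_def by metis
qed

section \<open>The genus two Schur polynomials\<close>

text \<open>The equation determines the series up to sign and the condition at W = 0 fixes the sign,
  so the choice is unambiguous.\<close>

definition theta_series :: "poly3 fps fps fps" where
  "theta_series = (SOME g. g \<in> ordP3 0
     \<and> g * g * theta_rho (cc (Y12 - 2)) (cc (Y13 - 2)) (cc (Y23 - 2)) UU VV WW = 1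
     \<and> g $ 0 * (1 - theta_M0 (c2 (Y12 - 2)) (c2 (Y13 - 2)) (c2 (Y23 - 2)) fps_X (fps_const fps_X)) = 1)"

lemma theta_series:
  "theta_series \<in> ordP3 0"
  "theta_series * theta_series * theta_rho (cc (Y12 - 2)) (cc (Y13 - 2)) (cc (Y23 - 2)) UU VV WW = 1"
  "theta_series $ 0 * (1 - theta_M0 (c2 (Y12 - 2)) (c2 (Y13 - 2)) (c2 (Y23 - 2)) fps_X (fps_const fps_X)) = 1"
  unfolding theta_series_def
  by (rule someI2_ex[OF ex_theta_series[unfolded Bex_def]], blast)+

definition theta_phi :: "nat \<Rightarrow> nat \<Rightarrow> nat \<Rightarrow> poly3" where
  "theta_phi = theta_trans (Lam (Suc 0) theta_series)"

lemma inv_fact_1: "inv_fact (Suc 0) = 1"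
  by (simp add: inv_fact_def C3_def one_pCons)

lemma theta_phi_0: "theta_phi 0 0 0 = 1"
proof -
  have "(theta_series $ 0 * (1 - theta_M0 (c2 (Y12 - 2)) (c2 (Y13 - 2)) (c2 (Y23 - 2)) fps_X (fps_const fps_X))) $ 0 $ 0 = 1"
    unfolding theta_series(3) by simp
  hence "theta_series $ 0 $ 0 $ 0 = 1" by (simp add: theta_M0_def)
  thus ?thesis by (simp add: theta_phi_def theta_trans_def bin_trans_def Lam_nth inv_fact_1)
qed

definition theta_family :: "int \<times> int \<times> int \<Rightarrow> poly3" where
  "theta_family j = (case j of (j1, j2, j3) \<Rightarrow>
     if adm j then theta_phi (nat ((j1 + j2 - j3) div 2)) (nat ((j1 + j3 - j2) div 2)) (nat ((j2 + j3 - j1) div 2))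
     else 0)"

lemma adm_nat: "adm (int a + int b, int a + int c, int b + int c)"
  by (auto simp: adm_def)

lemma adm_natE:
  assumes "adm (j1, j2, j3)"
  obtains a b c :: nat where "j1 = int a + int b" "j2 = int a + int c" "j3 = int b + int c"
proof
  have ev: "even (j1 + j2 + j3)" using assms by (simp add: adm_def)
  have "0 \<le> (j1 + j2 - j3) div 2" "0 \<le> (j1 + j3 - j2) div 2" "0 \<le> (j2 + j3 - j1) div 2"
    using assms by (auto simp: adm_def)
  thus "j1 = int (nat ((j1 + j2 - j3) div 2)) + int (nat ((j1 + j3 - j2) div 2))"
    "j2 = int (nat ((j1 + j2 - j3) div 2)) + int (nat ((j2 + j3 - j1) div 2))"
    "j3 = int (nat ((j1 + j3 - j2) div 2)) + int (nat ((j2 + j3 - j1) div 2))"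
    using ev by presburger+
qed

lemma theta_family_nat:
  assumes "j1 = int a + int b" "j2 = int a + int c" "j3 = int b + int c"
  shows "theta_family (j1, j2, j3) = theta_phi a b c"
proof -
  have "j1 + j2 - j3 = 2 * int a" "j1 + j3 - j2 = 2 * int b" "j2 + j3 - j1 = 2 * int c"
    using assms by simp_all
  thus ?thesis using adm_nat[of a b c] assms by (simp add: theta_family_def)
qed

text \<open>In the coordinates a, b, c both factors of each numerator are even, which cancels the
  4.\<close>

lemma Kab_nat:
  fixes a b c :: nat
  defines "d \<equiv> (of_nat (a+b+1) * of_nat (a+c+1) :: complex)"
  shows "Kab 1 1 (int a + int b) (int a + int c) (int b + int c) = of_nat (a+b+c+2) * of_nat (a+1) / d"
    "Kab (-1) (-1) (int a + int b) (int a + int c) (int b + int c) = of_nat a * of_nat (a+b+c+1) / d"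
    "Kab 1 (-1) (int a + int b) (int a + int c) (int b + int c) = of_nat (b+1) * of_nat c / d"
    "Kab (-1) 1 (int a + int b) (int a + int c) (int b + int c) = of_nat (c+1) * of_nat b / d"
proof -
  have *: "x / (4 * (of_nat a + of_nat b + 1) * (of_nat a + of_nat c + 1)) = y / d"
    if "x = 4 * y" for x y
  proof -
    have "x / (4 * (of_nat a + of_nat b + 1) * (of_nat a + of_nat c + 1))
        = 4 * y / (4 * ((of_nat a + of_nat b + 1) * (of_nat a + of_nat c + 1)))"
      by (simp only: that mult.assoc)
    also have "\<dots> = y / ((of_nat a + of_nat b + 1) * (of_nat a + of_nat c + 1))"
      by (rule mult_divide_mult_cancel_left) simp
    finally show ?thesis by (simp add: d_def add_ac)
  qed
  show "Kab 1 1 (int a + int b) (int a + int c) (int b + int c) = of_nat (a+b+c+2) * of_nat (a+1) / d"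
    "Kab (-1) (-1) (int a + int b) (int a + int c) (int b + int c) = of_nat a * of_nat (a+b+c+1) / d"
    "Kab 1 (-1) (int a + int b) (int a + int c) (int b + int c) = of_nat (b+1) * of_nat c / d"
    "Kab (-1) 1 (int a + int b) (int a + int c) (int b + int c) = of_nat (c+1) * of_nat b / d"
    unfolding Kab_def of_int_mult of_int_add of_int_diff of_int_minus of_int_of_nat_eq of_int_numeral of_int_1
    by ((subst mult.assoc[of 4, symmetric])?, rule *, simp add: algebra_simps)+
qed

lemma C3_divide: "C3 (of_nat n * of_nat m / d) = of_nat n * of_nat m * C3 (1 / d)"
  unfolding of_nat_C3 C3_mult by simp

lemma sum_sgns: "(\<Sum>x\<in>sgns. f x) = f (- 1) + f 1"
  by (simp add: sgns_def)

text \<open>The recurrence is divided by its common denominator. Terms that leave the admissible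
  range have coefficient 0, so their values are prescribed only for positive a, c or b.\<close>

lemma schur_equation:
  assumes rec: "of_nat (a+b+c+2) * of_nat (a+1) * f11 + of_nat a * of_nat (a+b+c+1) * fmm
    + of_nat (b+1) * of_nat c * f1m + of_nat (c+1) * of_nat b * fm1
    = of_nat (a+b+1) * of_nat (a+c+1) * (y * f)"
    and \<Phi>: "\<Phi> 1 1 = f11" "a > 0 \<Longrightarrow> \<Phi> (-1) (-1) = fmm" "c > 0 \<Longrightarrow> \<Phi> 1 (-1) = f1m"
      "b > 0 \<Longrightarrow> \<Phi> (-1) 1 = fm1"
  shows "y * f = (\<Sum>x\<in>sgns. \<Sum>z\<in>sgns.
     C3 (Kab x z (int a + int b) (int a + int c) (int b + int c)) * \<Phi> x z)"
proof -
  define d :: complex where "d = of_nat (a+b+1) * of_nat (a+c+1)"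
  have d: "d \<noteq> 0" unfolding d_def by (simp only: mult_eq_0_iff of_nat_eq_0_iff) simp
  have mm: "of_nat a * of_nat (a+b+c+1) * C3 (1/d) * \<Phi> (-1) (-1) = of_nat a * of_nat (a+b+c+1) * C3 (1/d) * fmm"
    and pm: "of_nat (b+1) * of_nat c * C3 (1/d) * \<Phi> 1 (-1) = of_nat (b+1) * of_nat c * C3 (1/d) * f1m"
    and mp: "of_nat (c+1) * of_nat b * C3 (1/d) * \<Phi> (-1) 1 = of_nat (c+1) * of_nat b * C3 (1/d) * fm1"
    using \<Phi> by (cases "a = 0"; cases "b = 0"; cases "c = 0"; simp)+
  have "(\<Sum>x\<in>sgns. \<Sum>z\<in>sgns.
     C3 (Kab x z (int a + int b) (int a + int c) (int b + int c)) * \<Phi> x z)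
    = of_nat a * of_nat (a+b+c+1) * C3 (1/d) * \<Phi> (-1) (-1) + of_nat (c+1) * of_nat b * C3 (1/d) * \<Phi> (-1) 1
      + of_nat (b+1) * of_nat c * C3 (1/d) * \<Phi> 1 (-1) + of_nat (a+b+c+2) * of_nat (a+1) * C3 (1/d) * \<Phi> 1 1"
    by (simp only: sum_sgns Kab_nat C3_divide d_def ac_simps)
  also have "\<dots> = C3 (1/d) * (of_nat (a+b+c+2) * of_nat (a+1) * f11 + of_nat a * of_nat (a+b+c+1) * fmm
    + of_nat (b+1) * of_nat c * f1m + of_nat (c+1) * of_nat b * fm1)"
    unfolding mm pm mp \<Phi>(1) by (simp add: algebra_simps)
  also have "\<dots> = (C3 (1/d) * (of_nat (a+b+1) * of_nat (a+c+1))) * (y * f)"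
    unfolding rec by (simp only: mult.assoc)
  also have "C3 (1/d) * (of_nat (a+b+1) * of_nat (a+c+1)) = C3 ((1/d) * d)"
    unfolding of_nat_C3 C3_mult d_def ..
  also have "\<dots> = 1" using d by (simp add: C3_def one_pCons)
  finally show ?thesis by simp
qed

lemma schur_family_theta_family: "schur_family theta_family"
  unfolding schur_family_def
proof (intro conjI allI impI)
  show "theta_family (0, 0, 0) = 1" using theta_family_nat[of 0 0 0 0 0 0] theta_phi_0 by simp
  show "theta_family j = 0" if "\<not> adm j" for j
    using that by (cases j) (simp add: theta_family_def)
  fix j1 j2 j3
  assume "adm (j1, j2, j3)"
  then obtain a b c :: nat where j: "j1 = int a + int b" "j2 = int a + int c" "j3 = int b + int c"
    by (rule adm_natE)
  note rec = theta_phi_recurrence[OF theta_series(2) theta_phi_def, of a b c]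
  have f: "theta_family (j1, j2, j3) = theta_phi a b c" by (rule theta_family_nat) (simp_all add: j)
  \<comment> \<open>Undoes the shift A = y - 2 in all three recurrences.\<close>
  have two: "2 + (y - 2) = y" for y :: poly3 by simp
  show "Y12 * theta_family (j1, j2, j3) = (\<Sum>x\<in>sgns. \<Sum>z\<in>sgns. C3 (Kab x z j1 j2 j3) * theta_family (j1 + x, j2 + z, j3))"
    unfolding f unfolding j
    by (rule schur_equation[OF rec(1)[unfolded two]]) (rule theta_family_nat; simp add: of_nat_diff)+
  show "Y13 * theta_family (j1, j2, j3) = (\<Sum>x\<in>sgns. \<Sum>z\<in>sgns. C3 (Kab x z j1 j3 j2) * theta_family (j1 + x, j2, j3 + z))"
    unfolding f unfolding j
    \<comment> \<open>The second equation is the first one read in the order b, a, c; the third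
      below uses c, a, b.\<close>
    using schur_equation[of b a c "theta_phi a (b+1) c" "theta_phi a (b-1) c" "theta_phi (a+1) b (c-1)" "theta_phi (a-1) b (c+1)"
        Y13 "theta_phi a b c" "\<lambda>x z. theta_family (int a + int b + x, int a + int c, int b + int c + z)"]
      rec(2)[unfolded two]
    by (simp add: ac_simps theta_family_nat of_nat_diff)
  show "Y23 * theta_family (j1, j2, j3) = (\<Sum>x\<in>sgns. \<Sum>z\<in>sgns. C3 (Kab x z j2 j3 j1) * theta_family (j1, j2 + x, j3 + z))"
    unfolding f unfolding j
    using schur_equation[of c a b "theta_phi a b (c+1)" "theta_phi a b (c-1)" "theta_phi (a+1) (b-1) c" "theta_phi (a-1) (b+1) c"
        Y23 "theta_phi a b c" "\<lambda>x z. theta_family (int a + int b, int a + int c + x, int b + int c + z)"]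
      rec(3)[unfolded two]
    by (simp add: ac_simps theta_family_nat of_nat_diff)
qed

section \<open>Uniqueness of the Schur family\<close>

lemma Kab_11_nonzero: "adm (j1, j2, j3) \<Longrightarrow> Kab 1 1 j1 j2 j3 \<noteq> 0"
  unfolding Kab_def adm_def
  by (simp add: divide_eq_0_iff flip: of_int_add of_int_diff of_int_mult)

lemma schur_step:
  fixes \<Phi> \<Psi> :: "int \<Rightarrow> int \<Rightarrow> poly3"
  assumes eq: "(\<Sum>x\<in>sgns. \<Sum>z\<in>sgns. C3 (k x z) * \<Phi> x z) = (\<Sum>x\<in>sgns. \<Sum>z\<in>sgns. C3 (k x z) * \<Psi> x z)"
    and k: "k 1 1 \<noteq> 0" and rest: "\<Phi> (-1) (-1) = \<Psi> (-1) (-1)" "\<Phi> (-1) 1 = \<Psi> (-1) 1" "\<Phi> 1 (-1) = \<Psi> 1 (-1)"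
  shows "\<Phi> 1 1 = \<Psi> 1 1"
proof -
  have "C3 (k 1 1) * \<Phi> 1 1 = C3 (k 1 1) * \<Psi> 1 1"
    using eq by (simp add: sgns_def rest)
  moreover have "C3 (k 1 1) \<noteq> 0" using k by (simp add: C3_def)
  ultimately show ?thesis by simp
qed

lemma schur_family_equations:
  assumes "schur_family \<Phi>"
  shows "adm (j1, j2, j3) \<Longrightarrow> Y12 * \<Phi> (j1, j2, j3)
      = (\<Sum>x\<in>sgns. \<Sum>z\<in>sgns. C3 (Kab x z j1 j2 j3) * \<Phi> (j1 + x, j2 + z, j3))"
    "adm (j1, j2, j3) \<Longrightarrow> Y13 * \<Phi> (j1, j2, j3)
      = (\<Sum>x\<in>sgns. \<Sum>z\<in>sgns. C3 (Kab x z j1 j3 j2) * \<Phi> (j1 + x, j2, j3 + z))"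
    "adm (j1, j2, j3) \<Longrightarrow> Y23 * \<Phi> (j1, j2, j3)
      = (\<Sum>x\<in>sgns. \<Sum>z\<in>sgns. C3 (Kab x z j2 j3 j1) * \<Phi> (j1, j2 + x, j3 + z))"
  using assms unfolding schur_family_def by blast+

text \<open>Induction on j1 + j2 + j3. A nonzero triple arises from an admissible one by raising two
  entries; in the equation at that lower triple all other terms have smaller sum, and the
  coefficient of the new term is nonzero.\<close>

lemma schur_family_unique:
  assumes \<Phi>: "schur_family \<Phi>" and \<Psi>: "schur_family \<Psi>"
  shows "\<Phi> = \<Psi>"
proof -
  have nonadm: "\<Phi> j = \<Psi> j" if "\<not> adm j" for j
    using \<Phi> \<Psi> that by (cases j) (simp add: schur_family_def)
  have "adm (j1, j2, j3) \<Longrightarrow> nat (j1 + j2 + j3) = n \<Longrightarrow> \<Phi> (j1, j2, j3) = \<Psi> (j1, j2, j3)" for n j1 j2 j3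
  proof (induction n arbitrary: j1 j2 j3 rule: less_induct)
    case (less n)
    have IH: "\<Phi> (i1, i2, i3) = \<Psi> (i1, i2, i3)" if "i1 + i2 + i3 < j1 + j2 + j3" for i1 i2 i3
    proof (cases "adm (i1, i2, i3)")
      case True
      hence "nat (i1 + i2 + i3) < n" using that less.prems by (auto simp: adm_def)
      thus ?thesis using less.IH True by blast
    qed (rule nonadm)
    obtain a b c :: nat where j: "j1 = int a + int b" "j2 = int a + int c" "j3 = int b + int c"
      using less.prems(1) by (rule adm_natE)
    have "adm (j1 - 1, j2 - 1, j3)" if "a > 0"
      using adm_nat[of "a - 1" b c] that by (simp add: j of_nat_diff algebra_simps)
    moreover have "adm (j1 - 1, j2, j3 - 1)" if "b > 0"
      using adm_nat[of a "b - 1" c] that by (simp add: j of_nat_diff algebra_simps)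
    moreover have "adm (j1, j2 - 1, j3 - 1)" if "c > 0"
      using adm_nat[of a b "c - 1"] that by (simp add: j of_nat_diff algebra_simps)
    moreover have "j1 = 0" "j2 = 0" "j3 = 0" if "a = 0" "b = 0" "c = 0"
      using that by (simp_all add: j)
    ultimately consider "j1 = 0" "j2 = 0" "j3 = 0" | "adm (j1 - 1, j2 - 1, j3)" | "adm (j1 - 1, j2, j3 - 1)"
      | "adm (j1, j2 - 1, j3 - 1)"
      by blast
    thus ?case
    proof cases
      case 1
      thus ?thesis using \<Phi> \<Psi> by (simp add: schur_family_def)
    next
      case 2
      note eqs = schur_family_equations(1)[OF \<Phi> 2] schur_family_equations(1)[OF \<Psi> 2]
      have "Y12 * \<Phi> (j1 - 1, j2 - 1, j3) = Y12 * \<Psi> (j1 - 1, j2 - 1, j3)" using IH by simp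
      from schur_step[OF this[unfolded eqs] Kab_11_nonzero[OF 2]]
      show ?thesis by (simp add: IH)
    next
      case 3
      note eqs = schur_family_equations(2)[OF \<Phi> 3] schur_family_equations(2)[OF \<Psi> 3]
      have "adm (j1 - 1, j3 - 1, j2)" using 3 by (auto simp: adm_def)
      note K = Kab_11_nonzero[OF this]
      have "Y13 * \<Phi> (j1 - 1, j2, j3 - 1) = Y13 * \<Psi> (j1 - 1, j2, j3 - 1)" using IH by simp
      from schur_step[OF this[unfolded eqs] K]
      show ?thesis by (simp add: IH)
    next
      case 4
      note eqs = schur_family_equations(3)[OF \<Phi> 4] schur_family_equations(3)[OF \<Psi> 4]
      have "adm (j2 - 1, j3 - 1, j1)" using 4 by (auto simp: adm_def)
      note K = Kab_11_nonzero[OF this]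
      have "Y23 * \<Phi> (j1, j2 - 1, j3 - 1) = Y23 * \<Psi> (j1, j2 - 1, j3 - 1)" using IH by simp
      from schur_step[OF this[unfolded eqs] K]
      show ?thesis by (simp add: IH)
    qed
  qed
  hence "\<Phi> j = \<Psi> j" for j using nonadm by (cases j; cases "adm j") blast+
  thus ?thesis by blast
qed

lemma phi_eq_theta_family: "phi = theta_family"
  unfolding phi_def
  by (rule the_equality) (auto intro: schur_family_theta_family schur_family_unique)

section \<open>The Cauchy sum and its pole\<close>

lemma is_hom_cst: "is_hom cst"
  by (rule is_homI) (simp_all add: cst_def One_fract_def one_pCons ac_simps)

text \<open>The substitution of t X for X, with \<open>h\<close> applied to the
  coefficients.\<close>

definition fps_scale :: "('a \<Rightarrow> 'b) \<Rightarrow> 'b \<Rightarrow> 'a::comm_ring_1 fps \<Rightarrow> 'b::comm_ring_1 fps" where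
  "fps_scale h t f = Abs_fps (\<lambda>n. t ^ n * h (f $ n))"

lemma is_hom_fps_scale:
  assumes h: "is_hom h"
  shows "is_hom (fps_scale h t)"
proof (rule is_homI)
  show "fps_scale h t 1 = 1" "fps_scale h t (x + y) = fps_scale h t x + fps_scale h t y" for x y
    by (simp_all add: fps_scale_def fps_eq_iff hom_simps[OF h] algebra_simps)
  fix x y
  have "t ^ n * (h (x $ i) * h (y $ (n - i))) = (t ^ i * h (x $ i)) * (t ^ (n - i) * h (y $ (n - i)))"
    if "i \<le> n" for i n
  proof -
    have "t ^ n = t ^ i * t ^ (n - i)" using that by (simp flip: power_add)
    thus ?thesis by (simp add: ac_simps)
  qed
  thus "fps_scale h t (x * y) = fps_scale h t x * fps_scale h t y"
    by (simp add: fps_scale_def fps_eq_iff fps_mult_nth hom_simps[OF h] sum_distrib_left)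
qed

definition tau :: "ratf fps" where "tau = 1 - fps_const (inverse kap) * fps_X"

definition rescale :: "cfps3 \<Rightarrow> ring4" where
  "rescale = fps_scale (fps_scale (fps_scale (\<lambda>c. fps_const (cst c)) tau) (fps_const tau))
     (fps_const (fps_const tau))"

lemma is_hom_rescale: "is_hom rescale"
  unfolding rescale_def by (intro is_hom_fps_scale is_hom_fps_const is_hom_cst)

lemma rescale_nth: "rescale f $ i $ j $ k = tau ^ (i + j + k) * fps_const (cst (f $ i $ j $ k))"
  by (simp add: rescale_def fps_scale_def power_add mult.assoc)

lemma tt_eq: "tt = fps_const (fps_const (fps_const tau))"
  by (simp add: tt_def lam_def emb4_def tau_def mult.commute flip: fps_const_1_eq_1)

lemma rescale_x: "rescale x12 = tt * XX12" "rescale x13 = tt * XX13" "rescale x23 = tt * XX23"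
  by (auto simp: fps_eq_iff rescale_nth tt_eq XX12_def XX13_def XX23_def x12_def x13_def x23_def
      fps_X_def hom_simps[OF is_hom_cst])

lemma rescale_const: "rescale (fps_const (fps_const (fps_const c))) = emb4 (cst c)"
  by (auto simp: fps_eq_iff rescale_nth emb4_def hom_simps[OF is_hom_cst])

lemma ring_inv_eqI:
  fixes x w :: "'a::comm_ring_1"
  assumes "x * w = 1"
  shows "ring_inv x = w"
  unfolding ring_inv_def
proof (rule the_equality)
  fix v assume "x * v = 1"
  hence "v = (x * w) * v" by (simp add: assms)
  also have "\<dots> = w * (x * v)" by (simp only: ac_simps)
  finally show "v = w" using \<open>x * v = 1\<close> by simp
qed fact

lemma yy_rescale:
  "yy XX12 = rescale (1 + x12 + i12)" "yy XX13 = rescale (1 + x13 + i13)" "yy XX23 = rescale (1 + x23 + i23)"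
proof -
  have *: "1 + rescale x + ring_inv (1 + rescale x) = rescale (1 + x + i)" if "(1 + x) * i = 1" for x i
  proof -
    have "(1 + rescale x) * rescale i = 1"
      using arg_cong[OF that, of rescale] by (simp add: hom_simps[OF is_hom_rescale])
    hence "ring_inv (1 + rescale x) = rescale i" by (rule ring_inv_eqI)
    thus ?thesis by (simp add: hom_simps[OF is_hom_rescale])
  qed
  show "yy XX12 = rescale (1 + x12 + i12)" "yy XX13 = rescale (1 + x13 + i13)" "yy XX23 = rescale (1 + x23 + i23)"
    unfolding yy_def rescale_x[symmetric] by (intro * x_inverse)+
qed

text \<open>Both sides are homomorphisms in \<open>p\<close>, so the generators suffice. It follows
  that \<lambda> enters the coefficient of X^m only through the power |m| of
  \<open>tau\<close>.\<close>

lemma eval3_rescale: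
  "eval3 (\<lambda>c. emb4 (cst c)) p (yy XX12) (yy XX13) (yy XX23) = rescale (ev3 p)"
proof -
  have emb: "is_hom (\<lambda>c. emb4 (cst c))"
    unfolding emb4_def by (intro is_hom_fps_const is_hom_cst)
  have "is_hom (\<lambda>p. rescale (ev3 p))"
    by (rule is_homI) (simp_all add: hom_simps[OF is_hom_ev3] hom_simps[OF is_hom_rescale])
  thus ?thesis
    by (rule poly3_hom_eqI[OF is_hom_eval3[OF emb]])
      (simp_all only: eval3_simps[OF emb] ev3_simps rescale_const yy_rescale)
qed

lemma Cterm_nth:
  fixes a b c :: nat
  shows "Cterm (int a + int b, int a + int c, int b + int c) $ m1 $ m2 $ m3
    = fps_const (cst (ev3 (theta_phi a b c) $ m1 $ m2 $ m3) * (kap ^ (a + b + 1) - inverse kap ^ (a + b + 1)))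
      * tau ^ (m1 + m2 + m3) * fps_X ^ (a + b + 2 * c)"
proof -
  have n: "nat (int a + int b) = a + b" "nat (int a + int c + (int b + int c)) = a + b + 2 * c"
    by (simp_all add: nat_add_distrib)
  have l: "lam ^ k = fps_const (fps_const (fps_const (fps_X ^ k)))" for k
    by (simp add: lam_def fps_const_power)
  have emb4_const: "emb4 k = fps_const (fps_const (fps_const (fps_const k)))" for k
    by (simp add: emb4_def)
  have cst: "(F * fps_const (fps_const (fps_const u))) $ m1 $ m2 $ m3 = F $ m1 $ m2 $ m3 * u" for F :: ring4 and u
    by simp
  have "phi (int a + int b, int a + int c, int b + int c) = theta_phi a b c"
    unfolding phi_eq_theta_family by (rule theta_family_nat) simp_all
  hence "Cterm (int a + int b, int a + int c, int b + int c) $ m1 $ m2 $ m3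
     = rescale (ev3 (theta_phi a b c)) $ m1 $ m2 $ m3 * fps_const (kap ^ (a + b + 1) - inverse kap ^ (a + b + 1))
       * fps_X ^ (a + b + 2 * c)"
    unfolding Cterm_def prod.case n eval3_rescale l unfolding emb4_const cst by (simp only:)
  thus ?thesis unfolding rescale_nth by (simp only: fps_const_mult[symmetric] ac_simps)
qed

definition theta_weight :: "nat \<Rightarrow> nat \<Rightarrow> nat \<Rightarrow> nat \<Rightarrow> nat \<Rightarrow> nat \<Rightarrow> complex" where
  "theta_weight m1 m2 m3 p q r = inverse (fact (p + q + r + 1)) * (ev3 (theta_series $ r $ p $ q) $ m1 $ m2 $ m3)"

text \<open>The order bound of \<open>theta_series\<close>; it limits p, q, r by |m|, independently
  of a, b, c.\<close>

lemma theta_weight_eq_0: "m1 + m2 + m3 < p + q + r \<Longrightarrow> theta_weight m1 m2 m3 p q r = 0"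
proof -
  assume m: "m1 + m2 + m3 < p + q + r"
  have "theta_series $ r \<in> ordP2 (int r)" using theta_series(1) by (rule fps_filt_nth) simp
  hence "theta_series $ r $ p \<in> ordP1 (int r + int p)" by (rule fps_filt_nth) simp
  hence "theta_series $ r $ p $ q \<in> ordP (int r + int p + int q)" by (rule fps_filt_nth) simp
  thus ?thesis using m by (simp add: theta_weight_def ordP_def in_ordC_iff)
qed

text \<open>Terms vanish beyond a by the binomial coefficient and beyond M by assumption, so both
  sums equal the one up to the maximum.\<close>

lemma sum_ffact_range:
  fixes f :: "nat \<Rightarrow> 'a::comm_ring_1"
  assumes "\<And>p. p > M \<Longrightarrow> f p = 0"
  shows "(\<Sum>p\<le>a. f p * of_nat ((a choose p) * fact p)) = (\<Sum>p\<le>M. f p * of_nat ((a choose p) * fact p))"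
proof -
  have "(\<Sum>p\<le>a. f p * of_nat ((a choose p) * fact p)) = (\<Sum>p\<le>max a M. f p * of_nat ((a choose p) * fact p))"
    by (rule sum.mono_neutral_left) (auto simp: binomial_eq_0)
  also have "\<dots> = (\<Sum>p\<le>M. f p * of_nat ((a choose p) * fact p))"
    by (rule sum.mono_neutral_right) (auto simp: assms)
  finally show ?thesis .
qed

lemma fps_mult_of_nat_nth: "(f * of_nat k) $ n = f $ n * of_nat k"
  by (simp add: fps_of_nat[symmetric])

lemma bin_trans_nth: "bin_trans h a $ n = (\<Sum>p\<le>a. h $ p $ n * of_nat ((a choose p) * fact p))"
  by (simp only: bin_trans_def fps_sum_nth fps_mult_of_nat_nth)

lemma ev3_theta_phi_nth:
  "ev3 (theta_phi a b c) $ m1 $ m2 $ m3 = (\<Sum>q\<le>m1+m2+m3. \<Sum>p\<le>m1+m2+m3. \<Sum>r\<le>m1+m2+m3.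
     theta_weight m1 m2 m3 p q r * of_nat ((c choose r) * fact r) * of_nat ((a choose p) * fact p)
       * of_nat ((b choose q) * fact q))"
proof -
  let ?M = "m1 + m2 + m3"
  have nat: "(x * of_nat k) $ m1 $ m2 $ m3 = x $ m1 $ m2 $ m3 * of_nat k" for x :: cfps3 and k
    by (simp only: fps_mult_of_nat_nth)
  have cst: "(fps_const (fps_const (fps_const k)) * x) $ m1 $ m2 $ m3 = k * x $ m1 $ m2 $ m3" for x :: cfps3 and k
    by simp
  have nth_sum: "(sum f I) $ m1 $ m2 $ m3 = (\<Sum>i\<in>I. f i $ m1 $ m2 $ m3)" for f :: "nat \<Rightarrow> cfps3" and I
    by (simp add: fps_sum_nth)
  have idx: "r + p + q + Suc 0 = p + q + r + 1" for p q r :: nat by simp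
  have theta_phi: "theta_phi a b c = (\<Sum>q\<le>b. (\<Sum>p\<le>a. (\<Sum>r\<le>c. inv_fact (r + p + q + Suc 0) * theta_series $ r $ p $ q
      * of_nat ((c choose r) * fact r)) * of_nat ((a choose p) * fact p)) * of_nat ((b choose q) * fact q))"
    unfolding theta_phi_def theta_trans_def
    by (simp only: bin_trans_def[of "bin_trans (bin_trans (Lam (Suc 0) theta_series) c) a" b]
        bin_trans_nth fps_sum_nth fps_mult_of_nat_nth Lam_nth)
  have "ev3 (theta_phi a b c) $ m1 $ m2 $ m3 = (\<Sum>q\<le>b. (\<Sum>p\<le>a. (\<Sum>r\<le>c. theta_weight m1 m2 m3 p q r
      * of_nat ((c choose r) * fact r)) * of_nat ((a choose p) * fact p)) * of_nat ((b choose q) * fact q))"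
    unfolding theta_phi hom_sum[OF is_hom_ev3] hom_mult[OF is_hom_ev3] hom_of_nat[OF is_hom_ev3] nth_sum nat
      inv_fact_def ev3_simps(1) cst theta_weight_def idx by (rule refl)
  also have "\<dots> = (\<Sum>q\<le>?M. (\<Sum>p\<le>?M. (\<Sum>r\<le>?M. theta_weight m1 m2 m3 p q r
      * of_nat ((c choose r) * fact r)) * of_nat ((a choose p) * fact p)) * of_nat ((b choose q) * fact q))"
  proof -
    have 1: "(\<Sum>r\<le>c. theta_weight m1 m2 m3 p q r * of_nat ((c choose r) * fact r))
        = (\<Sum>r\<le>?M. theta_weight m1 m2 m3 p q r * of_nat ((c choose r) * fact r))" for p q
      by (rule sum_ffact_range) (simp add: theta_weight_eq_0)
    have 2: "(\<Sum>p\<le>a. (\<Sum>r\<le>?M. theta_weight m1 m2 m3 p q r * of_nat ((c choose r) * fact r)) * of_nat ((a choose p) * fact p))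
        = (\<Sum>p\<le>?M. (\<Sum>r\<le>?M. theta_weight m1 m2 m3 p q r * of_nat ((c choose r) * fact r)) * of_nat ((a choose p) * fact p))" for q
      by (rule sum_ffact_range) (simp add: theta_weight_eq_0)
    show ?thesis unfolding 1 2 by (rule sum_ffact_range) (simp add: theta_weight_eq_0)
  qed
  finally show ?thesis by (simp only: sum_distrib_right)
qed

text \<open>The third series is one in \<lambda>^2, because j2 + j3 = a + b + 2c.\<close>

lemma fps_mult3_even_nth:
  fixes f g h :: "nat \<Rightarrow> 'a::comm_ring_1"
  shows "(Abs_fps f * Abs_fps g * Abs_fps (\<lambda>n. if even n then h (n div 2) else 0)) $ N
    = (\<Sum>(a, b, c) \<in> {(a, b, c). a + b + 2 * c = N}. f a * g b * h c)"
proof -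
  have "(Abs_fps f * Abs_fps g * Abs_fps (\<lambda>n. if even n then h (n div 2) else 0)) $ N
    = (\<Sum>i = 0..N. \<Sum>a = 0..i. if even (N - i) then f a * g (i - a) * h ((N - i) div 2) else 0)"
    by (simp add: fps_mult_nth sum_distrib_right) (intro sum.cong refl, simp)
  also have "\<dots> = (\<Sum>(i, a) \<in> Sigma {0..N} (\<lambda>i. {0..i}).
      if even (N - i) then f a * g (i - a) * h ((N - i) div 2) else 0)"
    by (subst sum.Sigma) auto
  also have "\<dots> = (\<Sum>(i, a) \<in> {(i, a) \<in> Sigma {0..N} (\<lambda>i. {0..i}). even (N - i)}.
      f a * g (i - a) * h ((N - i) div 2))"
    by (rule sum.mono_neutral_cong_right) (auto intro: finite_SigmaI simp del: even_diff_nat split: if_splits)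
  also have "\<dots> = (\<Sum>(a, b, c) \<in> {(a, b, c). a + b + 2 * c = N}. f a * g b * h c)"
    by (rule sum.reindex_bij_witness[of _ "\<lambda>(a, b, c). (a + b, a)" "\<lambda>(i, a). (a, i - a, (N - i) div 2)"])
      auto
  finally show ?thesis .
qed

text \<open>The series p! (k\<lambda>)^p / (1 - k\<lambda>)^(p+1), see
  \<open>ffact_gf_closed\<close>; k will be \<kappa> or its inverse.\<close>

definition ffact_gf :: "nat \<Rightarrow> ratf \<Rightarrow> ratf fps" where
  "ffact_gf p k = Abs_fps (\<lambda>a. of_nat ((a choose p) * fact p) * k ^ a)"

definition ffact_even_gf :: "nat \<Rightarrow> ratf fps" where
  "ffact_even_gf r = Abs_fps (\<lambda>n. if even n then of_nat ((n div 2 choose r) * fact r) else 0)"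

lemma finite_triples: "finite {(a, b, c). a + b + 2 * c \<le> (n :: nat)}"
  by (rule finite_subset[of _ "{..n} \<times> {..n} \<times> {..n}"]) auto

text \<open>As a, b, c range freely over the naturals, the sum over triples factorises. The two
  powers of \<kappa> are kept apart because only the second part has its pole at \<lambda> =
  \<kappa>.\<close>

lemma Cminus_eq:
  fixes m1 m2 m3 :: nat
  defines "M \<equiv> m1 + m2 + m3"
  shows "Cminus m1 m2 m3 = (\<Sum>q\<le>M. \<Sum>p\<le>M. \<Sum>r\<le>M. fps_const (cst (theta_weight m1 m2 m3 p q r)) *
     (fps_const kap * (tau ^ M * ffact_gf p kap * ffact_gf q kap * ffact_even_gf r)
      - fps_const (inverse kap) * (tau ^ M * ffact_gf p (inverse kap) * ffact_gf q (inverse kap) * ffact_even_gf r)))"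
proof (rule fps_ext)
  fix n :: nat
  define e where "e a b c = cst (ev3 (theta_phi a b c) $ m1 $ m2 $ m3)
     * (kap * kap ^ (a + b) - inverse kap * inverse kap ^ (a + b))" for a b c
  define T where "T N = {(a, b, c). a + b + 2 * c = (N :: nat)}" for N
  \<comment> \<open>The Cauchy sum without the common factor \<open>tau ^ M\<close>, collected by
    powers of \<lambda>.\<close>
  define S where "S = Abs_fps (\<lambda>N. \<Sum>(a, b, c) \<in> T N. e a b c)"
  have T: "(ffact_gf p k * ffact_gf q k * ffact_even_gf r) $ N = (\<Sum>(a, b, c) \<in> T N. of_nat ((c choose r) * fact r)
      * of_nat ((a choose p) * fact p) * of_nat ((b choose q) * fact q) * k ^ (a + b))" for p q r N k
    unfolding ffact_gf_def ffact_even_gf_def T_def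
      fps_mult3_even_nth[of _ _ "\<lambda>n. of_nat ((n choose r) * fact r)"]
    by (intro sum.cong refl) (simp only: split_beta power_add ac_simps)
  have ecst: "cst (ev3 (theta_phi a b c) $ m1 $ m2 $ m3) = (\<Sum>q\<le>M. \<Sum>p\<le>M. \<Sum>r\<le>M.
     cst (theta_weight m1 m2 m3 p q r) * (of_nat ((c choose r) * fact r) * of_nat ((a choose p) * fact p)
       * of_nat ((b choose q) * fact q)))" for a b c
    unfolding ev3_theta_phi_nth M_def
    by (simp only: hom_sum[OF is_hom_cst] hom_mult[OF is_hom_cst] hom_of_nat[OF is_hom_cst] mult.assoc)
  have S: "S = (\<Sum>q\<le>M. \<Sum>p\<le>M. \<Sum>r\<le>M. fps_const (cst (theta_weight m1 m2 m3 p q r)) *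
     (fps_const kap * (ffact_gf p kap * ffact_gf q kap * ffact_even_gf r)
      - fps_const (inverse kap) * (ffact_gf p (inverse kap) * ffact_gf q (inverse kap) * ffact_even_gf r)))"
  proof (rule fps_ext)
    fix N
    have "S $ N = (\<Sum>(a, b, c) \<in> T N. \<Sum>q\<le>M. \<Sum>p\<le>M. \<Sum>r\<le>M. cst (theta_weight m1 m2 m3 p q r) *
      (of_nat ((c choose r) * fact r) * of_nat ((a choose p) * fact p)
       * of_nat ((b choose q) * fact q) * (kap * kap ^ (a + b) - inverse kap * inverse kap ^ (a + b))))"
      unfolding S_def fps_nth_Abs_fps e_def ecst sum_distrib_right
      by (simp only: mult.assoc)
    also have "\<dots> = (\<Sum>q\<le>M. \<Sum>p\<le>M. \<Sum>r\<le>M. \<Sum>(a, b, c) \<in> T N. cst (theta_weight m1 m2 m3 p q r) *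
      (of_nat ((c choose r) * fact r) * of_nat ((a choose p) * fact p)
       * of_nat ((b choose q) * fact q) * (kap * kap ^ (a + b) - inverse kap * inverse kap ^ (a + b))))"
      unfolding split_beta
      by (subst sum.swap, intro sum.cong refl, subst sum.swap, intro sum.cong refl, subst sum.swap, rule refl)
    also have "\<dots> = (\<Sum>q\<le>M. \<Sum>p\<le>M. \<Sum>r\<le>M. (fps_const (cst (theta_weight m1 m2 m3 p q r)) *
     (fps_const kap * (ffact_gf p kap * ffact_gf q kap * ffact_even_gf r)
      - fps_const (inverse kap) * (ffact_gf p (inverse kap) * ffact_gf q (inverse kap) * ffact_even_gf r))) $ N)"
      unfolding fps_mult_left_const_nth fps_sub_nth T sum_distrib_left sum_subtractf[symmetric]
      by (intro sum.cong refl) (simp only: split_beta algebra_simps)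
    finally show "S $ N = (\<Sum>q\<le>M. \<Sum>p\<le>M. \<Sum>r\<le>M. fps_const (cst (theta_weight m1 m2 m3 p q r)) *
     (fps_const kap * (ffact_gf p kap * ffact_gf q kap * ffact_even_gf r)
      - fps_const (inverse kap) * (ffact_gf p (inverse kap) * ffact_gf q (inverse kap) * ffact_even_gf r))) $ N"
      by (simp only: fps_sum_nth)
  qed
  let ?R = "{(a, b, c). a + b + 2 * c \<le> n}"
  have C: "Cterm (int a + int b, int a + int c, int b + int c) $ m1 $ m2 $ m3
      = fps_const (e a b c) * tau ^ M * fps_X ^ (a + b + 2 * c)" for a b c
    unfolding Cterm_nth e_def M_def by (simp only: Suc_eq_plus1[symmetric] power_Suc)
  have bij: "bij_betw (\<lambda>(a, b, c). (int a + int b, int a + int c, int b + int c)) ?R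
      {j. adm j \<and> fst (snd j) + snd (snd j) \<le> int n}"
  proof (rule bij_betwI')
    fix j assume "j \<in> {j. adm j \<and> fst (snd j) + snd (snd j) \<le> int n}"
    moreover obtain j1 j2 j3 where j: "j = (j1, j2, j3)" by (cases j)
    ultimately have "adm (j1, j2, j3)" "j2 + j3 \<le> int n" by auto
    then obtain a b c :: nat where "j1 = int a + int b" "j2 = int a + int c" "j3 = int b + int c"
      by (elim adm_natE)
    thus "\<exists>x\<in>?R. j = (case x of (a, b, c) \<Rightarrow> (int a + int b, int a + int c, int b + int c))"
      using j \<open>j2 + j3 \<le> int n\<close> by (intro bexI[of _ "(a, b, c)"]) auto
  qed (auto simp: adm_nat)
  have "Cminus m1 m2 m3 $ n = (\<Sum>j\<in>{j. adm j \<and> fst (snd j) + snd (snd j) \<le> int n}. Cterm j $ m1 $ m2 $ m3 $ n)"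
    by (simp add: Cminus_def)
  also have "\<dots> = (\<Sum>x\<in>?R. Cterm (case x of (a, b, c) \<Rightarrow> (int a + int b, int a + int c, int b + int c)) $ m1 $ m2 $ m3 $ n)"
    by (rule sum.reindex_bij_betw[OF bij, symmetric])
  also have "\<dots> = (\<Sum>(a, b, c)\<in>?R. Cterm (int a + int b, int a + int c, int b + int c) $ m1 $ m2 $ m3 $ n)"
    by (simp add: split_beta)
  also have "\<dots> = (\<Sum>(a, b, c)\<in>?R. e a b c * (tau ^ M) $ (n - (a + b + 2 * c)))"
    by (intro sum.cong refl) (auto simp: C fps_X_power_mult_right_nth)
  \<comment> \<open>Grouping the triples by N = a + b + 2c exhibits a coefficient of the product of
    \<open>S\<close> and \<open>tau ^ M\<close>.\<close>
  also have "\<dots> = (\<Sum>N = 0..n. \<Sum>x\<in>{x\<in>?R. (case x of (a, b, c) \<Rightarrow> a + b + 2 * c) = N}.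
      case x of (a, b, c) \<Rightarrow> e a b c * (tau ^ M) $ (n - (a + b + 2 * c)))"
    by (rule sum.group[symmetric]) (auto intro: finite_triples)
  also have "\<dots> = (\<Sum>N = 0..n. S $ N * (tau ^ M) $ (n - N))"
    unfolding S_def fps_nth_Abs_fps sum_distrib_right T_def
    by (intro sum.cong refl) (auto intro!: sum.cong)
  also have "\<dots> = (S * tau ^ M) $ n" by (simp add: fps_mult_nth)
  finally have "Cminus m1 m2 m3 $ n = (S * tau ^ M) $ n" .
  moreover have "S * tau ^ M = (\<Sum>q\<le>M. \<Sum>p\<le>M. \<Sum>r\<le>M. fps_const (cst (theta_weight m1 m2 m3 p q r)) *
     (fps_const kap * (tau ^ M * ffact_gf p kap * ffact_gf q kap * ffact_even_gf r)
      - fps_const (inverse kap) * (tau ^ M * ffact_gf p (inverse kap) * ffact_gf q (inverse kap) * ffact_even_gf r)))"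
    unfolding S sum_distrib_right by (intro sum.cong refl) (simp only: algebra_simps)
  ultimately show "Cminus m1 m2 m3 $ n = (\<Sum>q\<le>M. \<Sum>p\<le>M. \<Sum>r\<le>M. fps_const (cst (theta_weight m1 m2 m3 p q r)) *
     (fps_const kap * (tau ^ M * ffact_gf p kap * ffact_gf q kap * ffact_even_gf r)
      - fps_const (inverse kap) * (tau ^ M * ffact_gf p (inverse kap) * ffact_gf q (inverse kap) * ffact_even_gf r))) $ n"
    by (simp only:)
qed

section \<open>Closed forms of the generating functions\<close>

lemma ffact_gf_0: "(1 - fps_const k * fps_X) * ffact_gf 0 k = 1"
proof (rule fps_ext)
  fix n show "((1 - fps_const k * fps_X) * ffact_gf 0 k) $ n = 1 $ n"
    by (cases n) (simp_all add: ffact_gf_def left_diff_distrib mult.assoc)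
qed

lemma ffact_gf_Suc: "(1 - fps_const k * fps_X) * ffact_gf (Suc p) k = of_nat (Suc p) * fps_const k * fps_X * ffact_gf p k"
proof (rule fps_ext)
  fix n show "((1 - fps_const k * fps_X) * ffact_gf (Suc p) k) $ n
      = (of_nat (Suc p) * fps_const k * fps_X * ffact_gf p k) $ n"
  proof (cases n)
    case (Suc a)
    have "((1 - fps_const k * fps_X) * ffact_gf (Suc p) k) $ Suc a = ffact_gf (Suc p) k $ Suc a - k * ffact_gf (Suc p) k $ a"
      by (simp add: left_diff_distrib mult.assoc)
    also have "\<dots> = of_nat (Suc p) * (k * ffact_gf p k $ a)"
      unfolding ffact_gf_def fps_nth_Abs_fps ffact_Suc_Suc of_nat_add of_nat_mult[of "Suc p"] power_Suc
      by (simp only: algebra_simps)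
    also have "\<dots> = (of_nat (Suc p) * fps_const k * fps_X * ffact_gf p k) $ Suc a"
      by (simp add: mult.assoc fps_of_nat[symmetric] del: of_nat_Suc)
    finally show ?thesis unfolding Suc .
  qed (simp add: ffact_gf_def mult.assoc fps_of_nat[symmetric] del: of_nat_Suc)
qed

lemma ffact_gf_closed:
  "(1 - fps_const k * fps_X) ^ Suc p * ffact_gf p k = of_nat (fact p) * (fps_const k * fps_X) ^ p"
proof (induction p)
  case (Suc p)
  have "(1 - fps_const k * fps_X) ^ Suc (Suc p) * ffact_gf (Suc p) k
    = (1 - fps_const k * fps_X) ^ Suc p * ((1 - fps_const k * fps_X) * ffact_gf (Suc p) k)"
    by (simp only: power_Suc ac_simps)
  also have "\<dots> = of_nat (Suc p) * (fps_const k * fps_X) * ((1 - fps_const k * fps_X) ^ Suc p * ffact_gf p k)"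
    unfolding ffact_gf_Suc by (simp only: ac_simps)
  also have "\<dots> = of_nat (fact (Suc p)) * (fps_const k * fps_X) ^ Suc p"
    unfolding Suc.IH by (simp only: fact_Suc of_nat_mult of_nat_id power_Suc ac_simps)
  finally show ?case .
qed (simp add: ffact_gf_0)

lemma ffact_even_gf_0: "(1 - fps_X ^ 2) * ffact_even_gf 0 = 1"
proof (rule fps_ext)
  fix n show "((1 - fps_X ^ 2) * ffact_even_gf 0) $ n = 1 $ n"
    by (simp add: ffact_even_gf_def left_diff_distrib fps_X_power_mult_nth) presburger
qed

lemma ffact_even_gf_Suc: "(1 - fps_X ^ 2) * ffact_even_gf (Suc r) = of_nat (Suc r) * fps_X ^ 2 * ffact_even_gf r"
proof (rule fps_ext)
  fix n show "((1 - fps_X ^ 2) * ffact_even_gf (Suc r)) $ n = (of_nat (Suc r) * fps_X ^ 2 * ffact_even_gf r) $ n"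
  proof (cases "even n \<and> 2 \<le> n")
    case True
    then obtain c where n: "n = 2 * Suc c"
      by (elim conjE evenE) (metis Suc_pred' numeral_2_eq_2 mult_is_0 neq0_conv not_less_eq_eq zero_less_Suc le0)
    have "((1 - fps_X ^ 2) * ffact_even_gf (Suc r)) $ n
      = of_nat ((Suc c choose Suc r) * fact (Suc r)) - of_nat ((c choose Suc r) * fact (Suc r))"
      unfolding n by (simp add: ffact_even_gf_def left_diff_distrib fps_X_power_mult_nth del: of_nat_mult fact_Suc binomial_Suc_Suc)
    also have "\<dots> = of_nat (Suc r) * of_nat ((c choose r) * fact r)"
      unfolding ffact_Suc_Suc of_nat_add of_nat_mult[of "Suc r"] by simp
    also have "\<dots> = (of_nat (Suc r) * fps_X ^ 2 * ffact_even_gf r) $ n"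
      unfolding n mult.assoc
      by (simp add: fps_of_nat[symmetric] ffact_even_gf_def fps_X_power_mult_nth del: of_nat_mult of_nat_Suc)
    finally show ?thesis .
  next
    case False
    hence "odd n \<or> n = 0" by presburger
    thus ?thesis
      by (auto simp: mult.assoc fps_of_nat[symmetric] ffact_even_gf_def left_diff_distrib fps_X_power_mult_nth
          simp del: of_nat_Suc)
  qed
qed

lemma ffact_even_gf_closed: "(1 - fps_X ^ 2) ^ Suc r * ffact_even_gf r = of_nat (fact r) * (fps_X ^ 2) ^ r"
proof (induction r)
  case (Suc r)
  have "(1 - fps_X ^ 2) ^ Suc (Suc r) * ffact_even_gf (Suc r) = (1 - fps_X ^ 2) ^ Suc r * ((1 - fps_X ^ 2) * ffact_even_gf (Suc r))"
    by (simp only: power_Suc ac_simps)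
  also have "\<dots> = of_nat (Suc r) * (fps_X ^ 2) * ((1 - fps_X ^ 2) ^ Suc r * ffact_even_gf r)"
    unfolding ffact_even_gf_Suc by (simp only: ac_simps)
  also have "\<dots> = of_nat (fact (Suc r)) * (fps_X ^ 2) ^ Suc r"
    unfolding Suc.IH by (simp only: fact_Suc of_nat_mult of_nat_id power_Suc ac_simps)
  finally show ?case .
qed (simp add: ffact_even_gf_0)

section \<open>The coefficient of the double pole\<close>

definition is_lead2 :: "ratf fps \<Rightarrow> ratf \<Rightarrow> bool" where
  "is_lead2 f c \<longleftrightarrow> (\<exists>P Q :: ratf poly. poly Q kap \<noteq> 0 \<and>
      fps_of_poly (Q * [:1, - inverse kap:] ^ 2) * f = fps_of_poly P \<and> c = poly P kap / poly Q kap)"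

lemma fps_of_poly_tau: "fps_of_poly [:1, - inverse kap:] = tau"
  by (simp add: tau_def fps_of_poly_pCons mult.commute)

lemma is_lead2I:
  assumes "fps_of_poly Q * tau ^ 2 * f = fps_of_poly P" "poly Q kap \<noteq> 0" "c = poly P kap / poly Q kap"
  shows "is_lead2 f c"
  using assms unfolding is_lead2_def fps_of_poly_mult fps_of_poly_power fps_of_poly_tau by metis

lemma is_lead2E:
  assumes "is_lead2 f c"
  obtains P Q where "fps_of_poly Q * tau ^ 2 * f = fps_of_poly P" "poly Q kap \<noteq> 0" "c = poly P kap / poly Q kap"
  using assms that unfolding is_lead2_def fps_of_poly_mult fps_of_poly_power fps_of_poly_tau by metis

text \<open>Two representations satisfy Q P' = Q' P, both being Q Q' \<open>tau\<close>^2 f;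
  evaluation at \<open>kap\<close> gives equal quotients.\<close>

lemma lead2_eqI:
  assumes "is_lead2 f c"
  shows "lead2 f = c"
  unfolding lead2_def is_lead2_def[symmetric]
proof (rule the_equality)
  fix c' assume "is_lead2 f c'"
  then obtain P' Q' where 1: "fps_of_poly Q' * tau ^ 2 * f = fps_of_poly P'" "poly Q' kap \<noteq> 0"
    "c' = poly P' kap / poly Q' kap" by (rule is_lead2E)
  from assms obtain P Q where 2: "fps_of_poly Q * tau ^ 2 * f = fps_of_poly P" "poly Q kap \<noteq> 0"
    "c = poly P kap / poly Q kap" by (rule is_lead2E)
  have "fps_of_poly (Q * P') = fps_of_poly (Q' * P)"
    unfolding fps_of_poly_mult 1(1)[symmetric] 2(1)[symmetric] by (simp only: ac_simps)
  hence "Q * P' = Q' * P" by simp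
  hence "poly Q kap * poly P' kap = poly Q' kap * poly P kap" by (metis poly_mult)
  thus "c' = c" unfolding 1(3) 2(3) using 1(2) 2(2) by (simp add: frac_eq_eq mult.commute)
qed fact

lemma is_lead2_add:
  assumes "is_lead2 f c" "is_lead2 g d"
  shows "is_lead2 (f + g) (c + d)"
proof -
  from assms obtain P Q where 1: "fps_of_poly Q * tau ^ 2 * f = fps_of_poly P" "poly Q kap \<noteq> 0"
    "c = poly P kap / poly Q kap" by (elim is_lead2E)
  from assms obtain P' Q' where 2: "fps_of_poly Q' * tau ^ 2 * g = fps_of_poly P'" "poly Q' kap \<noteq> 0"
    "d = poly P' kap / poly Q' kap" by (elim is_lead2E)
  show ?thesis
  proof (rule is_lead2I)
    show "fps_of_poly (Q * Q') * tau ^ 2 * (f + g) = fps_of_poly (Q' * P + Q * P')"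
      unfolding fps_of_poly_mult fps_of_poly_add 1(1)[symmetric] 2(1)[symmetric]
      by (simp only: algebra_simps)
    show "poly (Q * Q') kap \<noteq> 0" using 1(2) 2(2) by simp
    show "c + d = poly (Q' * P + Q * P') kap / poly (Q * Q') kap"
      unfolding 1(3) 2(3) using 1(2) 2(2) by (simp add: add_frac_eq mult.commute)
  qed
qed

lemma is_lead2_cmult:
  assumes "is_lead2 f c"
  shows "is_lead2 (fps_const k * f) (k * c)"
proof -
  from assms obtain P Q where 1: "fps_of_poly Q * tau ^ 2 * f = fps_of_poly P" "poly Q kap \<noteq> 0"
    "c = poly P kap / poly Q kap" by (elim is_lead2E)
  have "fps_of_poly (smult k P) = fps_const k * fps_of_poly P"
    by (simp add: fps_of_poly_smult)
  thus ?thesis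
    using 1 by (intro is_lead2I[of Q _ "smult k P"]) (simp_all add: ac_simps flip: 1(1))
qed

lemma is_lead2_0: "is_lead2 0 0"
  by (rule is_lead2I[of 1 _ 0]) simp_all

lemma is_lead2_diff: "is_lead2 f c \<Longrightarrow> is_lead2 g d \<Longrightarrow> is_lead2 (f - g) (c - d)"
  using is_lead2_add[of f c "fps_const (- 1) * g" "- 1 * d"] is_lead2_cmult[of g d "- 1"]
  by (simp flip: fps_const_neg)

lemma is_lead2_sum:
  "(\<And>i. i \<in> I \<Longrightarrow> is_lead2 (f i) (c i)) \<Longrightarrow> is_lead2 (sum f I) (sum c I)"
  by (induction I rule: infinite_finite_induct) (simp_all add: is_lead2_0 is_lead2_add)

lemma kap_nonzero: "kap \<noteq> 0"
  by (simp add: kap_def Zero_fract_def eq_fract)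

text \<open>The common value at \<lambda> = \<kappa> of the denominators 1 - \<kappa>\<lambda> and 1
  - \<lambda>^2.\<close>

lemma kap_square: "1 - kap ^ 2 \<noteq> 0"
proof -
  have "kap ^ 2 = Fract ([:0, 1:] ^ 2) 1" by (simp add: kap_def power2_eq_square)
  hence "1 - kap ^ 2 = Fract (1 - [:0, 1:] ^ 2) 1" by (simp add: One_fract_def)
  moreover have "(1 :: complex poly) - [:0, 1:] ^ 2 \<noteq> 0" by (simp add: power2_eq_square one_pCons)
  ultimately show ?thesis by (simp add: Zero_fract_def eq_fract)
qed

lemma fps_of_poly_linear: "fps_of_poly [:1, - k:] = 1 - fps_const k * fps_X"
  for k :: ratf
  by (simp add: fps_of_poly_pCons mult.commute)

lemma fps_of_poly_quadratic: "fps_of_poly [:1, 0, - 1 :: ratf:] = 1 - fps_X ^ 2"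
  by (simp add: fps_of_poly_pCons power2_eq_square)

lemma fps_of_poly_scaled_X: "fps_of_poly [:0, k:] = fps_const k * fps_X"
  for k :: ratf
  by (simp add: fps_of_poly_pCons mult.commute)

lemma fps_of_poly_of_nat: "fps_of_poly (of_nat n) = of_nat n"
  by (simp add: of_nat_poly fps_of_nat[symmetric] del: fps_of_nat)

text \<open>The denominators do not vanish at \<kappa>, so the factor \<open>tau ^ 2\<close> forces
  the value 0.\<close>

lemma is_lead2_regular: "is_lead2 (tau ^ M * ffact_gf p kap * ffact_gf q kap * ffact_even_gf r) 0"
proof (rule is_lead2I)
  let ?a = "1 - fps_const kap * fps_X :: ratf fps" and ?b = "1 - fps_X ^ 2 :: ratf fps"
  have "(?a ^ Suc p * ?a ^ Suc q * ?b ^ Suc r) * tau ^ 2 * (tau ^ M * ffact_gf p kap * ffact_gf q kap * ffact_even_gf r)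
    = tau ^ 2 * tau ^ M * ((?a ^ Suc p * ffact_gf p kap) * (?a ^ Suc q * ffact_gf q kap) * (?b ^ Suc r * ffact_even_gf r))"
    by (simp only: ac_simps)
  thus "fps_of_poly ([:1, - kap:] ^ Suc p * [:1, - kap:] ^ Suc q * [:1, 0, - 1:] ^ Suc r) * tau ^ 2
      * (tau ^ M * ffact_gf p kap * ffact_gf q kap * ffact_even_gf r)
    = fps_of_poly ([:1, - inverse kap:] ^ 2 * [:1, - inverse kap:] ^ M
        * ((of_nat (fact p) * [:0, kap:] ^ p) * (of_nat (fact q) * [:0, kap:] ^ q) * (of_nat (fact r) * ([:0, 1:] ^ 2) ^ r)))"
    unfolding ffact_gf_closed ffact_even_gf_closed fps_of_poly_mult fps_of_poly_power fps_of_poly_linear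
      fps_of_poly_quadratic fps_of_poly_scaled_X fps_of_poly_of_nat tau_def by simp
  show "poly ([:1, - kap:] ^ Suc p * [:1, - kap:] ^ Suc q * [:1, 0, - 1:] ^ Suc r) kap \<noteq> 0"
    using kap_square by (simp add: power2_eq_square)
qed (simp add: kap_nonzero)

text \<open>Here the first two denominators are \<open>tau ^ Suc p\<close> and
  \<open>tau ^ Suc q\<close>. After cancellation \<open>tau ^ (M - p - q)\<close> remains, which
  vanishes at \<kappa> unless p + q = M; then r = 0 and the numerator has the value p! q!.\<close>

lemma is_lead2_singular:
  assumes "p + q + r \<le> M"
  shows "is_lead2 (tau ^ M * ffact_gf p (inverse kap) * ffact_gf q (inverse kap) * ffact_even_gf r)
    (if p + q = M then of_nat (fact p * fact q) / (1 - kap ^ 2) else 0)"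
proof (rule is_lead2I)
  let ?b = "1 - fps_X ^ 2 :: ratf fps"
  have tau: "tau ^ 2 * tau ^ M = tau ^ (M - p - q) * (tau ^ Suc p * tau ^ Suc q)"
    using assms by (simp flip: power_add)
  have "?b ^ Suc r * tau ^ 2 * (tau ^ M * ffact_gf p (inverse kap) * ffact_gf q (inverse kap) * ffact_even_gf r)
    = (tau ^ 2 * tau ^ M) * ffact_gf p (inverse kap) * ffact_gf q (inverse kap) * (?b ^ Suc r * ffact_even_gf r)"
    by (simp only: ac_simps)
  also have "\<dots> = tau ^ (M - p - q) * ((tau ^ Suc p * ffact_gf p (inverse kap)) * (tau ^ Suc q * ffact_gf q (inverse kap))
      * (?b ^ Suc r * ffact_even_gf r))"
    unfolding tau by (simp only: ac_simps)
  finally show "fps_of_poly ([:1, 0, - 1:] ^ Suc r) * tau ^ 2 * (tau ^ M * ffact_gf p (inverse kap) * ffact_gf q (inverse kap) * ffact_even_gf r)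
    = fps_of_poly ([:1, - inverse kap:] ^ (M - p - q)
        * ((of_nat (fact p) * [:0, inverse kap:] ^ p) * (of_nat (fact q) * [:0, inverse kap:] ^ q)
            * (of_nat (fact r) * ([:0, 1:] ^ 2) ^ r)))"
    unfolding tau_def ffact_gf_closed ffact_even_gf_closed fps_of_poly_mult fps_of_poly_power fps_of_poly_linear
      fps_of_poly_quadratic fps_of_poly_scaled_X fps_of_poly_of_nat by simp
  show "poly ([:1, 0, - 1:] ^ Suc r) kap \<noteq> 0"
    using kap_square by (simp add: power2_eq_square)
  show "(if p + q = M then of_nat (fact p * fact q) / (1 - kap ^ 2) else 0)
    = poly ([:1, - inverse kap:] ^ (M - p - q)
        * ((of_nat (fact p) * [:0, inverse kap:] ^ p) * (of_nat (fact q) * [:0, inverse kap:] ^ q)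
            * (of_nat (fact r) * ([:0, 1:] ^ 2) ^ r))) kap / poly ([:1, 0, - 1:] ^ Suc r) kap"
  proof (cases "p + q = M")
    case True
    hence "r = 0" "M - p - q = 0" using assms by simp_all
    thus ?thesis using True by (simp add: kap_nonzero power2_eq_square)
  next
    case False
    hence "M - p - q > 0" using assms by simp
    thus ?thesis using False by (simp add: kap_nonzero)
  qed
qed

lemma Omega_minus_eq:
  fixes m1 m2 m3 :: nat
  defines "M \<equiv> m1 + m2 + m3"
  shows "Omega_minus m1 m2 m3 = 1 / (kap * (kap ^ 2 - 1)) *
    (\<Sum>p\<le>M. cst (ev3 (theta_series $ 0 $ p $ (M - p)) $ m1 $ m2 $ m3 * (fact p * fact (M - p) / fact (M + 1))))"
proof -
  define val where "val p q r = (if p + q = M \<and> r = 0 then of_nat (fact p * fact q) / (1 - kap ^ 2) else (0::ratf))" for p q r :: nat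
  have lead: "is_lead2 (fps_const (cst (theta_weight m1 m2 m3 p q r)) *
     (fps_const kap * (tau ^ M * ffact_gf p kap * ffact_gf q kap * ffact_even_gf r)
      - fps_const (inverse kap) * (tau ^ M * ffact_gf p (inverse kap) * ffact_gf q (inverse kap) * ffact_even_gf r)))
     (cst (theta_weight m1 m2 m3 p q r) * (kap * 0 - inverse kap * val p q r))" for p q r
  proof (cases "p + q + r \<le> M")
    case True
    have "val p q r = (if p + q = M then of_nat (fact p * fact q) / (1 - kap ^ 2) else 0)"
      using True by (auto simp: val_def)
    thus ?thesis
      by (simp only:) (intro is_lead2_cmult is_lead2_diff is_lead2_regular is_lead2_singular True)
  next
    case False
    \<comment> \<open>These indices lie outside the scope of \<open>is_lead2_singular\<close>, but
      carry weight 0.\<close>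
    hence "theta_weight m1 m2 m3 p q r = 0" by (intro theta_weight_eq_0) (simp add: M_def)
    thus ?thesis by (simp add: hom_simps[OF is_hom_cst] is_lead2_0)
  qed
  have "Omega_minus m1 m2 m3 = (\<Sum>q\<le>M. \<Sum>p\<le>M. \<Sum>r\<le>M.
      cst (theta_weight m1 m2 m3 p q r) * (kap * 0 - inverse kap * val p q r))"
    unfolding Omega_minus_def Cminus_eq M_def[symmetric]
    by (intro lead2_eqI is_lead2_sum lead)
  also have "\<dots> = (\<Sum>p\<le>M. \<Sum>q\<le>M. \<Sum>r\<le>M.
      cst (theta_weight m1 m2 m3 p q r) * (kap * 0 - inverse kap * val p q r))"
    by (rule sum.swap)
  also have "\<dots> = (\<Sum>p\<le>M. \<Sum>q\<le>M. if q = M - p then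
      cst (theta_weight m1 m2 m3 p q 0) * (- inverse kap * (of_nat (fact p * fact q) / (1 - kap ^ 2))) else 0)"
  proof (intro sum.cong refl)
    fix p q assume pq: "p \<in> {..M}" "q \<in> {..M}"
    have "(\<Sum>r\<le>M. cst (theta_weight m1 m2 m3 p q r) * (kap * 0 - inverse kap * val p q r))
      = (\<Sum>r\<le>M. if r = 0 then cst (theta_weight m1 m2 m3 p q 0) * (- inverse kap * val p q 0) else 0)"
      by (intro sum.cong) (auto simp: val_def)
    also have "\<dots> = cst (theta_weight m1 m2 m3 p q 0) * (- inverse kap * val p q 0)" by simp
    also have "\<dots> = (if q = M - p then
      cst (theta_weight m1 m2 m3 p q 0) * (- inverse kap * (of_nat (fact p * fact q) / (1 - kap ^ 2))) else 0)"
      using pq by (auto simp: val_def)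
    finally show "(\<Sum>r\<le>M. cst (theta_weight m1 m2 m3 p q r) * (kap * 0 - inverse kap * val p q r))
      = (if q = M - p then
      cst (theta_weight m1 m2 m3 p q 0) * (- inverse kap * (of_nat (fact p * fact q) / (1 - kap ^ 2))) else 0)" .
  qed
  also have "\<dots> = (\<Sum>p\<le>M. cst (theta_weight m1 m2 m3 p (M - p) 0) *
      (- inverse kap * (of_nat (fact p * fact (M - p)) / (1 - kap ^ 2))))"
    by (intro sum.cong refl) (simp add: sum.delta)
  also have "\<dots> = (\<Sum>p\<le>M. 1 / (kap * (kap ^ 2 - 1)) *
    cst (ev3 (theta_series $ 0 $ p $ (M - p)) $ m1 $ m2 $ m3 * (fact p * fact (M - p) / fact (M + 1))))"
  proof (intro sum.cong refl)
    fix p assume "p \<in> {..M}"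
    hence "p + (M - p) + 0 + 1 = M + 1" by simp
    hence "theta_weight m1 m2 m3 p (M - p) 0 = inverse (fact (M + 1)) * (ev3 (theta_series $ 0 $ p $ (M - p)) $ m1 $ m2 $ m3)"
      unfolding theta_weight_def by (simp only:)
    hence "cst (ev3 (theta_series $ 0 $ p $ (M - p)) $ m1 $ m2 $ m3 * (fact p * fact (M - p) / fact (M + 1)))
      = cst (theta_weight m1 m2 m3 p (M - p) 0 * of_nat (fact p * fact (M - p)))"
      by (simp add: divide_inverse ac_simps)
    also have "\<dots> = cst (theta_weight m1 m2 m3 p (M - p) 0) * of_nat (fact p * fact (M - p))"
      by (simp only: hom_mult[OF is_hom_cst] hom_of_nat[OF is_hom_cst])
    finally have e: "cst (ev3 (theta_series $ 0 $ p $ (M - p)) $ m1 $ m2 $ m3 * (fact p * fact (M - p) / fact (M + 1)))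
      = cst (theta_weight m1 m2 m3 p (M - p) 0) * of_nat (fact p * fact (M - p))" .
    \<comment> \<open>The minus sign of the second part turns 1 - \<kappa>^2 into \<kappa>^2 -
      1.\<close>
    have k: "- inverse kap * (x / (1 - kap ^ 2)) = 1 / (kap * (kap ^ 2 - 1)) * x" for x
    proof -
      have "kap ^ 2 - 1 \<noteq> 0" using kap_square by simp
      thus ?thesis using kap_square kap_nonzero by (simp add: field_simps)
    qed
    show "cst (theta_weight m1 m2 m3 p (M - p) 0) * (- inverse kap * (of_nat (fact p * fact (M - p)) / (1 - kap ^ 2)))
      = 1 / (kap * (kap ^ 2 - 1)) *
    cst (ev3 (theta_series $ 0 $ p $ (M - p)) $ m1 $ m2 $ m3 * (fact p * fact (M - p) / fact (M + 1)))"
      unfolding e k by (simp only: ac_simps)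
  qed
  finally show ?thesis by (simp only: sum_distrib_left)
qed

section \<open>The leading coefficient as an integral\<close>

lemma ratf_of_nat_nonzero: "of_nat (Suc n) \<noteq> (0 :: ratf)"
proof -
  have "of_nat (Suc n) = cst (of_nat (Suc n))" by (simp only: hom_of_nat[OF is_hom_cst])
  also have "\<dots> \<noteq> 0" by (simp add: cst_def Zero_fract_def eq_fract del: of_nat_Suc)
  finally show ?thesis .
qed

definition theta :: "ratf poly" where "theta = [:0, 1:]"

text \<open>Substituting \<open>U = \<theta>\<close> and \<open>V = 1 - \<theta>\<close> turns the weight \<open>p! q! / (p + q + 1)!\<close> into integration over
  \<open>\<theta>\<close> from 0 to 1. Keeping only the lowest order in the variables \<open>X\<close> makes \<open>top_part\<close> multiplicative.\<close>

definition top_part :: "poly3 fps fps \<Rightarrow> ratf poly fps fps fps" where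
  "top_part f = Abs_fps (\<lambda>m1. Abs_fps (\<lambda>m2. Abs_fps (\<lambda>m3. \<Sum>p\<le>m1+m2+m3.
     smult (cst (ev3 (f $ p $ (m1 + m2 + m3 - p)) $ m1 $ m2 $ m3))
       (theta ^ p * (1 - theta) ^ (m1 + m2 + m3 - p)))))"

lemma top_part_nth: "top_part f $ m1 $ m2 $ m3 = (\<Sum>p\<le>m1+m2+m3.
     smult (cst (ev3 (f $ p $ (m1 + m2 + m3 - p)) $ m1 $ m2 $ m3))
       (theta ^ p * (1 - theta) ^ (m1 + m2 + m3 - p)))"
  by (simp add: top_part_def)

lemma top_part_add: "top_part (f + g) = top_part f + top_part g"
  by (simp add: fps_eq_iff top_part_nth hom_simps[OF is_hom_ev3] hom_simps[OF is_hom_cst]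
      smult_add_left sum.distrib)

lemma top_part_diff: "top_part (f - g) = top_part f - top_part g"
  using top_part_add[of "f - g" g] by simp

lemma top_part_1: "top_part 1 = 1"
proof -
  have "top_part 1 $ m1 $ m2 $ m3 = (1 :: ratf poly fps fps fps) $ m1 $ m2 $ m3" for m1 m2 m3
  proof (cases "m1 + m2 + m3 = 0")
    case True
    thus ?thesis by (simp add: top_part_nth hom_simps[OF is_hom_ev3] hom_simps[OF is_hom_cst])
  next
    case False
    have "top_part 1 $ m1 $ m2 $ m3 = (\<Sum>p\<le>m1+m2+m3. 0)"
      unfolding top_part_nth using False
      by (intro sum.cong refl)
        (auto simp: hom_simps[OF is_hom_ev3] hom_simps[OF is_hom_cst])
    thus ?thesis using False by auto
  qed
  thus ?thesis by (simp add: fps_eq_iff)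
qed

lemma fps_X2_power_mult_nth:
  "(fps_X ^ i * (fps_const fps_X ^ j * f)) $ p $ q
    = (if i \<le> p \<and> j \<le> q then f $ (p - i) $ (q - j) else (0 :: 'a::comm_ring_1))"
  by (auto simp: fps_X_power_mult_nth fps_const_power)

lemma in_ordP2_nth: "f \<in> ordP2 0 \<Longrightarrow> f $ p $ q \<in> ordP (int p + int q)"
proof -
  assume "f \<in> ordP2 0"
  hence "f $ p \<in> ordP1 (int p)" by (rule fps_filt_nth) simp
  thus ?thesis by (rule fps_filt_nth) simp
qed

text \<open>Such a factor raises the degree in U, V by one but the order in X by two, so nothing of
  lowest order is left.\<close>

lemma top_part_raise1:
  assumes D: "D \<in> ordP 2" and f: "f \<in> ordP2 0" and ij: "i + j = 1"
  shows "top_part (c2 D * (fps_X ^ i * (fps_const fps_X ^ j * f))) = 0"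
proof -
  have "ev3 ((c2 D * (fps_X ^ i * (fps_const fps_X ^ j * f))) $ p $ (m1 + m2 + m3 - p)) $ m1 $ m2 $ m3 = 0"
    if "p \<le> m1 + m2 + m3" for p m1 m2 m3
  proof (cases "i \<le> p \<and> j \<le> m1 + m2 + m3 - p")
    case True
    have "D * f $ (p - i) $ (m1 + m2 + m3 - p - j) \<in> ordP (int (m1 + m2 + m3) + 1)"
      by (rule filtration.mult'[OF filtration_ordP D in_ordP2_nth[OF f]])
        (use True that ij in linarith)
    thus ?thesis using True by (simp add: fps_X2_power_mult_nth ordP_def in_ordC_iff del: fps_const_power)
  qed (simp only: fps_mult_left_const_nth fps_X2_power_mult_nth if_False mult_zero_right
      hom_0[OF is_hom_ev3] fps_zero_nth)
  thus ?thesis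
    by (auto simp: fps_eq_iff top_part_nth hom_0[OF is_hom_cst] intro!: sum.neutral)
qed

abbreviation "c3 \<equiv> \<lambda>a. fps_const (fps_const (fps_const a))"

text \<open>Here degree and order both rise by two, and only the leading term \<open>x * x\<close>
  of \<open>D\<close> counts. The functions \<open>ok\<close>, \<open>sa\<close>, \<open>sb\<close>,
  \<open>sc\<close> describe the shift of the multi-index by two in one of the three
  variables.\<close>

lemma top_part_raise2:
  fixes Z :: "ratf poly fps fps fps"
  assumes D: "ev3 D - x * x \<in> ordC 3" and f: "f \<in> ordP2 0" and ij: "i + j = 2"
    and x: "\<And>F m1 m2 m3. (x * x * F) $ m1 $ m2 $ m3
      = (if ok m1 m2 m3 then F $ sa m1 $ sb m2 $ sc m3 else 0)"
    and Z: "\<And>F m1 m2 m3. (Z * Z * F) $ m1 $ m2 $ m3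
      = (if ok m1 m2 m3 then F $ sa m1 $ sb m2 $ sc m3 else 0)"
    and s: "\<And>m1 m2 m3. ok m1 m2 m3 \<Longrightarrow> m1 + m2 + m3 = sa m1 + sb m2 + sc m3 + 2"
  shows "top_part (c2 D * (fps_X ^ i * (fps_const fps_X ^ j * f)))
    = Z * Z * (c3 (theta ^ i * (1 - theta) ^ j) * top_part f)"
proof -
  have "top_part (c2 D * (fps_X ^ i * (fps_const fps_X ^ j * f))) $ m1 $ m2 $ m3
    = (Z * Z * (c3 (theta ^ i * (1 - theta) ^ j) * top_part f)) $ m1 $ m2 $ m3" for m1 m2 m3
  proof -
    define M where "M = m1 + m2 + m3"
    have e: "ev3 ((c2 D * (fps_X ^ i * (fps_const fps_X ^ j * f))) $ p $ (M - p)) $ m1 $ m2 $ m3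
      = (if i \<le> p \<and> j \<le> M - p \<and> ok m1 m2 m3 then ev3 (f $ (p - i) $ (M - p - j)) $ sa m1 $ sb m2 $ sc m3 else 0)"
      if "p \<le> M" for p
    proof (cases "i \<le> p \<and> j \<le> M - p")
      case True
      define y where "y = f $ (p - i) $ (M - p - j)"
      have "y \<in> ordP (int (p - i) + int (M - p - j))" unfolding y_def by (rule in_ordP2_nth) fact
      moreover have "int (p - i) + int (M - p - j) = int M - 2" using True that ij by linarith
      ultimately have "ev3 y \<in> ordC (int M - 2)" by (simp add: ordP_def)
      \<comment> \<open>The error has order above M, hence does not reach the coefficient of
        X^m.\<close>
      hence "(ev3 D - x * x) * ev3 y \<in> ordC (int M + 1)"
        by (rule filtration.mult'[OF filtration_ordC D]) simp
      hence "((ev3 D - x * x) * ev3 y) $ m1 $ m2 $ m3 = 0"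
        by (simp add: in_ordC_iff M_def)
      hence "ev3 (D * y) $ m1 $ m2 $ m3 = (x * x * ev3 y) $ m1 $ m2 $ m3"
        by (simp add: hom_simps[OF is_hom_ev3] left_diff_distrib)
      thus ?thesis using True unfolding x by (simp add: fps_X2_power_mult_nth y_def del: fps_const_power)
    qed (auto simp: fps_X2_power_mult_nth hom_0[OF is_hom_ev3] simp del: fps_const_power)
    have L: "top_part (c2 D * (fps_X ^ i * (fps_const fps_X ^ j * f))) $ m1 $ m2 $ m3
      = (\<Sum>p\<le>M. smult (cst (if i \<le> p \<and> j \<le> M - p \<and> ok m1 m2 m3
            then ev3 (f $ (p - i) $ (M - p - j)) $ sa m1 $ sb m2 $ sc m3 else 0)) (theta ^ p * (1 - theta) ^ (M - p)))"
      unfolding top_part_nth M_def[symmetric] by (intro sum.cong refl) (simp only: e atMost_iff)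
    show ?thesis
    proof (cases "ok m1 m2 m3")
      case False
      thus ?thesis unfolding L Z by (simp add: hom_0[OF is_hom_cst])
    next
      case True
      define M' where "M' = sa m1 + sb m2 + sc m3"
      have M: "M = M' + 2" using s[OF True] by (simp add: M_def M'_def)
      have "top_part (c2 D * (fps_X ^ i * (fps_const fps_X ^ j * f))) $ m1 $ m2 $ m3
        = (\<Sum>p\<in>{i..M' + i}. smult (cst (ev3 (f $ (p - i) $ (M - p - j)) $ sa m1 $ sb m2 $ sc m3))
             (theta ^ p * (1 - theta) ^ (M - p)))"
        unfolding L using True ij M
        by (intro sum.mono_neutral_cong_right) (auto simp: hom_0[OF is_hom_cst])
      also have "\<dots> = (\<Sum>p\<le>M'. smult (cst (ev3 (f $ p $ (M' - p)) $ sa m1 $ sb m2 $ sc m3))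
             (theta ^ (p + i) * (1 - theta) ^ (M' - p + j)))"
      proof (rule sum.reindex_bij_witness[of _ "\<lambda>p. p + i" "\<lambda>p. p - i"], goal_cases)
        case (5 a)
        hence "M - a - j = M' - (a - i)" "M - a = M' - (a - i) + j" "a - i + i = a"
          using ij M by auto
        thus ?case by (simp only:)
      qed auto
      also have "\<dots> = theta ^ i * (1 - theta) ^ j * top_part f $ sa m1 $ sb m2 $ sc m3"
        unfolding top_part_nth M'_def[symmetric] sum_distrib_left
        by (intro sum.cong refl) (simp only: power_add mult_smult_right ac_simps)
      finally show ?thesis unfolding Z using True by simp
    qed
  qed
  thus ?thesis by (simp add: fps_eq_iff)
qed

definition S12 :: "ratf poly fps fps fps" where "S12 = fps_X"
definition S13 :: "ratf poly fps fps fps" where "S13 = fps_const fps_X"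
definition S23 :: "ratf poly fps fps fps" where "S23 = fps_const (fps_const fps_X)"

lemma XX_nth:
  fixes F :: "'a::comm_ring_1 fps fps fps"
  shows "(fps_X * fps_X * F) $ m1 $ m2 $ m3 = (if 2 \<le> m1 then F $ (m1 - 2) $ m2 $ m3 else 0)"
    "(fps_const fps_X * fps_const fps_X * F) $ m1 $ m2 $ m3 = (if 2 \<le> m2 then F $ m1 $ (m2 - 2) $ m3 else 0)"
    "(c2 fps_X * c2 fps_X * F) $ m1 $ m2 $ m3 = (if 2 \<le> m3 then F $ m1 $ m2 $ (m3 - 2) else 0)"
proof -
  have X: "fps_X * fps_X = (fps_X ^ 2 :: 'z::comm_ring_1 fps)" by (simp add: power2_eq_square)
  show "(fps_X * fps_X * F) $ m1 $ m2 $ m3 = (if 2 \<le> m1 then F $ (m1 - 2) $ m2 $ m3 else 0)"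
    "(fps_const fps_X * fps_const fps_X * F) $ m1 $ m2 $ m3 = (if 2 \<le> m2 then F $ m1 $ (m2 - 2) $ m3 else 0)"
    "(c2 fps_X * c2 fps_X * F) $ m1 $ m2 $ m3 = (if 2 \<le> m3 then F $ m1 $ m2 $ (m3 - 2) else 0)"
    unfolding fps_const_mult X by (auto simp: fps_X_power_mult_nth)
qed

text \<open>X^2 / (1 + X) = X^2 - X^3 / (1 + X).\<close>

lemma ev3_Y_leading:
  "ev3 (Y12 - 2) - x12 * x12 \<in> ordC 3" "ev3 (Y13 - 2) - x13 * x13 \<in> ordC 3" "ev3 (Y23 - 2) - x23 * x23 \<in> ordC 3"
proof -
  interpret filtration "ordC :: int \<Rightarrow> cfps3 set" by (rule filtration_ordC)
  have *: "x * x * i - x * x \<in> ordC 3" if "(1 + x) * i = 1" "x \<in> ordC 1" "i \<in> ordC 0" for x i :: cfps3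
  proof -
    have "x * x * i - x * x = - (x * x * (x * i)) + x * x * ((1 + x) * i - 1)" by (simp add: algebra_simps)
    also have "\<dots> = - (x * x * (x * i))" using that(1) by simp
    also have "\<dots> \<in> ordC 3"
      by (rule uminus, rule mult'[of _ 2 _ 1], rule mult'[of _ 1 _ 1], use that in simp_all,
          rule mult'[of _ 1 _ 0]) simp_all
    finally show ?thesis .
  qed
  show "ev3 (Y12 - 2) - x12 * x12 \<in> ordC 3" "ev3 (Y13 - 2) - x13 * x13 \<in> ordC 3"
    "ev3 (Y23 - 2) - x23 * x23 \<in> ordC 3"
    unfolding ev3_Y by (intro * x_inverse x_i_in_ordC)+
qed

definition TH :: "ratf poly fps fps fps" where "TH = c3 theta"

text \<open>Take top parts in g = 1 + M g. The terms A U and B V drop out by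
  \<open>top_part_raise1\<close>; with U = \<theta>, V = 1 - \<theta> the forms U (U + V), V (U +
  V), U V become \<theta>, 1 - \<theta>, \<theta> (1 - \<theta>).\<close>

lemma top_part_theta_series:
  "top_part (theta_series $ 0) * (1 - (S12 * S12 * TH + S13 * S13 * (1 - TH) - S23 * S23 * (TH * (1 - TH)))) = 1"
proof -
  define g where "g = theta_series $ 0"
  have g: "g \<in> ordP2 0" unfolding g_def using theta_series(1) by (rule fps_filt_nth) simp
  define A B C where "A = Y12 - 2" and "B = Y13 - 2" and "C = Y23 - 2"
  note ABC = A_def B_def C_def
  have c: "c3 (theta ^ i * (1 - theta) ^ j) = TH ^ i * (1 - TH) ^ j" for i j
  proof -
    have 1: "c3 (1 :: ratf poly) = 1" by simp
    have 2: "1 - TH = c3 (1 - theta)" unfolding TH_def by (subst 1[symmetric]) simp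
    show ?thesis unfolding 2 by (simp only: TH_def fps_const_power fps_const_mult)
  qed
  have r12: "top_part (c2 A * (fps_X ^ i * (fps_const fps_X ^ j * g)))
      = S12 * S12 * (c3 (theta ^ i * (1 - theta) ^ j) * top_part g)" if "i + j = 2" for i j
    unfolding A_def
    by (rule top_part_raise2[OF ev3_Y_leading(1) g that, where ok = "\<lambda>m1 m2 m3. 2 \<le> m1"
          and sa = "\<lambda>m. m - 2" and sb = "\<lambda>m. m" and sc = "\<lambda>m. m"])
      (unfold x12_def S12_def, rule XX_nth, rule XX_nth, simp)
  have r13: "top_part (c2 B * (fps_X ^ i * (fps_const fps_X ^ j * g)))
      = S13 * S13 * (c3 (theta ^ i * (1 - theta) ^ j) * top_part g)" if "i + j = 2" for i j
    unfolding B_def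
    by (rule top_part_raise2[OF ev3_Y_leading(2) g that, where ok = "\<lambda>m1 m2 m3. 2 \<le> m2"
          and sa = "\<lambda>m. m" and sb = "\<lambda>m. m - 2" and sc = "\<lambda>m. m"])
      (unfold x13_def S13_def, rule XX_nth, rule XX_nth, simp)
  have r23: "top_part (c2 C * (fps_X ^ i * (fps_const fps_X ^ j * g)))
      = S23 * S23 * (c3 (theta ^ i * (1 - theta) ^ j) * top_part g)" if "i + j = 2" for i j
    unfolding C_def
    by (rule top_part_raise2[OF ev3_Y_leading(3) g that, where ok = "\<lambda>m1 m2 m3. 2 \<le> m3"
          and sa = "\<lambda>m. m" and sb = "\<lambda>m. m" and sc = "\<lambda>m. m - 2"])
      (unfold x23_def S23_def, rule XX_nth, rule XX_nth, simp)
  note z = top_part_raise1[OF Y_in_ordP(1) g, folded A_def] top_part_raise1[OF Y_in_ordP(2) g, folded B_def]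
  have "g * (1 - theta_M0 (c2 A) (c2 B) (c2 C) fps_X (fps_const fps_X)) = 1"
    unfolding g_def ABC by (rule theta_series(3))
  hence "g = 1 + theta_M0 (c2 A) (c2 B) (c2 C) fps_X (fps_const fps_X) * g"
    by (simp add: algebra_simps)
  also have "\<dots> = 1 + (c2 A * (fps_X ^ 1 * (fps_const fps_X ^ 0 * g))
     + c2 A * (fps_X ^ 2 * (fps_const fps_X ^ 0 * g)) + c2 A * (fps_X ^ 1 * (fps_const fps_X ^ 1 * g))
     + (c2 B * (fps_X ^ 0 * (fps_const fps_X ^ 1 * g)) + c2 B * (fps_X ^ 1 * (fps_const fps_X ^ 1 * g))
     + c2 B * (fps_X ^ 0 * (fps_const fps_X ^ 2 * g)))
     - c2 C * (fps_X ^ 1 * (fps_const fps_X ^ 1 * g)))"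
    unfolding theta_M0_def by (simp add: algebra_simps power2_eq_square del: fps_const_mult)
  finally have "top_part g = top_part (1 + (c2 A * (fps_X ^ 1 * (fps_const fps_X ^ 0 * g))
     + c2 A * (fps_X ^ 2 * (fps_const fps_X ^ 0 * g)) + c2 A * (fps_X ^ 1 * (fps_const fps_X ^ 1 * g))
     + (c2 B * (fps_X ^ 0 * (fps_const fps_X ^ 1 * g)) + c2 B * (fps_X ^ 1 * (fps_const fps_X ^ 1 * g))
     + c2 B * (fps_X ^ 0 * (fps_const fps_X ^ 2 * g)))
     - c2 C * (fps_X ^ 1 * (fps_const fps_X ^ 1 * g))))"
    by (rule arg_cong)
  also have "\<dots> = 1 + (0 + S12 * S12 * (TH ^ 2 * (1 - TH) ^ 0 * top_part g)
      + S12 * S12 * (TH ^ 1 * (1 - TH) ^ 1 * top_part g)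
      + (0 + S13 * S13 * (TH ^ 1 * (1 - TH) ^ 1 * top_part g) + S13 * S13 * (TH ^ 0 * (1 - TH) ^ 2 * top_part g))
      - S23 * S23 * (TH ^ 1 * (1 - TH) ^ 1 * top_part g))"
    unfolding top_part_add top_part_diff top_part_1
    by (simp only: z(1)[of 1 0, OF add_0_right] z(2)[of 0 1, OF add_0_left]
        r12[of 2 0, OF add_0_right] r12[of 1 1, OF one_add_one] r13[of 1 1, OF one_add_one]
        r13[of 0 2, OF add_0_left] r23[of 1 1, OF one_add_one] c)
  finally have e: "top_part g = \<dots>" .
  have "top_part g * (1 - (S12 * S12 * TH + S13 * S13 * (1 - TH) - S23 * S23 * (TH * (1 - TH))))
    = top_part g - (0 + S12 * S12 * (TH ^ 2 * (1 - TH) ^ 0 * top_part g)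
      + S12 * S12 * (TH ^ 1 * (1 - TH) ^ 1 * top_part g)
      + (0 + S13 * S13 * (TH ^ 1 * (1 - TH) ^ 1 * top_part g) + S13 * S13 * (TH ^ 0 * (1 - TH) ^ 2 * top_part g))
      - S23 * S23 * (TH ^ 1 * (1 - TH) ^ 1 * top_part g))"
    by (simp add: algebra_simps power2_eq_square)
  also have "\<dots> = 1" using e by (simp add: eq_diff_eq[symmetric] diff_eq_eq)
  finally show ?thesis unfolding g_def .
qed

section \<open>Evaluation of the integral\<close>

text \<open>The formal integral over \<theta> from 0 to 1.\<close>

definition poly_integral :: "ratf poly \<Rightarrow> ratf" where
  "poly_integral p = (\<Sum>i\<le>degree p. coeff p i * inverse (of_nat (Suc i)))"

lemma poly_integral_eq:
  assumes "degree p \<le> n"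
  shows "poly_integral p = (\<Sum>i\<le>n. coeff p i * inverse (of_nat (Suc i)))"
  unfolding poly_integral_def
  by (rule sum.mono_neutral_left) (use assms in \<open>auto simp: coeff_eq_0\<close>)

lemma poly_integral_add: "poly_integral (p + q) = poly_integral p + poly_integral q"
proof -
  let ?n = "max (degree p) (degree q)"
  have "degree (p + q) \<le> ?n" by (rule degree_add_le) simp_all
  thus ?thesis
    by (simp add: poly_integral_eq[of _ ?n] distrib_right sum.distrib del: of_nat_Suc)
qed

lemma poly_integral_smult: "poly_integral (smult c p) = c * poly_integral p"
  using degree_smult_le[of c p]
  by (simp add: poly_integral_eq[of _ "degree p"] sum_distrib_left mult.assoc del: of_nat_Suc)

lemma poly_integral_0: "poly_integral 0 = 0"
  by (simp add: poly_integral_def)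

lemma poly_integral_sum: "poly_integral (sum f I) = (\<Sum>i\<in>I. poly_integral (f i))"
  by (induction I rule: infinite_finite_induct) (simp_all add: poly_integral_0 poly_integral_add)

lemma poly_integral_pderiv: "poly_integral (pderiv p) = poly p 1 - poly p 0"
proof -
  have "poly_integral (pderiv p) = (\<Sum>i\<le>degree p. coeff (pderiv p) i * inverse (of_nat (Suc i)))"
    by (rule poly_integral_eq, rule degree_le) (simp add: coeff_pderiv coeff_eq_0)
  also have "\<dots> = (\<Sum>i\<le>degree p. coeff p (Suc i))"
  proof (intro sum.cong refl)
    fix i
    show "coeff (pderiv p) i * inverse (of_nat (Suc i)) = coeff p (Suc i)"
      using ratf_of_nat_nonzero[of i] by (simp add: coeff_pderiv field_simps del: of_nat_Suc)
  qed
  also have "\<dots> = (\<Sum>i\<le>Suc (degree p). coeff p i) - coeff p 0"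
    by (subst sum.atMost_Suc_shift) simp
  also have "(\<Sum>i\<le>Suc (degree p). coeff p i) = poly p 1"
    by (simp add: poly_altdef coeff_eq_0)
  finally show ?thesis by (simp add: poly_0_coeff_0)
qed

lemma derivation_pderiv: "derivation (pderiv :: 'a::{comm_ring_1,semiring_no_zero_divisors} poly \<Rightarrow> _)"
  by (rule derivationI) (simp_all add: pderiv_add pderiv_mult algebra_simps)

lemma derivation_power:
  assumes "derivation d"
  shows "d (x ^ Suc n) = of_nat (Suc n) * x ^ n * d x"
proof (induction n)
  case (Suc n)
  have "d (x ^ Suc (Suc n)) = d x * x ^ Suc n + x * d (x ^ Suc n)"
    by (subst power_Suc) (rule derivation_mult[OF assms])
  also have "\<dots> = of_nat (Suc (Suc n)) * x ^ Suc n * d x"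
    unfolding Suc.IH by (simp add: algebra_simps)
  finally show ?case .
qed simp

lemma pderiv_theta: "pderiv theta = 1" "pderiv (1 - theta) = - 1"
  by (simp_all add: theta_def pderiv_pCons pderiv_diff one_pCons)

text \<open>Euler's beta integral: integration by parts lowers q and raises p.\<close>

lemma poly_integral_beta:
  "of_nat (fact (p + q + 1)) * poly_integral (theta ^ p * (1 - theta) ^ q) = of_nat (fact p * fact q)"
proof (induction q arbitrary: p)
  case 0
  have "pderiv (theta ^ Suc p) = smult (of_nat (Suc p)) (theta ^ p)"
    by (simp add: derivation_power[OF derivation_pderiv] pderiv_theta of_nat_poly
        del: of_nat_Suc power_Suc)
  hence "of_nat (Suc p) * poly_integral (theta ^ p) = poly (theta ^ Suc p) 1 - poly (theta ^ Suc p) 0"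
    by (metis poly_integral_pderiv poly_integral_smult)
  hence "of_nat (Suc p) * poly_integral (theta ^ p) = 1"
    by (simp add: theta_def del: of_nat_Suc)
  hence "of_nat (fact p) * (of_nat (Suc p) * poly_integral (theta ^ p)) = of_nat (fact p)" by simp
  moreover have "p + 0 + 1 = Suc p" by simp
  ultimately show ?case
    by (simp only: fact_Suc fact_0 of_nat_mult of_nat_id power_0 mult_1_right mult.assoc mult.left_commute)
next
  case (Suc q)
  have "pderiv (theta ^ Suc p * (1 - theta) ^ Suc q)
     = smult (of_nat (Suc p)) (theta ^ p * (1 - theta) ^ Suc q)
       + smult (- of_nat (Suc q)) (theta ^ Suc p * (1 - theta) ^ q)"
    unfolding derivation_mult[OF derivation_pderiv] derivation_power[OF derivation_pderiv] pderiv_theta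
    by (simp add: of_nat_poly ac_simps del: of_nat_Suc power_Suc)
  \<comment> \<open>No boundary terms, as both exponents are positive.\<close>
  moreover have "poly (theta ^ Suc p * (1 - theta) ^ Suc q) 1 - poly (theta ^ Suc p * (1 - theta) ^ Suc q) 0 = 0"
    by (simp add: theta_def)
  ultimately have "of_nat (Suc p) * poly_integral (theta ^ p * (1 - theta) ^ Suc q)
      + - of_nat (Suc q) * poly_integral (theta ^ Suc p * (1 - theta) ^ q) = 0"
    by (metis poly_integral_pderiv poly_integral_add poly_integral_smult)
  hence r: "of_nat (Suc p) * poly_integral (theta ^ p * (1 - theta) ^ Suc q)
      = of_nat (Suc q) * poly_integral (theta ^ Suc p * (1 - theta) ^ q)"
    by (simp only: mult_minus_left add_uminus_conv_diff right_minus_eq)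
  have "of_nat (Suc p) * (of_nat (fact (p + Suc q + 1)) * poly_integral (theta ^ p * (1 - theta) ^ Suc q))
      = of_nat (Suc q) * (of_nat (fact (Suc p + q + 1)) * poly_integral (theta ^ Suc p * (1 - theta) ^ q))"
    unfolding mult.left_commute[of "of_nat (Suc p)"] r
    by (simp only: add_Suc add_Suc_right mult.left_commute)
  also have "\<dots> = of_nat (Suc p) * of_nat (fact p * fact (Suc q))"
    unfolding Suc.IH by (simp only: fact_Suc of_nat_mult of_nat_id ac_simps)
  finally show ?case using ratf_of_nat_nonzero[of p] by (simp del: of_nat_Suc of_nat_mult fact_Suc)
qed

lemma Omega_minus_integral:
  "Omega_minus m1 m2 m3 = 1 / (kap * (kap ^ 2 - 1)) * poly_integral (top_part (theta_series $ 0) $ m1 $ m2 $ m3)"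
proof -
  define M where "M = m1 + m2 + m3"
  have "poly_integral (theta ^ p * (1 - theta) ^ (M - p)) = cst (fact p * fact (M - p) / fact (M + 1))"
    if "p \<le> M" for p
  proof -
    have f: "cst (of_nat (fact (M + 1))) \<noteq> 0"
      unfolding hom_of_nat[OF is_hom_cst] using ratf_of_nat_nonzero[of "fact (M + 1) - 1"] by simp
    have "p + (M - p) + 1 = M + 1" using that by simp
    hence "cst (of_nat (fact (M + 1))) * poly_integral (theta ^ p * (1 - theta) ^ (M - p)) = cst (of_nat (fact p * fact (M - p)))"
      unfolding hom_of_nat[OF is_hom_cst] by (metis poly_integral_beta)
    also have "\<dots> = cst (of_nat (fact (M + 1)) * (fact p * fact (M - p) / fact (M + 1)))"
      by (simp del: fact_Suc)
    finally show ?thesis using f unfolding hom_mult[OF is_hom_cst] by simp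
  qed
  thus ?thesis
    unfolding Omega_minus_eq top_part_nth poly_integral_sum poly_integral_smult M_def[symmetric]
    by (intro arg_cong[of _ _ "(*) _"] sum.cong refl) (simp only: hom_mult[OF is_hom_cst] atMost_iff)
qed

section \<open>Antiderivative and endpoint values\<close>

lemma fps_right_unit: "f $ 0 * c = (1 :: 'a::comm_ring_1) \<Longrightarrow> \<exists>g. f * g = 1 \<and> g $ 0 = c"
  by (rule exI[of _ "fps_right_inverse f c"]) (simp add: fps_right_inverse)

lemma fps3_unit:
  fixes f :: "'a::comm_ring_1 fps fps fps"
  assumes "f $ 0 $ 0 $ 0 * c = 1"
  obtains g where "f * g = 1"
  using fps_right_unit fps_right_unit[OF assms] by metis

text \<open>Written as the discriminant of the quadratic in \<theta> with leading coefficient -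
  S23^2 and constant term 1 - S13^2; \<open>evS_DS\<close> identifies it with
  \<open>DD\<close>.\<close>

definition DS :: "ratf poly fps fps fps" where
  "DS = (S23 * S23 - S12 * S12 + S13 * S13) ^ 2 + 4 * (S23 * S23) * (1 - S13 * S13)"

definition dS :: "ratf poly fps fps fps \<Rightarrow> ratf poly fps fps fps" where
  "dS = fps_map (fps_map (fps_map pderiv))"

lemma derivation_dS: "derivation dS"
  unfolding dS_def by (intro derivation_fps_map derivation_pderiv)

lemma dS_simps: "dS S12 = 0" "dS S13 = 0" "dS S23 = 0" "dS TH = 1" "dS (c3 [:c:]) = 0"
proof -
  show "dS S12 = 0" "dS S13 = 0" "dS S23 = 0" "dS TH = 1" "dS (c3 [:c:]) = 0"
    unfolding dS_def S12_def S13_def S23_def TH_def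
    by (simp_all add: fps_map_X fps_map_const derivation_0 derivation_fps_map derivation_pderiv
        pderiv_theta(1) pderiv_pCons)
qed

text \<open>A truncation of 2 artanh (\<surd>D w) / \<surd>D, so that no infinite sum is
  needed.\<close>

definition atanh_sum :: "nat \<Rightarrow> ratf poly fps fps fps \<Rightarrow> ratf poly fps fps fps" where
  "atanh_sum K w = (\<Sum>k\<le>K. c3 [:2 * inverse (of_nat (2 * k + 1)):] * DS ^ k * w ^ Suc (2 * k))"

text \<open>\<open>DS\<close> is free of \<theta>, so termwise differentiation gives a finite
  geometric sum in \<open>DS * w ^ 2\<close>.\<close>

lemma dS_atanh_sum:
  "(1 - DS * w ^ 2) * dS (atanh_sum K w) = 2 * dS w * (1 - (DS * w ^ 2) ^ Suc K)"
proof -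
  have DS0: "dS DS = 0"
    by (simp add: DS_def power2_eq_square derivation_simps[OF derivation_dS] dS_simps)
  have DSk: "dS (DS ^ k) = 0" for k
    by (cases k) (simp_all only: power_0 derivation_1[OF derivation_dS] derivation_power[OF derivation_dS] DS0 mult_zero_right)
  have two: "c3 [:2 * inverse (of_nat (2 * k + 1) :: ratf):] * of_nat (Suc (2 * k)) = 2" for k
  proof -
    have e: "(of_nat n :: ratf poly fps fps fps) = c3 [:of_nat n:]" for n
      by (simp only: fps_of_nat[symmetric] of_nat_poly)
    have "c3 [:2 * inverse (of_nat (2 * k + 1) :: ratf):] * of_nat (Suc (2 * k))
        = c3 ([:2 * inverse (of_nat (2 * k + 1)):] * [:of_nat (Suc (2 * k)):])"
      by (simp only: e fps_const_mult)
    also have "[:2 * inverse (of_nat (2 * k + 1)):] * [:of_nat (Suc (2 * k)):] = [:2 :: ratf:]"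
      using ratf_of_nat_nonzero[of "2 * k"] by (simp del: of_nat_Suc)
    also have "c3 [:2 :: ratf:] = 2" using e[of 2] by simp
    finally show ?thesis .
  qed
  have "dS (atanh_sum K w) = (\<Sum>k\<le>K. 2 * dS w * (DS * w ^ 2) ^ k)"
    unfolding atanh_sum_def derivation_sum[OF derivation_dS]
  proof (intro sum.cong refl)
    fix k
    have "dS (c3 [:2 * inverse (of_nat (2 * k + 1)):] * DS ^ k * w ^ Suc (2 * k))
      = (c3 [:2 * inverse (of_nat (2 * k + 1)):] * of_nat (Suc (2 * k))) * (DS ^ k * w ^ (2 * k) * dS w)"
      unfolding derivation_mult[OF derivation_dS] derivation_power[OF derivation_dS] dS_simps DSk
      by (simp only: mult_zero_left mult_zero_right add_0_left add_0_right ac_simps)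
    also have "\<dots> = 2 * dS w * (DS * w ^ 2) ^ k"
      unfolding two by (simp only: power_mult_distrib power_mult[symmetric] ac_simps)
    finally show "dS (c3 [:2 * inverse (of_nat (2 * k + 1)):] * DS ^ k * w ^ Suc (2 * k))
      = 2 * dS w * (DS * w ^ 2) ^ k" .
  qed
  also have "\<dots> = 2 * dS w * (\<Sum>k<Suc K. (DS * w ^ 2) ^ k)"
    by (simp only: sum_distrib_left lessThan_Suc_atMost)
  finally have "dS (atanh_sum K w) = 2 * dS w * (\<Sum>k<Suc K. (DS * w ^ 2) ^ k)" .
  thus ?thesis
    using one_diff_power_eq[of "DS * w ^ 2" "Suc K"] by (simp only: ac_simps)
qed

definition mobius_den :: "ratf poly fps fps fps" where
  "mobius_den = (S23 * S23 - S12 * S12 + S13 * S13) * TH + 2 * (1 - S13 * S13)"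

text \<open>With \<open>w = \<theta> / (\<beta> \<theta> + 2 \<gamma>)\<close> the form \<open>\<alpha> \<theta>\<^sup>2 + \<beta> \<theta> + \<gamma>\<close> with discriminant \<open>D\<close> satisfies
  \<open>(\<beta> \<theta> + 2 \<gamma>)\<^sup>2 (1 - D w\<^sup>2) = 4 \<gamma> (\<alpha> \<theta>\<^sup>2 + \<beta> \<theta> + \<gamma>)\<close>, so that \<open>2 artanh (\<surd>D w) / \<surd>D\<close>
  is an antiderivative of its inverse.\<close>

lemma atanh_sum_antiderivative:
  assumes w: "w * mobius_den = TH"
  shows "dS (atanh_sum K w) = top_part (theta_series $ 0) * (1 - (DS * w ^ 2) ^ Suc K)"
proof -
  define \<beta> \<gamma> where "\<beta> = S23 * S23 - S12 * S12 + S13 * S13" and "\<gamma> = 1 - S13 * S13"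
  define Q where "Q = 1 - (S12 * S12 * TH + S13 * S13 * (1 - TH) - S23 * S23 * (TH * (1 - TH)))"
  have N: "mobius_den = \<beta> * TH + 2 * \<gamma>" by (simp add: mobius_den_def \<beta>_def \<gamma>_def)
  have dN: "dS mobius_den = \<beta>"
    unfolding mobius_den_def \<beta>_def by (simp add: derivation_simps[OF derivation_dS] dS_simps)
  have Q: "Q = \<gamma> + \<beta> * TH - S23 * S23 * TH ^ 2"
    by (simp add: Q_def \<beta>_def \<gamma>_def algebra_simps power2_eq_square)
  have D: "DS = \<beta> ^ 2 + 4 * (S23 * S23) * \<gamma>" by (simp add: DS_def \<beta>_def \<gamma>_def)
  have "dS w * mobius_den + w * \<beta> = 1"
    using arg_cong[OF w, of dS] by (simp add: derivation_mult[OF derivation_dS] dN dS_simps)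
  hence "dS w * mobius_den = 1 - w * \<beta>" by (simp add: eq_diff_eq)
  hence "dS w * mobius_den * mobius_den = mobius_den - \<beta> * (w * mobius_den)"
    by (simp only: left_diff_distrib mult_1_left mult.assoc mult.left_commute mult.commute[of w])
  hence "dS w * mobius_den ^ 2 = mobius_den - \<beta> * TH" by (simp only: w power2_eq_square mult.assoc)
  hence dw: "dS w * mobius_den ^ 2 = 2 * \<gamma>" by (simp add: N)
  have "mobius_den ^ 2 * (1 - DS * w ^ 2) = mobius_den ^ 2 - DS * (w * mobius_den) ^ 2"
    by (simp add: algebra_simps power_mult_distrib)
  also have "\<dots> = 4 * \<gamma> * Q"
    unfolding w unfolding Q D N by (simp add: algebra_simps power2_eq_square)
  finally have NQ: "mobius_den ^ 2 * (1 - DS * w ^ 2) = 4 * \<gamma> * Q" .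
  have "4 * \<gamma> * (Q * dS (atanh_sum K w)) = mobius_den ^ 2 * ((1 - DS * w ^ 2) * dS (atanh_sum K w))"
    unfolding mult.assoc[symmetric] NQ ..
  also have "\<dots> = 2 * (dS w * mobius_den ^ 2) * (1 - (DS * w ^ 2) ^ Suc K)"
    unfolding dS_atanh_sum by (simp only: ac_simps)
  also have "\<dots> = 4 * \<gamma> * (1 - (DS * w ^ 2) ^ Suc K)" unfolding dw by simp
  finally have *: "4 * \<gamma> * (Q * dS (atanh_sum K w)) = 4 * \<gamma> * (1 - (DS * w ^ 2) ^ Suc K)" .
  \<comment> \<open>Ensures that 4\<gamma> can be cancelled.\<close>
  have "\<gamma> $ 0 $ 0 $ 0 = 1" by (simp add: \<gamma>_def S13_def)
  hence "\<gamma> \<noteq> 0" by auto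
  moreover have "(4 :: ratf poly fps fps fps) \<noteq> 0"
  proof
    assume "(4 :: ratf poly fps fps fps) = 0"
    hence "(4 :: ratf poly fps fps fps) $ 0 $ 0 $ 0 = 0" by simp
    hence "poly (4 :: ratf poly) 0 = 0" by simp
    thus False using ratf_of_nat_nonzero[of 3] by simp
  qed
  ultimately have "Q * dS (atanh_sum K w) = 1 - (DS * w ^ 2) ^ Suc K" using * by simp
  hence "top_part (theta_series $ 0) * Q * dS (atanh_sum K w) = top_part (theta_series $ 0) * (1 - (DS * w ^ 2) ^ Suc K)"
    by (simp only: mult.assoc)
  thus ?thesis unfolding top_part_theta_series[folded Q_def] by simp
qed

text \<open>Evaluation at \<theta> = x; with scaling factor 1, \<open>fps_scale\<close> only maps
  coefficients.\<close>

definition evS :: "ratf \<Rightarrow> ratf poly fps fps fps \<Rightarrow> ring3" where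
  "evS x = fps_scale (fps_scale (fps_scale (\<lambda>p. poly p x) 1) 1) 1"

lemma is_hom_evS: "is_hom (evS x)"
  unfolding evS_def by (intro is_hom_fps_scale is_homI) simp_all

lemma evS_nth: "evS x f $ i $ j $ k = poly (f $ i $ j $ k) x"
  by (simp add: evS_def fps_scale_def)

lemma evS_simps: "evS x S12 = Z12" "evS x S13 = Z13" "evS x S23 = Z23"
  "evS x TH = emb3 x" "evS x (c3 [:c:]) = emb3 c"
  by (auto simp: fps_eq_iff evS_nth S12_def S13_def S23_def TH_def Z12_def Z13_def Z23_def emb3_def
      fps_X_def theta_def)

lemma evS_DS: "evS x DS = DD"
  by (simp add: DS_def DD_def hom_simps[OF is_hom_evS] evS_simps algebra_simps power2_eq_square power4_eq_xxxx)

text \<open>The truncation error: for K = |m| its order exceeds |m|.\<close>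

lemma DS_power_in_ordC: "(DS * w ^ 2) ^ Suc K \<in> ordC (2 * int K + 2)"
proof -
  interpret filtration "ordC :: int \<Rightarrow> ratf poly fps fps fps set" by (rule filtration_ordC)
  have any: "f \<in> ordC 0" for f :: "ratf poly fps fps fps" by (simp add: in_ordC_iff)
  have S: "S12 \<in> ordC 1" "S13 \<in> ordC 1" "S23 \<in> ordC 1"
    by (auto simp: in_ordC_iff S12_def S13_def S23_def fps_X_def)
  have SS: "S12 * S12 \<in> ordC 2" "S13 * S13 \<in> ordC 2" "S23 * S23 \<in> ordC 2"
    by (rule mult'[OF S(1) S(1)], simp, rule mult'[OF S(2) S(2)], simp, rule mult'[OF S(3) S(3)], simp)
  have "(S23 * S23 - S12 * S12 + S13 * S13) * (S23 * S23 - S12 * S12 + S13 * S13) \<in> ordC 2"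
    by (rule mult'[OF _ any, of _ 2]) (intro add diff SS, simp)
  moreover have "4 * (S23 * S23) * (1 - S13 * S13) \<in> ordC 2"
    by (rule mult'[OF mult'[OF any SS(3)] any]) simp_all
  ultimately have "DS \<in> ordC 2" unfolding DS_def power2_eq_square by (rule add)
  hence D: "DS * w ^ 2 \<in> ordC 2" by (rule mult'[OF _ any]) simp
  show ?thesis
  proof (induction K)
    case (Suc K)
    show ?case by (subst power_Suc) (rule mult'[OF D Suc], simp)
  qed (simp add: D)
qed

text \<open>The fundamental theorem applied to \<open>atanh_sum K w\<close> with K = |m|, where the
  truncation error is invisible.\<close>

lemma rhs_identity:
  "poly_integral (top_part (theta_series $ 0) $ m1 $ m2 $ m3) = kap * (kap ^ 2 - 1) * Omega_rhs m1 m2 m3"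
proof -
  define K where "K = m1 + m2 + m3"
  have "mobius_den $ 0 $ 0 $ 0 * [:inverse 2:] = 1"
  proof -
    have "(2 :: ratf) \<noteq> 0" using ratf_of_nat_nonzero[of 1] by simp
    moreover have "mobius_den $ 0 $ 0 $ 0 = [:2:]"
      by (simp add: mobius_den_def S12_def S13_def S23_def numeral_poly)
    ultimately show ?thesis by (simp add: one_pCons)
  qed
  then obtain Ni where Ni: "mobius_den * Ni = 1" by (rule fps3_unit)
  define w where "w = TH * Ni"
  have w: "w * mobius_den = TH" using Ni by (simp add: w_def mult.assoc mult.commute[of Ni])
  have "(dS (atanh_sum K w)) $ m1 $ m2 $ m3
      = top_part (theta_series $ 0) $ m1 $ m2 $ m3 - (top_part (theta_series $ 0) * (DS * w ^ 2) ^ Suc K) $ m1 $ m2 $ m3"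
    unfolding atanh_sum_antiderivative[OF w] by (simp add: right_diff_distrib)
  moreover have "(top_part (theta_series $ 0) * (DS * w ^ 2) ^ Suc K) \<in> ordC (2 * int K + 2)"
    by (rule filtration.mult'[OF filtration_ordC _ DS_power_in_ordC, of _ 0]) (simp_all add: in_ordC_iff)
  hence "(top_part (theta_series $ 0) * (DS * w ^ 2) ^ Suc K) $ m1 $ m2 $ m3 = 0"
    unfolding in_ordC_iff K_def by auto
  ultimately have "top_part (theta_series $ 0) $ m1 $ m2 $ m3 = pderiv (atanh_sum K w $ m1 $ m2 $ m3)"
    by (simp add: dS_def)
  hence int: "poly_integral (top_part (theta_series $ 0) $ m1 $ m2 $ m3)
      = evS 1 (atanh_sum K w) $ m1 $ m2 $ m3 - evS 0 (atanh_sum K w) $ m1 $ m2 $ m3"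
    by (simp add: poly_integral_pderiv evS_nth)
  have ev: "evS x (atanh_sum K w) = (\<Sum>k\<le>K. emb3 (2 * inverse (of_nat (2 * k + 1))) * DD ^ k * evS x w ^ Suc (2 * k))" for x
    unfolding atanh_sum_def hom_sum[OF is_hom_evS] hom_mult[OF is_hom_evS] hom_power[OF is_hom_evS]
      evS_DS evS_simps ..
  \<comment> \<open>The lower endpoint contributes nothing, since w vanishes at \<theta> =
    0.\<close>
  have "emb3 0 = 0" by (simp add: emb3_def)
  hence "evS 0 w = 0" by (simp add: w_def hom_mult[OF is_hom_evS] evS_simps)
  hence ev0: "evS 0 (atanh_sum K w) = 0" unfolding ev by simp
  \<comment> \<open>At the upper endpoint the denominator is -s, so w = -1/s.\<close>
  have "emb3 1 = 1" by (simp add: emb3_def)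
  hence N1: "evS 1 mobius_den = - ss"
    unfolding mobius_den_def ss_def by (simp add: hom_simps[OF is_hom_evS] evS_simps algebra_simps power2_eq_square)
  have "evS 1 w * evS 1 mobius_den = 1"
    using arg_cong[OF w, of "evS 1"] \<open>emb3 1 = 1\<close> by (simp add: hom_mult[OF is_hom_evS] evS_simps)
  hence "ss * (- evS 1 w) = 1" unfolding N1 by (simp add: mult.commute)
  hence ri: "ring_inv ss = - evS 1 w" by (rule ring_inv_eqI)
  have emb3_mult: "emb3 (a * b) = emb3 a * emb3 b" for a b by (simp add: emb3_def)
  have k0: "kap * (kap ^ 2 - 1) \<noteq> 0" using kap_nonzero kap_square by simp
  have "kap * (kap ^ 2 - 1) * rhs_term k $ m1 $ m2 $ m3
    = (emb3 (2 * inverse (of_nat (2 * k + 1))) * DD ^ k * evS 1 w ^ Suc (2 * k)) $ m1 $ m2 $ m3" for k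
  proof -
    \<comment> \<open>The odd power produces the sign that turns the factor -2 of
      \<open>rhs_term\<close> into 2.\<close>
    have "(- evS 1 w) ^ Suc (2 * k) = - (evS 1 w ^ Suc (2 * k))" by simp
    hence "emb3 (kap * (kap ^ 2 - 1)) * rhs_term k
      = emb3 (kap * (kap ^ 2 - 1) * (-2 / (kap * (kap^2 - 1)))) * emb3 (inverse (of_nat (2 * k + 1)))
        * DD ^ k * (- (evS 1 w ^ Suc (2 * k)))"
      unfolding rhs_term_def ri emb3_mult by (simp only: Suc_eq_plus1 mult.assoc)
    also have "kap * (kap ^ 2 - 1) * (-2 / (kap * (kap^2 - 1))) = - 2" using k0 by simp
    also have "emb3 (- 2) * emb3 (inverse (of_nat (2 * k + 1))) * DD ^ k * (- (evS 1 w ^ Suc (2 * k)))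
      = emb3 (2 * inverse (of_nat (2 * k + 1))) * DD ^ k * evS 1 w ^ Suc (2 * k)"
    proof -
      have "emb3 (- 2) = - emb3 2" by (simp add: emb3_def)
      thus ?thesis unfolding emb3_mult by (simp only: mult_minus_left mult_minus_right minus_minus)
    qed
    finally have "(emb3 (kap * (kap ^ 2 - 1)) * rhs_term k) $ m1 $ m2 $ m3
      = (emb3 (2 * inverse (of_nat (2 * k + 1))) * DD ^ k * evS 1 w ^ Suc (2 * k)) $ m1 $ m2 $ m3"
      by (rule arg_cong)
    thus ?thesis by (simp only: emb3_def fps_mult_left_const_nth)
  qed
  hence "kap * (kap ^ 2 - 1) * Omega_rhs m1 m2 m3
    = (\<Sum>k\<le>K. (emb3 (2 * inverse (of_nat (2 * k + 1))) * DD ^ k * evS 1 w ^ Suc (2 * k)) $ m1 $ m2 $ m3)"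
    unfolding Omega_rhs_def sum_distrib_left K_def by (simp only:)
  also have "\<dots> = evS 1 (atanh_sum K w) $ m1 $ m2 $ m3"
    unfolding ev by (simp only: fps_sum_nth)
  finally show ?thesis unfolding int ev0 by simp
qed

theorem mainTheorem17:
  shows "\<forall>m1 m2 m3. Omega_minus m1 m2 m3 = Omega_rhs m1 m2 m3"
proof (intro allI)
  fix m1 m2 m3
  have "kap * (kap ^ 2 - 1) \<noteq> 0" using kap_nonzero kap_square by simp
  thus "Omega_minus m1 m2 m3 = Omega_rhs m1 m2 m3"
    unfolding Omega_minus_integral rhs_identity by simp
qed

end
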